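(* Let $K$ be a p.c.f. self-similar set generated by an IFS $F_i(x)=\rho(x-b_i)+b_i$, $1\le i\le N$, on $\mathbb R^d$ with $0<\rho<1$. Assume that the asymptotic geometric growth rates $R(p,q)$ $(>1)$ exist for all $p\ne q$ in $V_0$, and let $R^*=\min\{R(p,q):p\neq q,\ p,q\in V_0\}$. Suppose there is a compatible relation on $V_0$ with property (B) which satisfies: (i) for each non-trivial boundary class $J$ of $V_*$ and for any function $u$ on $J\cap V_0$, there is an extension of $u$ to $J$ such that $\sup_{n\ge0}(R^* )^nE_{J,n}(u)<\infty$; (ii) for any two distinct equivalence classes $J_i,J_j$ of $V_0$, the growth rate $R^\sim(J_i,J_j)$ exists and satisfies $R^\sim(J_i,J_j)>R^*$. Then $B^{\sigma^*}_{2,\infty}$ is dense in $C(K)$.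
   Context: **P.c.f. setting.** $K=\bigcup_{i=1}^NF_i(K)$ is the nonempty compact self-similar set, assumed connected. For a word $\omega=\omega_1\cdots\omega_n\in\{1,\dots,N\}^n$, $|\omega|=n$, put $F_\omega=F_{\omega_1}\circ\cdots\circ F_{\omega_n}$, $K_\omega=F_\omega(K)$. Let $\pi:\{1,\dots,N\}^{\infty}\to K$ be $\{\pi(\omega)\}=\bigcap_nK_{\omega_1\cdots\omega_n}$, $\tau$ the left shift, $\mathcal C=\pi^{-1}(\bigcup_{i<j}(K_i\cap K_j))$ and $\mathcal P=\bigcup_{m\ge1}\tau^m(\mathcal C)$. The IFS (and $K$) is p.c.f. if $\mathcal P$ is finite. The boundary is $V_0=\pi(\mathcal P)$, assumed to have at least two points; $V_n=\bigcup_iF_i(V_{n-1})$, $V_*=\bigcup_nV_n$, and $V_\omega=F_\omega(V_0)$, $|\omega|=n$, is an $n$-cell. Let $\alpha=\log N/|\log\rho|=\dim_HK$ and let $\mu$ be the self-similar measure $\mu=\frac1N\sum_i\mu\circ F_i^{-1}$ (the normalized $\alpha$-Hausdorff measure). **Besov spaces.** For $\sigma>0$, $[u]^2_{B^\sigma_{2,\infty}}=\sup_{0<r<1}r^{-\alpha-2\sigma}\int_K\int_{B(x,r)}|u(x)-u(y)|^2d\mu(y)d\mu(x)$ and $B^\sigma_{2,\infty}=\{u\in L^2(K,\mu):\|u\|_2+[u]_{B^\sigma_{2,\infty}}<\infty\}$. When $2\sigma>\alpha$, elements of $B^\sigma_{2,\infty}$ have continuous representatives and $B^\sigma_{2,\infty}$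 is regarded as a subset of $C(K)$. $\sigma^*=\sup\{\sigma: B^\sigma_{2,\infty}\cap C(K)\text{ is dense in }C(K)\}$ (sup norm). **Primal energy and traces.** For $u:V_n\to\mathbb R$, $E_n[u]=\sum_{|\omega|=n}\sum_{\{x,y\}\subset V_\omega}|u(x)-u(y)|^2$ (unordered pairs). The trace $R_n(p,q)$, $p\neq q\in V_0$, is defined by: for all $u:V_0\to\mathbb R$, $\min\{E_n[v]: v:V_n\to\mathbb R,\ v|_{V_0}=u\}=\sum_{\{p,q\}\subset V_0}\frac1{R_n(p,q)}|u(p)-u(q)|^2$. An increasing sequence $(R_n)$ of positive reals has asymptotic geometric growth rate $R>1$ if for every $\varepsilon>0$ there is $N(\varepsilon)$ with $R^{(1-\varepsilon)n}\le R_n\le R^{(1+\varepsilon)n}$ for all $n\ge N(\varepsilon)$; $R(p,q)$ denotes the rate of $(R_n(p,q))_n$. **Compatible relations and quotient traces.** Let $\sim\,=\,\sim_0$ be an equivalence relation on $V_0$ with at least two classes. Let $\sim_n$ be the smallest equivalence relation on $V_n$ such that (1) $x\sim_{n-1}y$ in $V_{n-1}$ implies $x\sim_ny$; (2) $x\sim_{n-1}y$ in $V_{n-1}$ implies $F_i(x)\sim_nF_i(y)$ for $1\le i\le N$. The relation $\sim$ is compatible if for all $n\ge0$ and $x,y\in V_n$: $x\sim_ny$ iff $x\sim_{n+1}y$. It then induces an equivalence relation on $V_*$ ($x\sim y$ iff $x\sim_ny$ for $n$ with $x,y\in V_n$). A class $J$ of $V_n$ or $V_*$ is a boundary class if $J\cap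 V_0\ne\emptyset$, and non-trivial if it contains more than one point. Property (B): any $1$-cell intersects at most one boundary class in $V_1$. $V_n^\sim$ is the set of $\sim_n$-classes; functions on $V_n^\sim$ are identified with functions on $V_n$ constant on classes. The quotient trace $R_n^\sim(J_i,J_j)$ is defined by: for all $u:V_0^\sim\to\mathbb R$, $\min\{E_n[v]: v:V_n^\sim\to\mathbb R,\ v|_{V_0}=u\}=\sum_{\{J_i,J_j\}\subset V_0^\sim}\frac1{R^\sim_n(J_i,J_j)}|u(J_i)-u(J_j)|^2$, and $R^\sim(J_i,J_j)$ is the asymptotic geometric growth rate of $(R_n^\sim(J_i,J_j))_n$, if it exists. For a class $J$ and $u$ defined on $J$, $E_{J,n}(u)=\sum_{|\omega|=n}\sum_{\{x,y\}\subset J\cap V_\omega}|u(x)-u(y)|^2$. *)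

theory Defs
  imports "HOL-Analysis.Analysis"
begin

text \<open>
  An iterated function system is a family F i, where i ranges over {1..N}; finite words are lists
  and infinite words are functions on nat, indexed from 0.  Real functions on a subset of
  the ambient space are total functions of which only the values on that subset matter.
\<close>

definition self_similar_set :: "nat \<Rightarrow> (nat \<Rightarrow> 'a \<Rightarrow> 'a) \<Rightarrow> 'a::topological_space set \<Rightarrow> bool" where
  "self_similar_set N F K \<longleftrightarrow> compact K \<and> K \<noteq> {} \<and> K = (\<Union>i\<in>{1..N}. F i ` K)"

definition words :: "nat \<Rightarrow> nat \<Rightarrow> nat list set" where
  "words N n = {w. set w \<subseteq> {1..N} \<and> length w = n}"

definition word_map :: "(nat \<Rightarrow> 'a \<Rightarrow> 'a) \<Rightarrow> nat list \<Rightarrow> 'a \<Rightarrow> 'a" where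
  "word_map F w = foldr (\<lambda>i g. F i \<circ> g) w id"

definition inf_words :: "nat \<Rightarrow> (nat \<Rightarrow> nat) set" where
  "inf_words N = {\<omega>. \<forall>k. \<omega> k \<in> {1..N}}"

definition coding :: "(nat \<Rightarrow> 'a \<Rightarrow> 'a) \<Rightarrow> 'a set \<Rightarrow> (nat \<Rightarrow> nat) \<Rightarrow> 'a" where
  "coding F K \<omega> = (THE x. x \<in> (\<Inter>n. word_map F (map \<omega> [0..<n]) ` K))"

definition shift :: "(nat \<Rightarrow> nat) \<Rightarrow> nat \<Rightarrow> nat" where
  "shift \<omega> = (\<lambda>k. \<omega> (Suc k))"

definition critical_set :: "nat \<Rightarrow> (nat \<Rightarrow> 'a \<Rightarrow> 'a) \<Rightarrow> 'a set \<Rightarrow> (nat \<Rightarrow> nat) set" where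
  "critical_set N F K =
     {\<omega> \<in> inf_words N. \<exists>i\<in>{1..N}. \<exists>j\<in>{1..N}. i < j \<and> coding F K \<omega> \<in> F i ` K \<inter> F j ` K}"

definition post_critical_set :: "nat \<Rightarrow> (nat \<Rightarrow> 'a \<Rightarrow> 'a) \<Rightarrow> 'a set \<Rightarrow> (nat \<Rightarrow> nat) set" where
  "post_critical_set N F K = (\<Union>m\<in>{1..}. (shift ^^ m) ` critical_set N F K)"

definition pcf :: "nat \<Rightarrow> (nat \<Rightarrow> 'a \<Rightarrow> 'a) \<Rightarrow> 'a set \<Rightarrow> bool" where
  "pcf N F K \<longleftrightarrow> finite (post_critical_set N F K)"

primrec vertices :: "nat \<Rightarrow> (nat \<Rightarrow> 'a \<Rightarrow> 'a) \<Rightarrow> 'a set \<Rightarrow> nat \<Rightarrow> 'a set" where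
  "vertices N F K 0 = coding F K ` post_critical_set N F K"
| "vertices N F K (Suc n) = (\<Union>i\<in>{1..N}. F i ` vertices N F K n)"

definition all_vertices :: "nat \<Rightarrow> (nat \<Rightarrow> 'a \<Rightarrow> 'a) \<Rightarrow> 'a set \<Rightarrow> 'a set" where
  "all_vertices N F K = (\<Union>n. vertices N F K n)"

definition cell :: "nat \<Rightarrow> (nat \<Rightarrow> 'a \<Rightarrow> 'a) \<Rightarrow> 'a set \<Rightarrow> nat list \<Rightarrow> 'a set" where
  "cell N F K w = word_map F w ` vertices N F K 0"

text \<open>The measure lives on K itself: its space is K and its measurable sets are the Borel subsets of K.\<close>

definition self_similar_measure ::
  "nat \<Rightarrow> (nat \<Rightarrow> 'a \<Rightarrow> 'a) \<Rightarrow> 'a::topological_space set \<Rightarrow> 'a measure \<Rightarrow> bool" where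
  "self_similar_measure N F K \<mu> \<longleftrightarrow>
     sets \<mu> = sets (restrict_space borel K) \<and> emeasure \<mu> K = 1 \<and>
     (\<forall>A\<in>sets \<mu>. emeasure \<mu> A = (\<Sum>i=1..N. emeasure \<mu> (F i -` A \<inter> K)) / of_nat N)"

definition besov_seminorm_sq ::
  "'a::metric_space measure \<Rightarrow> real \<Rightarrow> real \<Rightarrow> ('a \<Rightarrow> real) \<Rightarrow> ennreal" where
  "besov_seminorm_sq \<mu> \<alpha> \<sigma> u =
     (SUP r\<in>{0<..<1}. ennreal (r powr (- \<alpha> - 2 * \<sigma>)) *
        (\<integral>\<^sup>+x. (\<integral>\<^sup>+y. ennreal (\<bar>u x - u y\<bar>\<^sup>2) * indicator (ball x r) y \<partial>\<mu>) \<partial>\<mu>))"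

definition besov :: "'a::metric_space measure \<Rightarrow> real \<Rightarrow> real \<Rightarrow> ('a \<Rightarrow> real) set" where
  "besov \<mu> \<alpha> \<sigma> = {u. u \<in> borel_measurable \<mu> \<and> integrable \<mu> (\<lambda>x. (u x)\<^sup>2) \<and>
                      besov_seminorm_sq \<mu> \<alpha> \<sigma> u < \<infinity>}"

text \<open>
  Membership in besov is invariant under changes on null sets, so
  intersecting with the continuous functions on K picks exactly the continuous representatives.
\<close>

definition besov_cont ::
  "'a::metric_space set \<Rightarrow> 'a measure \<Rightarrow> real \<Rightarrow> real \<Rightarrow> ('a \<Rightarrow> real) set" where
  "besov_cont K \<mu> \<alpha> \<sigma> = besov \<mu> \<alpha> \<sigma> \<inter> {u. continuous_on K u}"

definition dense_in_C :: "'a::topological_space set \<Rightarrow> ('a \<Rightarrow> real) set \<Rightarrow> bool" where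
  "dense_in_C K B \<longleftrightarrow>
     B \<subseteq> {u. continuous_on K u} \<and>
     (\<forall>f. continuous_on K f \<longrightarrow> (\<forall>\<epsilon>>0. \<exists>u\<in>B. \<forall>x\<in>K. \<bar>f x - u x\<bar> < \<epsilon>))"

text \<open>
  For a connected p.c.f. set with at least two boundary points the set below is nonempty and bounded above, so the
  supremum in the reals is the genuine one.
\<close>

definition critical_exponent :: "'a::metric_space set \<Rightarrow> 'a measure \<Rightarrow> real \<Rightarrow> real" where
  "critical_exponent K \<mu> \<alpha> = Sup {\<sigma>. 0 < \<sigma> \<and> dense_in_C K (besov_cont K \<mu> \<alpha> \<sigma>)}"

text \<open>A sum over unordered pairs is half the sum over ordered pairs; the diagonal contributes 0.\<close>

definition pair_energy :: "'a set \<Rightarrow> ('a \<Rightarrow> real) \<Rightarrow> real" where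
  "pair_energy A u = (1/2) * (\<Sum>x\<in>A. \<Sum>y\<in>A. \<bar>u x - u y\<bar>\<^sup>2)"

definition energy ::
  "nat \<Rightarrow> (nat \<Rightarrow> 'a \<Rightarrow> 'a) \<Rightarrow> 'a set \<Rightarrow> nat \<Rightarrow> ('a \<Rightarrow> real) \<Rightarrow> real" where
  "energy N F K n u = (\<Sum>w\<in>words N n. pair_energy (cell N F K w) u)"

definition class_energy ::
  "nat \<Rightarrow> (nat \<Rightarrow> 'a \<Rightarrow> 'a) \<Rightarrow> 'a set \<Rightarrow> 'a set \<Rightarrow> nat \<Rightarrow> ('a \<Rightarrow> real) \<Rightarrow> real" where
  "class_energy N F K J n u = (\<Sum>w\<in>words N n. pair_energy (J \<inter> cell N F K w) u)"

definition network_form :: "'b set \<Rightarrow> ('b \<Rightarrow> 'b \<Rightarrow> real) \<Rightarrow> ('b \<Rightarrow> real) \<Rightarrow> real" where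
  "network_form S R u = (1/2) * (\<Sum>p\<in>S. \<Sum>q\<in>S. 1 / R p q * \<bar>u p - u q\<bar>\<^sup>2)"

definition is_minimum :: "real \<Rightarrow> real set \<Rightarrow> bool" where
  "is_minimum m S \<longleftrightarrow> m \<in> S \<and> (\<forall>s\<in>S. m \<le> s)"

text \<open>
  As R is symmetric, the minimisation identity determines the values R p q for distinct p, q in
  the vertex set.
\<close>

definition is_trace ::
  "nat \<Rightarrow> (nat \<Rightarrow> 'a \<Rightarrow> 'a) \<Rightarrow> 'a set \<Rightarrow> nat \<Rightarrow> ('a \<Rightarrow> 'a \<Rightarrow> real) \<Rightarrow> bool" where
  "is_trace N F K n R \<longleftrightarrow>
     (\<forall>p\<in>vertices N F K 0. \<forall>q\<in>vertices N F K 0. R p q = R q p) \<and>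
     (\<forall>u. is_minimum (network_form (vertices N F K 0) R u)
            {energy N F K n v | v. \<forall>x\<in>vertices N F K 0. v x = u x})"

definition has_growth_rate :: "(nat \<Rightarrow> real) \<Rightarrow> real \<Rightarrow> bool" where
  "has_growth_rate r R \<longleftrightarrow> incseq r \<and> (\<forall>n. 0 < r n) \<and> 1 < R \<and>
     (\<forall>\<epsilon>>0. \<exists>M. \<forall>n\<ge>M. R powr ((1 - \<epsilon>) * real n) \<le> r n \<and> r n \<le> R powr ((1 + \<epsilon>) * real n))"

primrec level_rel ::
  "nat \<Rightarrow> (nat \<Rightarrow> 'a \<Rightarrow> 'a) \<Rightarrow> 'a set \<Rightarrow> ('a \<times> 'a) set \<Rightarrow> nat \<Rightarrow> ('a \<times> 'a) set" where
  "level_rel N F K E 0 = E"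
| "level_rel N F K E (Suc n) =
     \<Inter>{S. equiv (vertices N F K (Suc n)) S \<and> level_rel N F K E n \<subseteq> S \<and>
         (\<forall>i\<in>{1..N}. \<forall>(x, y)\<in>level_rel N F K E n. (F i x, F i y) \<in> S)}"

definition compatible ::
  "nat \<Rightarrow> (nat \<Rightarrow> 'a \<Rightarrow> 'a) \<Rightarrow> 'a set \<Rightarrow> ('a \<times> 'a) set \<Rightarrow> bool" where
  "compatible N F K E \<longleftrightarrow>
     (\<forall>n. \<forall>x\<in>vertices N F K n. \<forall>y\<in>vertices N F K n.
        (x, y) \<in> level_rel N F K E n \<longleftrightarrow> (x, y) \<in> level_rel N F K E (Suc n))"

definition limit_rel ::
  "nat \<Rightarrow> (nat \<Rightarrow> 'a \<Rightarrow> 'a) \<Rightarrow> 'a set \<Rightarrow> ('a \<times> 'a) set \<Rightarrow> ('a \<times> 'a) set" where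
  "limit_rel N F K E =
     {(x, y). \<exists>n. x \<in> vertices N F K n \<and> y \<in> vertices N F K n \<and> (x, y) \<in> level_rel N F K E n}"

definition boundary_class :: "nat \<Rightarrow> (nat \<Rightarrow> 'a \<Rightarrow> 'a) \<Rightarrow> 'a set \<Rightarrow> 'a set \<Rightarrow> bool" where
  "boundary_class N F K J \<longleftrightarrow> J \<inter> vertices N F K 0 \<noteq> {}"

definition nontrivial_class :: "'a set \<Rightarrow> bool" where
  "nontrivial_class J \<longleftrightarrow> (\<exists>x\<in>J. \<exists>y\<in>J. x \<noteq> y)"

definition property_B ::
  "nat \<Rightarrow> (nat \<Rightarrow> 'a \<Rightarrow> 'a) \<Rightarrow> 'a set \<Rightarrow> ('a \<times> 'a) set \<Rightarrow> bool" where
  "property_B N F K E \<longleftrightarrow>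
     (\<forall>w\<in>words N 1. \<forall>J\<in>vertices N F K 1 // level_rel N F K E 1.
        \<forall>J'\<in>vertices N F K 1 // level_rel N F K E 1.
          boundary_class N F K J \<longrightarrow> boundary_class N F K J' \<longrightarrow>
          cell N F K w \<inter> J \<noteq> {} \<longrightarrow> cell N F K w \<inter> J' \<noteq> {} \<longrightarrow> J = J')"

definition is_quotient_trace ::
  "nat \<Rightarrow> (nat \<Rightarrow> 'a \<Rightarrow> 'a) \<Rightarrow> 'a set \<Rightarrow> ('a \<times> 'a) set \<Rightarrow> nat \<Rightarrow> ('a set \<Rightarrow> 'a set \<Rightarrow> real) \<Rightarrow> bool"
  where
  "is_quotient_trace N F K E n R \<longleftrightarrow>
     (\<forall>I\<in>vertices N F K 0 // E. \<forall>J\<in>vertices N F K 0 // E. R I J = R J I) \<and>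
     (\<forall>u. is_minimum (network_form (vertices N F K 0 // E) R u)
            {energy N F K n v | v. v respects level_rel N F K E n \<and>
                                   (\<forall>J\<in>vertices N F K 0 // E. \<forall>x\<in>J. v x = u J)})"

end

theory Submission
  imports Defs
begin

text \<open>
  Put \<open>\<kappa> = 1 / Rstar\<close> and let \<open>\<sigma>0\<close> be the exponent with \<open>\<rho> powr (2 * \<sigma>0 - \<alpha>) = \<kappa>\<close>.  The proof shows that
  \<open>\<sigma>0\<close> is the critical exponent and that the Besov space of order \<open>\<sigma>0\<close> is dense.

  The link between the two sides is that, for a continuous function \<open>u\<close> and \<open>\<alpha> < 2 * \<sigma>\<close>, the Besov seminorm of
  order \<open>\<sigma>\<close> is finite exactly when the energies of \<open>u\<close> on the vertices of level \<open>n\<close> are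
  \<open>O((\<rho> powr (2 * \<sigma> - \<alpha>)) ^ n)\<close> (\<open>energy_of_besov_cont\<close>, \<open>besov_cont_of_energy\<close>).  One direction writes a
  vertex value as the limit of averages over shrinking cells.  The other one rests on the geometric fact
  \<open>cells_separated\<close>: points at distance less than a small multiple of \<open>\<rho> ^ n\<close> lie in cells of level \<open>n\<close>
  with a common vertex.  It holds because all maps of level \<open>n\<close> are translates of one homothety, so that
  touching cells have only finitely many relative positions.

  Above \<open>\<sigma>0\<close> the space is not dense (\<open>not_dense_above\<close>).  If \<open>p\<close>, \<open>q\<close> realise \<open>Rstar\<close>, then
  \<open>(u p - u q)\<^sup>2\<close> is at most a constant times the trace at level \<open>n\<close> times the energy of level \<open>n\<close>; the trace
  grows like \<open>Rstar ^ n\<close> and the energy decays faster, so every member of the space has equal values at \<open>p\<close> and \<open>q\<close>.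

  At \<open>\<sigma>0\<close> it is enough to extend each function on \<open>V 0\<close> to all vertices with energies \<open>O(\<kappa> ^ n)\<close>
  (\<open>finite_energy_dense\<close>): truncation at the extreme boundary values does not raise the energy, the energy bound
  gives uniform continuity, and rescaled copies of such extensions, glued along the cells of a fine level, approximate
  a given continuous function.

  The extension (\<open>finite_energy_extension\<close>) is where the relation enters.  Boundary values that are constant on
  classes are extended by iterating the minimiser of the quotient trace at one fixed level; by the second hypothesis
  the energy then decays like \<open>\<tau> ^ n\<close> for some \<open>\<tau> < \<kappa>\<close> (\<open>saturated_extension\<close>).  For arbitrary boundary values
  the first hypothesis prescribes a function \<open>v\<close> on the union of the boundary classes.  By property (B) each cell of positive
  level meets at most one of them, so that inside a cell \<open>w\<close> the function \<open>v\<close> is a constant, its value at a base point, plus a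
  small oscillation.  The constant is carried into the interior by a cutoff that is 1 on the boundary class and 0
  on the other vertices of the cell.  Passing from a cell to its children changes the constant by a jump, and the
  squares of the jumps of level \<open>n\<close> sum to \<open>O(\<kappa> ^ n)\<close>.  Since the cutoffs lose energy faster than \<open>\<kappa> ^ n\<close>,
  the contributions of all levels form a geometric series, and the sum is again \<open>O(\<kappa> ^ n)\<close>.
\<close>

section \<open>Words and codings\<close>

lemma words_0: "words N 0 = {[]}"
  by (auto simp: words_def)

lemma words_Suc: "words N (Suc n) = (\<lambda>(i, w). i # w) ` ({1..N} \<times> words N n)"
  by (auto simp: words_def length_Suc_conv image_iff)

lemma finite_words: "finite (words N n)"
  unfolding words_def by (rule finite_lists_length_eq) simp

lemma append_in_words: "v \<in> words N n \<Longrightarrow> w \<in> words N m \<Longrightarrow> v @ w \<in> words N (n + m)"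
  by (auto simp: words_def)

lemma words_add: "words N (n + m) = (\<lambda>(v, w). v @ w) ` (words N n \<times> words N m)"
proof
  show "words N (n + m) \<subseteq> (\<lambda>(v, w). v @ w) ` (words N n \<times> words N m)"
  proof
    fix w assume w: "w \<in> words N (n + m)"
    have "take n w \<in> words N n" "drop n w \<in> words N m"
      using w by (auto simp: words_def dest: in_set_takeD in_set_dropD)
    then show "w \<in> (\<lambda>(v, w). v @ w) ` (words N n \<times> words N m)"
      by (intro image_eqI[where x = "(take n w, drop n w)"]) auto
  qed
qed (auto simp: append_in_words)

lemma sum_words_add:
  fixes f :: "nat list \<Rightarrow> 'b::comm_monoid_add"
  shows "(\<Sum>w\<in>words N (n + m). f w) = (\<Sum>v\<in>words N n. \<Sum>w\<in>words N m. f (v @ w))"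
proof -
  have inj: "inj_on (\<lambda>(v, w). v @ w) (words N n \<times> words N m)"
    by (auto simp: inj_on_def words_def)
  have "(\<Sum>w\<in>words N (n + m). f w) = (\<Sum>z\<in>words N n \<times> words N m. f (fst z @ snd z))"
    unfolding words_add by (subst sum.reindex[OF inj]) (simp add: case_prod_unfold)
  also have "\<dots> = (\<Sum>v\<in>words N n. \<Sum>w\<in>words N m. f (v @ w))"
    by (simp add: sum.cartesian_product case_prod_unfold)
  finally show ?thesis .
qed

lemma words_1: "words N (Suc 0) = (\<lambda>i. [i]) ` {1..N}"
  by (auto simp: words_Suc words_0 image_iff)

lemma sum_words_Suc:
  fixes f :: "nat list \<Rightarrow> 'b::comm_monoid_add"
  shows "(\<Sum>w\<in>words N (Suc n). f w) = (\<Sum>v\<in>words N n. \<Sum>i=1..N. f (v @ [i]))"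
proof -
  have "(\<Sum>w\<in>words N (Suc 0). g w) = (\<Sum>i=1..N. g [i])" for g :: "nat list \<Rightarrow> 'b"
    unfolding words_1 by (subst sum.reindex) (auto simp: inj_on_def)
  then show ?thesis using sum_words_add[of f N n "Suc 0"] by simp
qed

lemma card_words: "card (words N n) = N ^ n"
  unfolding words_def using card_lists_length_eq[of "{1..N}" n] by simp

lemma snoc_word_cases:
  assumes "w \<in> words N (Suc n)"
  obtains v i where "v \<in> words N n" "i \<in> {1..N}" "w = v @ [i]"
  using assms words_add[of N n "Suc 0"] unfolding words_1 by auto

lemma word_map_Nil [simp]: "word_map F [] = id"
  by (simp add: word_map_def)

lemma word_map_Cons [simp]: "word_map F (i # w) = F i \<circ> word_map F w"
  by (simp add: word_map_def)

lemma word_map_append: "word_map F (v @ w) = word_map F v \<circ> word_map F w"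
  by (induction v) (auto simp: comp_assoc)

lemma shift_case_nat [simp]: "shift (case_nat i \<omega>) = \<omega>"
  by (auto simp: shift_def)

lemma map_case_nat_upt: "map (case_nat i \<omega>) [0..<Suc n] = i # map \<omega> [0..<n]"
  by (simp add: map_upt_Suc del: upt_Suc)

definition prepend :: "nat list \<Rightarrow> (nat \<Rightarrow> nat) \<Rightarrow> nat \<Rightarrow> nat" where
  "prepend w \<omega> = foldr case_nat w \<omega>"

lemma prepend_simps [simp]: "prepend [] \<omega> = \<omega>" "prepend (i # w) \<omega> = case_nat i (prepend w \<omega>)"
  by (auto simp: prepend_def)

lemma shift_prepend: "(shift ^^ length w) (prepend w \<omega>) = \<omega>"
  by (induction w) (auto simp: funpow_swap1[of shift] simp del: funpow.simps simp: funpow_Suc_right)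

lemma case_nat_in_inf_words: "i \<in> {1..N} \<Longrightarrow> \<omega> \<in> inf_words N \<Longrightarrow> case_nat i \<omega> \<in> inf_words N"
  by (auto simp: inf_words_def split: nat.split)

lemma prepend_in_inf_words: "set w \<subseteq> {1..N} \<Longrightarrow> \<omega> \<in> inf_words N \<Longrightarrow> prepend w \<omega> \<in> inf_words N"
  by (induction w) (auto intro!: case_nat_in_inf_words)

lemma map_prepend_upt: "map (prepend w \<omega>) [0..<length w] = w"
  by (induction w) (auto simp: map_case_nat_upt simp del: upt_Suc)

section \<open>Cells and vertices of a homogeneous p.c.f. set\<close>

locale homogeneous_pcf =
  fixes N :: nat and \<rho> :: real and b :: "nat \<Rightarrow> 'a::euclidean_space"
    and F :: "nat \<Rightarrow> 'a \<Rightarrow> 'a" and K :: "'a set"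
  assumes rho: "0 < \<rho>" "\<rho> < 1"
    and F_eq: "\<And>i x. F i x = \<rho> *\<^sub>R (x - b i) + b i"
    and self_similar: "self_similar_set N F K"
    and connected_K: "connected K"
    and pcf: "pcf N F K"
    and card_V0: "2 \<le> card (vertices N F K 0)"
begin

abbreviation "P \<equiv> post_critical_set N F K"
abbreviation "V \<equiv> vertices N F K"
abbreviation "Vs \<equiv> all_vertices N F K"
abbreviation "Fw \<equiv> word_map F"
abbreviation "W \<equiv> words N"

lemma Fw_diff: "Fw w x - Fw w y = \<rho> ^ length w *\<^sub>R (x - y)"
proof (induction w)
  case (Cons i w)
  have "Fw (i # w) x - Fw (i # w) y = \<rho> *\<^sub>R (Fw w x - Fw w y)"
    by (simp add: F_eq algebra_simps)
  then show ?case using Cons by simp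
qed simp

lemma dist_Fw: "dist (Fw w x) (Fw w y) = \<rho> ^ length w * dist x y"
  using rho by (simp add: dist_norm Fw_diff)

lemma Fw_inj: "Fw w x = Fw w y \<longleftrightarrow> x = y"
  using rho Fw_diff[of w x y] by auto

lemma inj_Fw: "inj_on (Fw w) A"
  by (auto simp: inj_on_def Fw_inj)

lemma continuous_Fw: "continuous_on A (Fw w)"
proof -
  have "Fw w x = \<rho> ^ length w *\<^sub>R x + Fw w 0" for x
    using Fw_diff[of w x 0] by (simp add: algebra_simps)
  then have "Fw w = (\<lambda>x. \<rho> ^ length w *\<^sub>R x + Fw w 0)" by blast
  moreover have "continuous_on A (\<lambda>x. \<rho> ^ length w *\<^sub>R x + Fw w 0)" by (intro continuous_intros)
  ultimately show ?thesis by metis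
qed

lemma F_inj: "F i x = F i y \<longleftrightarrow> x = y"
  using Fw_inj[of "[i]"] by simp

lemma compact_K: "compact K" and K_nonempty: "K \<noteq> {}" and K_eq: "K = (\<Union>i\<in>{1..N}. F i ` K)"
  using self_similar unfolding self_similar_set_def by auto

lemma F_in_K: "i \<in> {1..N} \<Longrightarrow> x \<in> K \<Longrightarrow> F i x \<in> K"
  using K_eq by blast

lemma Fw_in_K: "set w \<subseteq> {1..N} \<Longrightarrow> x \<in> K \<Longrightarrow> Fw w x \<in> K"
  by (induction w) (auto intro: F_in_K)

lemma words_in_K: "w \<in> W n \<Longrightarrow> x \<in> K \<Longrightarrow> Fw w x \<in> K"
  by (rule Fw_in_K) (auto simp: words_def)

lemma K_word_cover:
  assumes "x \<in> K" shows "\<exists>w\<in>W n. \<exists>y\<in>K. x = Fw w y"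
  using assms
proof (induction n arbitrary: x)
  case 0
  then show ?case by (auto simp: words_0)
next
  case (Suc n)
  obtain i y where "i \<in> {1..N}" "y \<in> K" "x = F i y" using Suc.prems K_eq by blast
  moreover obtain w z where "w \<in> W n" "z \<in> K" "y = Fw w z" using Suc.IH[OF \<open>y \<in> K\<close>] by blast
  ultimately show ?case
    by (intro bexI[of _ "i # w"] bexI[of _ z]) (auto simp: words_Suc image_iff)
qed

lemma rho_pow_small: "0 < e \<Longrightarrow> \<exists>n. \<rho> ^ n * C < e"
proof -
  assume e: "0 < e"
  have "(\<lambda>n. \<rho> ^ n * C) \<longlonglongrightarrow> 0 * C"
    using rho by (intro tendsto_mult tendsto_const LIMSEQ_power_zero) auto
  then have "eventually (\<lambda>n. \<rho> ^ n * C < e) sequentially"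
    using e by (intro order_tendstoD(2)) auto
  then show ?thesis by (auto simp: eventually_sequentially)
qed

lemma coding_unique:
  assumes "\<And>n. x \<in> Fw (map \<omega> [0..<n]) ` K"
  shows "coding F K \<omega> = x"
  unfolding coding_def
proof (rule the_equality)
  show "x \<in> (\<Inter>n. Fw (map \<omega> [0..<n]) ` K)" by (rule INT_I) (rule assms)
next
  fix y assume y: "y \<in> (\<Inter>n. Fw (map \<omega> [0..<n]) ` K)"
  have le: "dist y x \<le> \<rho> ^ n * diameter K" for n
  proof -
    obtain x' y' where *: "x' \<in> K" "x = Fw (map \<omega> [0..<n]) x'" "y' \<in> K" "y = Fw (map \<omega> [0..<n]) y'"
      using INT_D[OF y UNIV_I, of n] assms[of n] by blast
    have "dist y' x' \<le> diameter K"
      using * compact_K by (intro diameter_bounded_bound compact_imp_bounded) auto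
    then show ?thesis using * rho by (auto simp: dist_Fw intro!: mult_left_mono)
  qed
  show "y = x"
  proof (rule ccontr)
    assume "y \<noteq> x"
    then obtain n where "\<rho> ^ n * diameter K < dist y x" using rho_pow_small[of "dist y x"] by auto
    with le[of n] show False by simp
  qed
qed

lemma coding_mem:
  assumes "\<omega> \<in> inf_words N"
  shows "coding F K \<omega> \<in> Fw (map \<omega> [0..<n]) ` K"
proof -
  let ?A = "\<lambda>n. Fw (map \<omega> [0..<n]) ` K"
  have sub: "?A (Suc n) \<subseteq> ?A n" for n
  proof
    fix y assume "y \<in> ?A (Suc n)"
    then obtain z where z: "z \<in> K" "y = Fw (map \<omega> [0..<n]) (F (\<omega> n) z)" by (auto simp: word_map_append)
    moreover have "\<omega> n \<in> {1..N}" using assms by (auto simp: inf_words_def)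
    ultimately show "y \<in> ?A n" using F_in_K by blast
  qed
  have "(\<Inter>n. ?A n) \<noteq> {}"
  proof (rule compact_nest)
    show "compact (?A n)" for n by (intro compact_continuous_image continuous_Fw compact_K)
    show "?A n \<noteq> {}" for n using K_nonempty by simp
    show "?A n \<subseteq> ?A m" if "m \<le> n" for m n
      using that by (rule lift_Suc_antimono_le[of ?A, OF sub])
  qed
  then obtain x where x: "x \<in> (\<Inter>n. ?A n)" by blast
  have xn: "x \<in> ?A n" for n by (rule INT_D[OF x UNIV_I])
  have "coding F K \<omega> = x" by (rule coding_unique) (rule xn)
  then show ?thesis by (simp only: xn)
qed

lemma coding_in_K: "\<omega> \<in> inf_words N \<Longrightarrow> coding F K \<omega> \<in> K"
  using coding_mem[of \<omega> 0] by simp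

lemma coding_case_nat:
  assumes "\<omega> \<in> inf_words N" "i \<in> {1..N}"
  shows "coding F K (case_nat i \<omega>) = F i (coding F K \<omega>)"
proof (rule coding_unique)
  fix n
  show "F i (coding F K \<omega>) \<in> Fw (map (case_nat i \<omega>) [0..<n]) ` K"
  proof (cases n)
    case 0
    then show ?thesis using F_in_K[OF assms(2) coding_in_K[OF assms(1)]] by simp
  next
    case (Suc m)
    obtain x where "x \<in> K" "coding F K \<omega> = Fw (map \<omega> [0..<m]) x"
      using coding_mem[OF assms(1), of m] by blast
    then show ?thesis unfolding Suc map_case_nat_upt word_map_Cons
      by (intro image_eqI[of _ _ x]) (simp_all add: o_def)
  qed
qed

lemma coding_prepend:
  "set w \<subseteq> {1..N} \<Longrightarrow> \<omega> \<in> inf_words N \<Longrightarrow> coding F K (prepend w \<omega>) = Fw w (coding F K \<omega>)"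
  by (induction w) (auto simp: coding_case_nat prepend_in_inf_words)

lemma coding_surj:
  assumes "x \<in> K" obtains \<omega> where "\<omega> \<in> inf_words N" "coding F K \<omega> = x"
proof -
  have "\<exists>i y. i \<in> {1..N} \<and> y \<in> K \<and> z = F i y" if "z \<in> K" for z using K_eq that by blast
  then obtain I Y where IY: "\<And>z. z \<in> K \<Longrightarrow> I z \<in> {1..N} \<and> Y z \<in> K \<and> z = F (I z) (Y z)"
    by metis
  define \<omega> where "\<omega> k = I ((Y ^^ k) x)" for k
  have YK: "(Y ^^ k) x \<in> K" for k by (induction k) (use assms IY in auto)
  have \<omega>: "\<omega> \<in> inf_words N" using IY YK by (auto simp: inf_words_def \<omega>_def)
  have "x = Fw (map \<omega> [0..<n]) ((Y ^^ n) x)" for n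
  proof (induction n)
    case (Suc n)
    then show ?case using IY[OF YK[of n]] by (simp add: word_map_append \<omega>_def)
  qed simp
  then have "coding F K \<omega> = x" by (intro coding_unique image_eqI[OF _ YK])
  with \<omega> that show ?thesis by blast
qed

lemma finite_P: "finite P"
  using pcf by (simp add: pcf_def)

lemma V0_eq: "V 0 = coding F K ` P"
  by (rule vertices.simps(1))

declare vertices.simps [simp del]

lemma finite_V0: "finite (V 0)"
  using finite_P by (simp add: V0_eq)

lemma critical_tail:
  assumes "i \<in> {1..N}" "j \<in> {1..N}" "i \<noteq> j" "coding F K \<omega> \<in> F i ` K" "coding F K \<omega> \<in> F j ` K"
    "\<omega> \<in> inf_words N" "0 < m"
  shows "(shift ^^ m) \<omega> \<in> P"
proof -
  have "\<omega> \<in> critical_set N F K"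
  proof (cases "i < j")
    case True
    then show ?thesis unfolding critical_set_def using assms(1-6) by blast
  next
    case False
    then have "j < i" using assms(3) by simp
    then show ?thesis unfolding critical_set_def using assms(1-6) by blast
  qed
  then show ?thesis using assms(7) unfolding post_critical_set_def by force
qed

lemma shift_pow_in_inf_words: "\<omega> \<in> inf_words N \<Longrightarrow> (shift ^^ m) \<omega> \<in> inf_words N"
  by (induction m) (auto simp: inf_words_def shift_def)

lemma P_inf_words: "P \<subseteq> inf_words N"
  unfolding post_critical_set_def critical_set_def using shift_pow_in_inf_words by auto

lemma V0_K: "V 0 \<subseteq> K"
  using P_inf_words coding_in_K by (auto simp: V0_eq)

lemma junction_codings:
  assumes "i \<in> {1..N}" "j \<in> {1..N}" "i \<noteq> j" "F i (coding F K \<omega>) \<in> F j ` K" "\<omega> \<in> inf_words N"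
  shows "\<omega> \<in> P"
proof -
  have "(shift ^^ 1) (case_nat i \<omega>) \<in> P"
    using assms by (intro critical_tail[of i j]) (auto simp: coding_case_nat coding_in_K case_nat_in_inf_words)
  then show ?thesis by simp
qed

lemma junction_V0:
  assumes "i \<in> {1..N}" "j \<in> {1..N}" "i \<noteq> j" "x \<in> K" "y \<in> K" "F i x = F j y"
  shows "x \<in> V 0"
proof -
  obtain \<omega> where "\<omega> \<in> inf_words N" "coding F K \<omega> = x" using coding_surj[OF assms(4)] .
  with junction_codings[of i j \<omega>] assms show ?thesis by (auto simp: V0_eq)
qed

lemma prepend_prefix: "prepend (map \<omega> [0..<m]) ((shift ^^ m) \<omega>) = \<omega>"
proof (induction m arbitrary: \<omega>)
  case (Suc m)
  have "map \<omega> [0..<Suc m] = \<omega> 0 # map (shift \<omega>) [0..<m]"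
    by (simp add: map_upt_Suc shift_def del: upt_Suc)
  moreover have "case_nat (\<omega> 0) (shift \<omega>) = \<omega>"
    by (auto simp: shift_def fun_eq_iff split: nat.split)
  ultimately show ?case using Suc[of "shift \<omega>"]
    by (simp add: funpow_Suc_right del: upt_Suc funpow.simps)
qed simp

text \<open>
  Being critical is a property of the coded point, not of the coding.  Prepend to \<open>\<omega>\<close> the word that leads from
  the given point of \<open>V 0\<close> back to a critical point: this is another coding of that critical point.
\<close>

lemma V0_codings:
  assumes "coding F K \<omega> \<in> V 0" "\<omega> \<in> inf_words N"
  shows "\<omega> \<in> P"
proof -
  obtain \<beta> where \<beta>: "\<beta> \<in> P" "coding F K \<omega> = coding F K \<beta>"
    using assms by (auto simp: V0_eq)
  then obtain m \<gamma> i j where g: "m \<ge> 1" "\<beta> = (shift ^^ m) \<gamma>" "\<gamma> \<in> inf_words N" "i \<in> {1..N}" "j \<in> {1..N}" "i < j"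
    "coding F K \<gamma> \<in> F i ` K \<inter> F j ` K"
    unfolding post_critical_set_def critical_set_def by blast
  define w where "w = map \<gamma> [0..<m]"
  have w: "set w \<subseteq> {1..N}" "length w = m" using g(3) by (auto simp: w_def inf_words_def)
  have "coding F K (prepend w \<omega>) = coding F K (prepend w \<beta>)"
    using \<beta> assms(2) w P_inf_words by (simp add: coding_prepend subset_iff)
  also have "prepend w \<beta> = \<gamma>" using prepend_prefix g(2) by (simp add: w_def)
  finally have "(shift ^^ m) (prepend w \<omega>) \<in> P"
    using g w prepend_in_inf_words[OF w(1) assms(2)] by (intro critical_tail[of i j]) auto
  then show ?thesis using shift_prepend[of w \<omega>] w by simp
qed

lemma V0_pullback:
  assumes "Fw w x \<in> V 0" "x \<in> K" "set w \<subseteq> {1..N}"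
  shows "x \<in> V 0"
proof -
  obtain \<omega> where \<omega>: "\<omega> \<in> inf_words N" "coding F K \<omega> = x" using coding_surj[OF assms(2)] .
  have "prepend w \<omega> \<in> P"
    using assms \<omega> by (intro V0_codings) (auto simp: coding_prepend prepend_in_inf_words)
  then obtain m \<gamma> where "m \<ge> 1" "prepend w \<omega> = (shift ^^ m) \<gamma>" "\<gamma> \<in> critical_set N F K"
    unfolding post_critical_set_def by blast
  then have "\<omega> = (shift ^^ (length w + m)) \<gamma>" "length w + m \<ge> 1"
    using shift_prepend[of w \<omega>] by (auto simp: funpow_add)
  then have "\<omega> \<in> P" using \<open>\<gamma> \<in> critical_set N F K\<close> unfolding post_critical_set_def by auto
  then show ?thesis using \<omega> by (auto simp: V0_eq)
qed

text \<open>
  After the common prefix is removed the words start with different letters, so the point is shared by two cells of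
  level 1 and the codings of its preimages are tails of critical sequences.
\<close>

lemma words_junction:
  assumes "w \<in> W n" "w' \<in> W n" "w \<noteq> w'" "x \<in> K" "y \<in> K" "Fw w x = Fw w' y"
  shows "x \<in> V 0"
  using assms
proof (induction n arbitrary: w w')
  case 0
  then show ?case by (simp add: words_0)
next
  case (Suc n)
  obtain i v where w: "w = i # v" "i \<in> {1..N}" "v \<in> W n" using Suc.prems(1) by (auto simp: words_Suc)
  obtain j v' where w': "w' = j # v'" "j \<in> {1..N}" "v' \<in> W n" using Suc.prems(2) by (auto simp: words_Suc)
  show ?case
  proof (cases "i = j")
    case True
    then have "Fw v x = Fw v' y" using Suc.prems w w' by (simp add: F_inj)
    then show ?thesis using Suc w w' True by auto
  next
    case False
    then have "Fw v x \<in> V 0" using Suc.prems w w' words_in_K by (intro junction_V0[of i j]) auto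
    then show ?thesis using V0_pullback w Suc.prems by (auto simp: words_def)
  qed
qed

text \<open>
  A cell meets the larger cells that do not contain it, and the vertices of those that do, only in its own vertices:
  up to the ancestor of the same size this is \<open>words_junction\<close>, and \<open>V0_pullback\<close> carries it down to the cell.
\<close>

lemma prefix_junction:
  assumes "w \<in> W n" "w' \<in> W m" "n \<le> m" "x \<in> K" "y \<in> K" "Fw w x = Fw w' y"
    and "x \<in> V 0 \<or> take n w' \<noteq> w"
  shows "y \<in> V 0"
proof -
  have s: "take n w' \<in> W n" "drop n w' \<in> W (m - n)"
    using assms by (auto simp: words_def dest: in_set_takeD in_set_dropD)
  have eq: "Fw w' = Fw (take n w') \<circ> Fw (drop n w')"
    by (metis append_take_drop_id word_map_append)
  have "Fw (drop n w') y \<in> V 0"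
  proof (cases "take n w' = w")
    case True
    then have "Fw (drop n w') y = x" using assms(6) eq by (simp add: Fw_inj)
    then show ?thesis using assms(7) True by auto
  next
    case False
    then show ?thesis using words_junction[OF s(1) assms(1) False _ assms(4)] assms eq words_in_K[OF s(2)]
      by auto
  qed
  then show ?thesis using V0_pullback s assms by (auto simp: words_def)
qed

lemma V_eq: "V n = (\<Union>w\<in>W n. Fw w ` V 0)"
proof (induction n)
  case 0
  then show ?case by (simp add: words_0)
next
  case (Suc n)
  have "F i ` (\<Union>w\<in>W n. Fw w ` V 0) = (\<Union>w\<in>W n. Fw (i # w) ` V 0)" for i
    by (auto simp: image_UN image_comp)
  then show ?case unfolding vertices.simps(2) Suc words_Suc by force
qed

lemma V_K: "V n \<subseteq> K"
  unfolding V_eq[of n] using V0_K words_in_K by blast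

lemma V0_V1: "V 0 \<subseteq> V (Suc 0)"
proof
  fix p assume p: "p \<in> V 0"
  then obtain i y where iy: "i \<in> {1..N}" "y \<in> K" "p = F i y" using V0_K K_eq by blast
  then have "y \<in> V 0" using V0_pullback[of "[i]" y] p by auto
  then show "p \<in> V (Suc 0)" using iy by (simp only: vertices.simps(2)) blast
qed

lemma V_Suc: "V n \<subseteq> V (Suc n)"
proof (induction n)
  case 0
  show ?case by (rule V0_V1)
next
  case (Suc n)
  then show ?case
    by (subst (1 2) vertices.simps(2)) (intro UN_mono image_mono order_refl)
qed

lemma V_mono: "m \<le> n \<Longrightarrow> V m \<subseteq> V n"
  by (rule lift_Suc_mono_le[of V, OF V_Suc])

lemma finite_V: "finite (V n)"
  unfolding V_eq[of n] using finite_words finite_V0 by auto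

lemma V_in_Vs: "V n \<subseteq> Vs"
  by (auto simp: all_vertices_def)

lemma Vs_K: "Vs \<subseteq> K"
  using V_K by (auto simp: all_vertices_def)

lemma Vs_iff: "x \<in> Vs \<longleftrightarrow> (\<exists>n. \<exists>w\<in>W n. \<exists>p\<in>V 0. x = Fw w p)"
proof -
  have "x \<in> Vs \<longleftrightarrow> (\<exists>n. x \<in> V n)" by (auto simp: all_vertices_def)
  also have "\<dots> \<longleftrightarrow> (\<exists>n. \<exists>w\<in>W n. \<exists>p\<in>V 0. x = Fw w p)"
    by (subst V_eq) blast
  finally show ?thesis .
qed

lemma Fw_V: "w \<in> W n \<Longrightarrow> x \<in> V m \<Longrightarrow> Fw w x \<in> V (n + m)"
proof -
  assume w: "w \<in> W n" and "x \<in> V m"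
  then obtain v p where v: "v \<in> W m" "p \<in> V 0" "x = Fw v p" unfolding V_eq[of m] by blast
  then have "w @ v \<in> W (n + m)" "Fw w x = Fw (w @ v) p"
    using w append_in_words by (auto simp: word_map_append)
  then show ?thesis unfolding V_eq[of "n + m"] using v(2) by blast
qed

lemma Fw_Vs: "w \<in> W n \<Longrightarrow> x \<in> Vs \<Longrightarrow> Fw w x \<in> Vs"
  using Fw_V[of w n x] unfolding all_vertices_def by blast

lemma Vs_pullback:
  assumes "Fw w x \<in> Vs" "w \<in> W n" "x \<in> K"
  shows "x \<in> Vs"
proof -
  obtain m v p where v: "v \<in> W m" "p \<in> V 0" "Fw w x = Fw v p" using assms Vs_iff by blast
  have "Fw w x \<in> V (n + m)" using v V_eq[of m] V_mono[of m "n+m"] by force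
  then obtain v p where v: "v \<in> W (n + m)" "p \<in> V 0" "Fw w x = Fw v p" unfolding V_eq[of "n+m"] by auto
  then obtain v1 v2 where v12: "v = v1 @ v2" "v1 \<in> W n" "v2 \<in> W m" unfolding words_add by auto
  show ?thesis
  proof (cases "v1 = w")
    case True
    then have "x = Fw v2 p" using v v12 by (simp add: word_map_append Fw_inj)
    then show ?thesis using v v12 Vs_iff by blast
  next
    case False
    have "p \<in> K" using v V0_K by blast
    then have "x \<in> V 0" using words_junction[of w n v1 x "Fw v2 p"] assms v v12 words_in_K False
      by (auto simp: word_map_append)
    then show ?thesis using V_in_Vs by blast
  qed
qed

lemma V0_two: obtains p q where "p \<in> V 0" "q \<in> V 0" "p \<noteq> q"
proof -
  have "\<not> card (V 0) \<le> Suc 0" using card_V0 by simp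
  then show ?thesis using that finite_V0 card_le_Suc0_iff_eq by blast
qed

lemma N_ge_2: "2 \<le> N"
proof (rule ccontr)
  assume "\<not> 2 \<le> N"
  then consider "N = 0" | "N = 1" by linarith
  then show False
  proof cases
    case 1
    then have "K = {}" by (subst K_eq) simp
    then show False using K_nonempty by simp
  next
    case 2
    have K1: "w = replicate n 1" if "w \<in> W n" for n w
      using that by (intro replicate_eqI) (auto simp: words_def 2)
    obtain p q where "p \<in> V 0" "q \<in> V 0" and pq: "p \<noteq> q" by (rule V0_two)
    then have pq: "p \<in> K" "q \<in> K" "p \<noteq> q" using V0_K by auto
    obtain n where n: "\<rho> ^ n * diameter K < dist p q" using rho_pow_small[of "dist p q"] pq by auto
    obtain x y where xy: "x \<in> K" "y \<in> K" "p = Fw (replicate n 1) x" "q = Fw (replicate n 1) y"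
      using K_word_cover[of p n] K_word_cover[of q n] K1 pq by metis
    then have "dist p q \<le> \<rho> ^ n * diameter K"
      using rho diameter_bounded_bound[OF compact_imp_bounded[OF compact_K], of x y]
      by (simp add: dist_Fw mult_left_mono)
    with n show False by simp
  qed
qed

text \<open>
  Two cells of one level meet only in images of \<open>V 0\<close>, so agreement at common vertices makes the pieces compatible.
\<close>

lemma glue_on_cells:
  fixes h :: "nat list \<Rightarrow> 'a \<Rightarrow> 'b"
  assumes "\<And>w w' p p'. w \<in> W n \<Longrightarrow> w' \<in> W n \<Longrightarrow> w \<noteq> w' \<Longrightarrow> p \<in> V 0 \<Longrightarrow> p' \<in> V 0 \<Longrightarrow>
     Fw w p = Fw w' p' \<Longrightarrow> h w p = h w' p'"
  obtains g where "\<And>w x. w \<in> W n \<Longrightarrow> x \<in> K \<Longrightarrow> g (Fw w x) = h w x"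
proof -
  define g where "g y = (let z = SOME z. fst z \<in> W n \<and> snd z \<in> K \<and> y = Fw (fst z) (snd z) in h (fst z) (snd z))" for y
  have "g (Fw w x) = h w x" if "w \<in> W n" "x \<in> K" for w x
  proof -
    define z where "z = (SOME z. fst z \<in> W n \<and> snd z \<in> K \<and> Fw w x = Fw (fst z) (snd z))"
    have "fst z \<in> W n \<and> snd z \<in> K \<and> Fw w x = Fw (fst z) (snd z)"
      unfolding z_def by (rule someI[where x = "(w, x)"]) (use that in auto)
    then have z: "fst z \<in> W n" "snd z \<in> K" "Fw w x = Fw (fst z) (snd z)" by auto
    have "h w x = h (fst z) (snd z)"
    proof (cases "w = fst z")
      case True
      then have "x = snd z" using z(3) by (simp add: Fw_inj)
      with True show ?thesis by simp
    next
      case False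
      then have "x \<in> V 0" "snd z \<in> V 0"
        using words_junction[OF that(1) z(1) False that(2) z(2,3)]
          words_junction[OF z(1) that(1) _ z(2) that(2) z(3)[symmetric]] by auto
      then show ?thesis using assms[OF that(1) z(1) False _ _ z(3)] by blast
    qed
    then show ?thesis unfolding g_def z_def[symmetric] by (simp add: Let_def)
  qed
  then show ?thesis using that by blast
qed

end

section \<open>Separation of cells and discrete energies\<close>

lemma pair_energy_nonneg: "0 \<le> pair_energy A u"
  unfolding pair_energy_def by (intro mult_nonneg_nonneg sum_nonneg) auto

lemma pair_energy_image:
  assumes "inj_on f A" shows "pair_energy (f ` A) u = pair_energy A (u \<circ> f)"
  unfolding pair_energy_def by (simp add: sum.reindex[OF assms])

lemma pair_energy_cong: "(\<And>x. x \<in> A \<Longrightarrow> u x = v x) \<Longrightarrow> pair_energy A u = pair_energy A v"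
  unfolding pair_energy_def by (intro arg_cong2[of _ _ _ _ "(*)"] sum.cong refl) auto

lemma pair_energy_mono:
  assumes "finite A" "\<And>x y. x \<in> A \<Longrightarrow> y \<in> A \<Longrightarrow> \<bar>u x - u y\<bar> \<le> \<bar>v x - v y\<bar>"
  shows "pair_energy A u \<le> pair_energy A v"
  unfolding pair_energy_def using assms by (intro mult_left_mono sum_mono power_mono) auto

lemma diff_le_pair_energy:
  assumes "finite A" "x \<in> A" "y \<in> A"
  shows "(u x - u y)\<^sup>2 \<le> 2 * pair_energy A u"
proof -
  have "\<bar>u x - u y\<bar>\<^sup>2 \<le> (\<Sum>y\<in>A. \<bar>u x - u y\<bar>\<^sup>2)"
    using assms by (intro member_le_sum) auto
  also have "\<dots> \<le> (\<Sum>x\<in>A. \<Sum>y\<in>A. \<bar>u x - u y\<bar>\<^sup>2)"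
    using assms by (intro member_le_sum[of x A "\<lambda>x. \<Sum>y\<in>A. \<bar>u x - u y\<bar>\<^sup>2"]) (auto intro: sum_nonneg)
  finally show ?thesis by (simp add: pair_energy_def)
qed

lemma Cons_word_cases:
  assumes "w \<in> words N (Suc n)"
  obtains i v where "w = i # v" "i \<in> {1..N}" "v \<in> words N n"
  using assms unfolding words_Suc by auto

context homogeneous_pcf
begin

lemma word_through_cases:
  assumes "w \<in> W (Suc n)" "z \<in> Fw w ` K"
  obtains i v y where "w = i # v" "i \<in> {1..N}" "v \<in> W n" "y \<in> K" "z = F i (Fw v y)"
proof -
  obtain i v where iv: "w = i # v" "i \<in> {1..N}" "v \<in> W n" using Cons_word_cases[OF assms(1)] .
  obtain y where "y \<in> K" "z = Fw w y" using assms(2) by blast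
  then show ?thesis using that[OF iv] iv(1) by simp
qed

text \<open>
  Once the common prefix of the words is removed, two of them start with different letters.  The point is then
  critical, and a word is recovered from the first letter and the tail of a coding that extends it; such tails belong
  to \<open>P\<close>.  The summand 1 covers the case of a single word.
\<close>

lemma card_words_through_le: "card {w \<in> W n. z \<in> Fw w ` K} \<le> N * card P + 1"
proof (induction n arbitrary: z)
  case 0
  have "card {w \<in> W 0. z \<in> Fw w ` K} \<le> card {[]::nat list}"
    by (intro card_mono) (auto simp: words_0)
  then show ?case by simp
next
  case (Suc n)
  define A where "A = {w \<in> W (Suc n). z \<in> Fw w ` K}"
  show ?case
  proof (cases "\<exists>w\<in>A. \<exists>w'\<in>A. hd w \<noteq> hd w'")
    case False
    show ?thesis
    proof (cases "A = {}")
      case True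
      then show ?thesis unfolding A_def[symmetric] by simp
    next
      case ne: False
      then obtain w0 where w0: "w0 \<in> A" by blast
      then have "w0 \<in> W (Suc n)" "z \<in> Fw w0 ` K" by (auto simp: A_def)
      then obtain i v0 y0 where iv: "w0 = i # v0" "i \<in> {1..N}" "v0 \<in> W n" "y0 \<in> K" "z = F i (Fw v0 y0)"
        by (rule word_through_cases)
      have "A \<subseteq> (#) i ` {v \<in> W n. Fw v0 y0 \<in> Fw v ` K}"
      proof
        fix w assume w: "w \<in> A"
        then have hd: "hd w = i" using False w0 iv(1) by (metis list.sel(1))
        have "w \<in> W (Suc n)" "z \<in> Fw w ` K" using w by (auto simp: A_def)
        then obtain j v y where "w = j # v" "j \<in> {1..N}" "v \<in> W n" "y \<in> K" "z = F j (Fw v y)"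
          by (rule word_through_cases)
        with hd have v: "w = i # v" "v \<in> W n" "y \<in> K" "z = F i (Fw v y)" by auto
        then have "Fw v0 y0 = Fw v y" using iv(5) by (simp add: F_inj)
        then show "w \<in> (#) i ` {v \<in> W n. Fw v0 y0 \<in> Fw v ` K}" using v by auto
      qed
      then have "card A \<le> card ((#) i ` {v \<in> W n. Fw v0 y0 \<in> Fw v ` K})"
        using finite_words by (intro card_mono) auto
      also have "\<dots> = card {v \<in> W n. Fw v0 y0 \<in> Fw v ` K}" by (intro card_image) auto
      also have "\<dots> \<le> N * card P + 1" by (rule Suc.IH)
      finally show ?thesis unfolding A_def .
    qed
  next
    case True
    then obtain w0 w1 where w01: "w0 \<in> A" "w1 \<in> A" "hd w0 \<noteq> hd w1" by blast
    have hd: "hd w \<in> {1..N} \<and> z \<in> F (hd w) ` K" if "w \<in> A" for w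
    proof -
      have "w \<in> W (Suc n)" "z \<in> Fw w ` K" using that by (auto simp: A_def)
      then obtain i v y where "w = i # v" "i \<in> {1..N}" "v \<in> W n" "y \<in> K" "z = F i (Fw v y)"
        by (rule word_through_cases)
      then show ?thesis using words_in_K[of v n y] by simp
    qed
    have "\<exists>\<omega>. \<omega> \<in> inf_words N \<and> coding F K \<omega> = z \<and> map \<omega> [0..<Suc n] = w" if w: "w \<in> A" for w
    proof -
      obtain y where y: "y \<in> K" "z = Fw w y" "w \<in> W (Suc n)" using w by (auto simp: A_def)
      then have sw: "set w \<subseteq> {1..N}" "length w = Suc n" by (auto simp: words_def)
      obtain \<beta> where \<beta>: "\<beta> \<in> inf_words N" "coding F K \<beta> = y" using coding_surj[OF y(1)] .
      show ?thesis
        using prepend_in_inf_words[OF sw(1) \<beta>(1)] coding_prepend[OF sw(1) \<beta>(1)] \<beta> y map_prepend_upt[of w \<beta>] sw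
        by (intro exI[of _ "prepend w \<beta>"]) (auto simp del: upt_Suc)
    qed
    then obtain \<Omega> where \<Omega>: "\<And>w. w \<in> A \<Longrightarrow> \<Omega> w \<in> inf_words N \<and> coding F K (\<Omega> w) = z \<and> map (\<Omega> w) [0..<Suc n] = w"
      by metis
    let ?\<phi> = "\<lambda>w. (\<Omega> w 0, shift (\<Omega> w))"
    have "inj_on ?\<phi> A"
    proof (rule inj_onI)
      fix w w' assume w: "w \<in> A" "w' \<in> A" "?\<phi> w = ?\<phi> w'"
      have "\<Omega> w = \<Omega> w'"
      proof
        fix k show "\<Omega> w k = \<Omega> w' k" using w(3) by (cases k) (auto simp: shift_def fun_eq_iff)
      qed
      then show "w = w'" using \<Omega> w by metis
    qed
    moreover have "?\<phi> ` A \<subseteq> {1..N} \<times> P"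
    proof -
      have "?\<phi> w \<in> {1..N} \<times> P" if "w \<in> A" for w
      proof -
        have "(shift ^^ 1) (\<Omega> w) \<in> P"
          using hd[OF w01(1)] hd[OF w01(2)] w01(3) \<Omega>[OF that]
          by (intro critical_tail[of "hd w0" "hd w1"]) auto
        moreover have "\<Omega> w 0 \<in> {1..N}" using \<Omega>[OF that] by (auto simp: inf_words_def)
        ultimately show ?thesis by simp
      qed
      then show ?thesis by blast
    qed
    ultimately have "card A \<le> card ({1..N} \<times> P)"
      using finite_P by (intro card_inj_on_le[of ?\<phi>]) auto
    then show ?thesis unfolding A_def by (simp add: card_cartesian_product)
  qed
qed

text \<open>
  For words of the same length this says that the two cells of \<open>K\<close> intersect; see \<open>touching_iff\<close>.
\<close>

definition touching :: "nat list \<Rightarrow> nat list \<Rightarrow> bool" where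
  "touching w w' \<longleftrightarrow> (\<exists>p\<in>V 0. \<exists>q\<in>V 0. Fw w p = Fw w' q)"

lemma V0_nonempty: "V 0 \<noteq> {}"
  using card_V0 by auto

lemma touching_iff:
  assumes "w \<in> W n" "w' \<in> W n"
  shows "touching w w' \<longleftrightarrow> (\<exists>x\<in>K. \<exists>y\<in>K. Fw w x = Fw w' y)"
proof
  assume "touching w w'"
  then show "\<exists>x\<in>K. \<exists>y\<in>K. Fw w x = Fw w' y" using V0_K unfolding touching_def by blast
next
  assume "\<exists>x\<in>K. \<exists>y\<in>K. Fw w x = Fw w' y"
  then obtain x y where xy: "x \<in> K" "y \<in> K" "Fw w x = Fw w' y" by blast
  show "touching w w'"
  proof (cases "w = w'")
    case True
    then show ?thesis using V0_nonempty unfolding touching_def by blast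
  next
    case False
    have "x \<in> V 0" "y \<in> V 0"
      using words_junction[OF assms False xy] words_junction[OF assms(2,1) _ xy(2,1) xy(3)[symmetric]] False
      by auto
    then show ?thesis unfolding touching_def using xy by blast
  qed
qed

lemma card_touching_le:
  assumes "w \<in> W n"
  shows "card {w' \<in> W n. touching w w'} \<le> card (V 0) * (N * card P + 1)"
proof -
  have "{w' \<in> W n. touching w w'} \<subseteq> (\<Union>p\<in>V 0. {w' \<in> W n. Fw w p \<in> Fw w' ` K})"
    using V0_K unfolding touching_def by fast
  then have "card {w' \<in> W n. touching w w'} \<le> card (\<Union>p\<in>V 0. {w' \<in> W n. Fw w p \<in> Fw w' ` K})"
    using finite_V0 finite_words by (intro card_mono) auto
  also have "\<dots> \<le> (\<Sum>p\<in>V 0. card {w' \<in> W n. Fw w p \<in> Fw w' ` K})"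
    using finite_V0 by (rule card_UN_le)
  also have "\<dots> \<le> (\<Sum>p\<in>V 0. N * card P + 1)"
    by (intro sum_mono card_words_through_le)
  finally show ?thesis by simp
qed

text \<open>
  The maps of level \<open>n\<close> have the form \<open>x \<mapsto> \<rho> ^ n *\<^sub>R x + t\<close>.  A common vertex expresses the difference of the two
  translation vectors, in units of \<open>\<rho> ^ n\<close>, as a difference of two points of \<open>V 0\<close>: there are only finitely many
  relative positions.
\<close>

lemma touching_translation:
  assumes "w \<in> W n" "w' \<in> W n" "touching w w'"
  obtains d where "d \<in> (\<lambda>(p, q). q - p) ` (V 0 \<times> V 0)"
    "\<And>x y. Fw w x - Fw w' y = \<rho> ^ n *\<^sub>R (x + d - y)"
proof -
  obtain p q where pq: "p \<in> V 0" "q \<in> V 0" "Fw w p = Fw w' q" using assms unfolding touching_def by blast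
  have "Fw w x - Fw w' y = \<rho> ^ n *\<^sub>R (x + (q - p) - y)" for x y
  proof -
    have "Fw w x - Fw w' y = (Fw w x - Fw w p) - (Fw w' y - Fw w' q)" using pq by simp
    also have "\<dots> = \<rho> ^ n *\<^sub>R (x - p) - \<rho> ^ n *\<^sub>R (y - q)"
      using assms by (simp add: Fw_diff words_def)
    finally show ?thesis by (simp add: algebra_simps)
  qed
  with pq that show ?thesis by blast
qed

text \<open>
  Consider the last level at which the ancestors of two disjoint cells still touch.  Their relative position there is
  one of finitely many, and so is the configuration formed by their children that contain the two cells.  These
  children are disjoint compact sets, hence have a positive distance in units of the scale, and the minimum over the
  finitely many configurations is \<open>c\<close>.
\<close>

lemma cells_separated:
  obtains c where "0 < c"
    "\<And>n w w' x y. w \<in> W n \<Longrightarrow> w' \<in> W n \<Longrightarrow> x \<in> K \<Longrightarrow> y \<in> K \<Longrightarrow>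
       dist (Fw w x) (Fw w' y) < c * \<rho> ^ n \<Longrightarrow> touching w w'"
proof -
  define D where "D = (\<lambda>(p, q). q - p) ` (V 0 \<times> V 0)"
  define I where "I = D \<times> {1..N} \<times> {1..N}"
  have fin: "finite I" using finite_V0 by (auto simp: I_def D_def)
  have ne: "I \<noteq> {}" using V0_nonempty N_ge_2 by (auto simp: I_def D_def)
  have "\<exists>c>0. (\<exists>x\<in>K. \<exists>y\<in>K. F i x + d = F j y) \<or> (\<forall>x\<in>K. \<forall>y\<in>K. c \<le> norm (F i x + d - F j y))" for d i j
  proof (cases "(\<exists>x\<in>K. \<exists>y\<in>K. F i x + d = F j y)")
    case False
    have cF: "continuous_on K (F i)" for i using continuous_Fw[of K "[i]"] by simp
    have "compact ((\<lambda>x. F i x + d) ` K)"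
      by (intro compact_continuous_image continuous_intros cF compact_K)
    moreover have "closed (F j ` K)"
      by (intro compact_imp_closed compact_continuous_image cF compact_K)
    moreover have "(\<lambda>x. F i x + d) ` K \<inter> F j ` K = {}" using False by blast
    ultimately obtain c where "c > 0" "\<And>x y. x \<in> (\<lambda>x. F i x + d) ` K \<Longrightarrow> y \<in> F j ` K \<Longrightarrow> c \<le> dist x y"
      using separate_compact_closed by metis
    then show ?thesis by (auto simp: dist_norm)
  qed (auto intro: exI[of _ 1])
  then have "\<forall>d i j. \<exists>c. c > 0 \<and>
     ((\<exists>x\<in>K. \<exists>y\<in>K. F i x + d = F j y) \<or> (\<forall>x\<in>K. \<forall>y\<in>K. c \<le> norm (F i x + d - F j y)))"
    by simp
  from this[unfolded choice_iff] obtain c where "\<forall>d i j. c d i j > 0 \<and>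
     ((\<exists>x\<in>K. \<exists>y\<in>K. F i x + d = F j y) \<or> (\<forall>x\<in>K. \<forall>y\<in>K. c d i j \<le> norm (F i x + d - F j y)))"
    by blast
  then have c: "\<And>d i j. c d i j > 0"
    "\<And>d i j. (\<exists>x\<in>K. \<exists>y\<in>K. F i x + d = F j y) \<or> (\<forall>x\<in>K. \<forall>y\<in>K. c d i j \<le> norm (F i x + d - F j y))"
    by simp_all
  define c0 where "c0 = Min ((\<lambda>(d, i, j). c d i j) ` I)"
  have c0: "0 < c0" unfolding c0_def using fin ne c(1) by (subst Min_gr_iff) auto
  have c0_le: "c0 \<le> c d i j" if "d \<in> D" "i \<in> {1..N}" "j \<in> {1..N}" for d i j
    unfolding c0_def using fin that by (intro Min_le) (auto simp: I_def intro!: image_eqI[of _ _ "(d, i, j)"])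
  have main: "touching w w'" if "w \<in> W n" "w' \<in> W n" "x \<in> K" "y \<in> K"
       "dist (Fw w x) (Fw w' y) < c0 * \<rho> ^ n" for n w w' x y
    using that
  proof (induction n arbitrary: w w' x y)
    case 0
    then show ?case using V0_nonempty by (auto simp: words_0 touching_def)
  next
    case (Suc n)
    obtain v i where w: "v \<in> W n" "i \<in> {1..N}" "w = v @ [i]" using snoc_word_cases[OF Suc.prems(1)] .
    obtain v' j where w': "v' \<in> W n" "j \<in> {1..N}" "w' = v' @ [j]" using snoc_word_cases[OF Suc.prems(2)] .
    have "c0 * \<rho> ^ Suc n \<le> c0 * \<rho> ^ n" using rho c0 by (intro mult_left_mono power_decreasing) auto
    then have "dist (Fw w x) (Fw w' y) < c0 * \<rho> ^ n" using Suc.prems(5) by linarith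
    then have "touching v v'"
      using Suc.prems w w' F_in_K by (intro Suc.IH[of v v' "F i x" "F j y"]) (auto simp: word_map_append)
    then obtain d where d: "d \<in> D" "\<And>x y. Fw v x - Fw v' y = \<rho> ^ n *\<^sub>R (x + d - y)"
      using touching_translation[OF w(1) w'(1)] unfolding D_def by metis
    show ?case
    proof (rule ccontr)
      assume nt: "\<not> touching w w'"
      have "\<not> (\<exists>x\<in>K. \<exists>y\<in>K. F i x + d = F j y)"
      proof
        assume "\<exists>x\<in>K. \<exists>y\<in>K. F i x + d = F j y"
        then obtain x y where xy: "x \<in> K" "y \<in> K" "F i x + d = F j y" by blast
        then have "Fw v (F i x) - Fw v' (F j y) = 0" using d(2) by simp
        then show False using nt xy touching_iff[OF Suc.prems(1,2)] w w' by (auto simp: word_map_append)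
      qed
      then have "c d i j \<le> norm (F i x + d - F j y)" using c(2)[of i d j] Suc.prems by blast
      then have "c0 \<le> norm (F i x + d - F j y)" using c0_le[OF d(1) w(2) w'(2)] by simp
      then have "c0 * \<rho> ^ n \<le> norm (F i x + d - F j y) * \<rho> ^ n" using rho by (intro mult_right_mono) auto
      also have "\<dots> = dist (Fw w x) (Fw w' y)"
        using d(2)[of "F i x" "F j y"] rho w w' by (simp add: dist_norm word_map_append)
      also have "\<dots> < c0 * \<rho> ^ Suc n" by (rule Suc.prems(5))
      also have "\<dots> \<le> c0 * \<rho> ^ n" using rho c0 by (simp add: mult_left_le_one_le)
      finally show False by simp
    qed
  qed
  show ?thesis by (rule that[OF c0]) (rule main)
qed

abbreviation "En \<equiv> energy N F K"

lemma energy_eq: "En n u = (\<Sum>w\<in>W n. pair_energy (V 0) (u \<circ> Fw w))"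
  unfolding energy_def cell_def by (intro sum.cong refl pair_energy_image inj_Fw)

lemma energy_0: "En 0 u = pair_energy (V 0) u"
  by (simp add: energy_eq words_0)

lemma energy_nonneg: "0 \<le> En n u"
  unfolding energy_eq by (intro sum_nonneg pair_energy_nonneg)

lemma energy_add: "En (n + m) u = (\<Sum>w\<in>W n. En m (u \<circ> Fw w))"
  unfolding energy_eq sum_words_add by (simp add: word_map_append comp_assoc)

lemma energy_mono:
  assumes "\<And>x y. x \<in> V n \<Longrightarrow> y \<in> V n \<Longrightarrow> \<bar>u x - u y\<bar> \<le> \<bar>v x - v y\<bar>"
  shows "En n u \<le> En n v"
  unfolding energy_eq
proof (intro sum_mono pair_energy_mono finite_V0)
  fix w x y assume "w \<in> W n" "x \<in> V 0" "y \<in> V 0"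
  then show "\<bar>(u \<circ> Fw w) x - (u \<circ> Fw w) y\<bar> \<le> \<bar>(v \<circ> Fw w) x - (v \<circ> Fw w) y\<bar>"
    using Fw_V[of w n _ 0] assms by auto
qed

lemma energy_cong: "(\<And>x. x \<in> V n \<Longrightarrow> u x = v x) \<Longrightarrow> En n u = En n v"
  by (intro antisym energy_mono) auto

text \<open>
  Two vertices of level 1 can be joined by a chain of steps inside cells of level 1.  Otherwise the cells reachable
  from the first one and the remaining cells would split \<open>K\<close> into two disjoint nonempty closed sets.
\<close>

lemma V1_chain:
  obtains C where "0 < C"
    "\<And>u x y. x \<in> V (Suc 0) \<Longrightarrow> y \<in> V (Suc 0) \<Longrightarrow> (u x - u y)\<^sup>2 \<le> C * En (Suc 0) u"
proof -
  define R where "R x y \<longleftrightarrow> (\<exists>C\<ge>0. \<forall>u. (u x - u y)\<^sup>2 \<le> C * En (Suc 0) u)" for x y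
  have trans: "R x z" if "R x y" "R y z" for x y z
  proof -
    obtain C C' where C: "C \<ge> 0" "\<And>u. (u x - u y)\<^sup>2 \<le> C * En (Suc 0) u" "C' \<ge> 0"
      "\<And>u. (u y - u z)\<^sup>2 \<le> C' * En (Suc 0) u" using \<open>R x y\<close> \<open>R y z\<close> unfolding R_def by blast
    have "(u x - u z)\<^sup>2 \<le> (2 * C + 2 * C') * En (Suc 0) u" for u
    proof -
      have "(u x - u z)\<^sup>2 \<le> 2 * (u x - u y)\<^sup>2 + 2 * (u y - u z)\<^sup>2"
        using sum_squares_bound[of "u x - u y" "u y - u z"] by (simp add: power2_eq_square algebra_simps)
      then show ?thesis using C(2)[of u] C(4)[of u] by (simp add: algebra_simps)
    qed
    then show ?thesis unfolding R_def using C by (intro exI[of _ "2 * C + 2 * C'"]) auto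
  qed
  have sym: "R y x" if "R x y" for x y using that unfolding R_def by (simp add: power2_commute)
  have cell: "R (F i p) (F i q)" if "i \<in> {1..N}" "p \<in> V 0" "q \<in> V 0" for i p q
  proof -
    have "(u (F i p) - u (F i q))\<^sup>2 \<le> 2 * En (Suc 0) u" for u
    proof -
      have "(u (F i p) - u (F i q))\<^sup>2 \<le> 2 * pair_energy (V 0) (u \<circ> Fw [i])"
        using diff_le_pair_energy[OF finite_V0 that(2,3), of "u \<circ> Fw [i]"] by simp
      also have "\<dots> \<le> 2 * En (Suc 0) u"
        unfolding energy_eq using that(1)
        by (intro mult_left_mono member_le_sum finite_words pair_energy_nonneg) (auto simp: words_1)
      finally show ?thesis .
    qed
    then show ?thesis unfolding R_def by (intro exI[of _ 2]) auto
  qed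
  obtain p0 where p0: "p0 \<in> V 0" using V0_nonempty by blast
  define A where "A = {i \<in> {1..N}. R (F 1 p0) (F i p0)}"
  define S where "S = (\<Union>i\<in>A. F i ` K)"
  define T where "T = (\<Union>i\<in>{1..N} - A. F i ` K)"
  have cF: "compact (F i ` K)" for i
    using continuous_Fw[of K "[i]"] compact_K by (intro compact_continuous_image) auto
  have "closed S" "closed T" unfolding S_def T_def A_def
    by (auto intro!: closed_UN compact_imp_closed cF)
  moreover have "S \<inter> T = {}"
  proof (rule ccontr)
    assume "S \<inter> T \<noteq> {}"
    then obtain z where z: "z \<in> S" "z \<in> T" by blast
    obtain i x where ix: "i \<in> A" "x \<in> K" "z = F i x" using z(1) unfolding S_def by blast
    obtain j y where jy: "j \<in> {1..N}" "j \<notin> A" "y \<in> K" "z = F j y" using z(2) unfolding T_def by blast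
    have ij: "i \<in> A" "j \<in> {1..N}" "j \<notin> A" "x \<in> K" "y \<in> K" "F i x = F j y"
      using ix jy by auto
    then have i: "i \<in> {1..N}" "i \<noteq> j" by (auto simp: A_def)
    have xy: "x \<in> V 0" "y \<in> V 0"
      using junction_V0[OF i(1) ij(2) i(2) ij(4,5,6)] junction_V0[OF ij(2) i(1) _ ij(5,4)] ij(6) i(2) by auto
    have "R (F i p0) (F i x)" using cell[OF i(1) p0 xy(1)] .
    moreover have "R (F j y) (F j p0)" using cell[OF ij(2) xy(2) p0] .
    moreover have "R (F 1 p0) (F i p0)" using ij(1) by (simp add: A_def)
    ultimately have "R (F 1 p0) (F j p0)"
      using trans[of "F 1 p0" "F i p0" "F i x"] trans[of "F 1 p0" "F i x" "F j p0"] ij(6) by simp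
    with ij show False by (auto simp: A_def)
  qed
  moreover have "K = S \<union> T"
  proof -
    have "S \<union> T = (\<Union>i\<in>{1..N}. F i ` K)" unfolding S_def T_def A_def by blast
    then show ?thesis using K_eq by simp
  qed
  ultimately have "S = {} \<or> T = {}"
    using connected_K unfolding connected_closed by blast
  moreover have "S \<noteq> {}"
  proof -
    have "1 \<in> A" using N_ge_2 cell[of 1 p0 p0] p0 by (auto simp: A_def)
    then show ?thesis using K_nonempty by (auto simp: S_def)
  qed
  ultimately have "T = {}" by simp
  then have all: "i \<in> A" if "i \<in> {1..N}" for i
    using that K_nonempty by (auto simp: T_def)
  have "R x y" if "x \<in> V (Suc 0)" "y \<in> V (Suc 0)" for x y
  proof -
    obtain i p j q where "i \<in> {1..N}" "p \<in> V 0" "x = F i p" "j \<in> {1..N}" "q \<in> V 0" "y = F j q"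
      using \<open>x \<in> V (Suc 0)\<close> \<open>y \<in> V (Suc 0)\<close> unfolding vertices.simps(2) by blast
    moreover have "R (F i p) (F i p0)" "R (F 1 p0) (F i p0)" "R (F 1 p0) (F j p0)" "R (F j p0) (F j q)"
      using cell all p0 calculation unfolding A_def by auto
    ultimately show ?thesis using trans sym by blast
  qed
  then have "\<exists>C. \<forall>x\<in>V (Suc 0). \<forall>y\<in>V (Suc 0). 0 \<le> C x y \<and> (\<forall>u. (u x - u y)\<^sup>2 \<le> C x y * En (Suc 0) u)"
    unfolding R_def by (intro bchoice_iff[THEN iffD1, rule_format]) metis
  then obtain C where C: "\<And>x y. x \<in> V (Suc 0) \<Longrightarrow> y \<in> V (Suc 0) \<Longrightarrow> 0 \<le> C x y"
    "\<And>x y u. x \<in> V (Suc 0) \<Longrightarrow> y \<in> V (Suc 0) \<Longrightarrow> (u x - u y)\<^sup>2 \<le> C x y * En (Suc 0) u" by blast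
  define C1 where "C1 = 1 + (\<Sum>x\<in>V (Suc 0). \<Sum>y\<in>V (Suc 0). C x y)"
  have le: "C x y \<le> C1" if "x \<in> V (Suc 0)" "y \<in> V (Suc 0)" for x y
  proof -
    have "C x y \<le> (\<Sum>y\<in>V (Suc 0). C x y)" using that C finite_V by (intro member_le_sum) auto
    also have "\<dots> \<le> (\<Sum>x\<in>V (Suc 0). \<Sum>y\<in>V (Suc 0). C x y)"
      using that C finite_V by (intro member_le_sum[of x _ "\<lambda>x. \<Sum>y\<in>V (Suc 0). C x y"]) (auto intro!: sum_nonneg)
    finally show ?thesis by (simp add: C1_def)
  qed
  show ?thesis
  proof (rule that[of C1])
    show "0 < C1" unfolding C1_def using C by (intro add_pos_nonneg sum_nonneg) auto
    fix u x y assume "x \<in> V (Suc 0)" "y \<in> V (Suc 0)"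
    then have "(u x - u y)\<^sup>2 \<le> C x y * En (Suc 0) u" "C x y * En (Suc 0) u \<le> C1 * En (Suc 0) u"
      using C le energy_nonneg by (auto intro: mult_right_mono)
    then show "(u x - u y)\<^sup>2 \<le> C1 * En (Suc 0) u" by linarith
  qed
qed

lemma energy_Suc: "En (Suc n) u = (\<Sum>w\<in>W n. En (Suc 0) (u \<circ> Fw w))"
  using energy_add[of n "Suc 0" u] by simp

lemma energy_le_energy_Suc:
  obtains C where "1 \<le> C" "\<And>n u. En n u \<le> C * En (Suc n) u"
proof -
  obtain C where C: "0 < C"
    "\<And>u x y. x \<in> V (Suc 0) \<Longrightarrow> y \<in> V (Suc 0) \<Longrightarrow> (u x - u y)\<^sup>2 \<le> C * En (Suc 0) u" by (rule V1_chain) (rule that)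
  define C' where "C' = 1 + real (card (V 0)) * real (card (V 0)) * C"
  have pe: "pair_energy (V 0) u \<le> C' * En (Suc 0) u" for u
  proof -
    have "pair_energy (V 0) u \<le> (\<Sum>x\<in>V 0. \<Sum>y\<in>V 0. \<bar>u x - u y\<bar>\<^sup>2)"
      unfolding pair_energy_def by (simp add: sum_nonneg)
    also have "\<dots> \<le> (\<Sum>x\<in>V 0. \<Sum>y\<in>V 0. C * En (Suc 0) u)"
      using C(2) V0_V1 by (intro sum_mono) (auto simp: subset_iff)
    also have "\<dots> \<le> C' * En (Suc 0) u" using energy_nonneg[of "Suc 0" u] by (simp add: C'_def algebra_simps)
    finally show ?thesis .
  qed
  show ?thesis
  proof (rule that[of C'])
    show "1 \<le> C'" using C(1) by (simp add: C'_def)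
    show "En n u \<le> C' * En (Suc n) u" for n u
      unfolding energy_Suc[of n] sum_distrib_left by (subst energy_eq) (intro sum_mono pe)
  qed
qed

lemma local_energy_le: "w \<in> W n \<Longrightarrow> En m (u \<circ> Fw w) \<le> En (n + m) u"
  unfolding energy_add by (intro member_le_sum finite_words energy_nonneg) auto

text \<open>
  Passing from a vertex of a cell to a vertex of a child costs the square root of the energy in that cell.  The costs
  along a sequence of nested cells form a geometric series of ratio \<open>sqrt \<kappa>\<close>.
\<close>

lemma cell_oscillation:
  assumes u: "\<And>n. En n u \<le> A * \<kappa> ^ n" and A: "0 \<le> A" and \<kappa>: "0 < \<kappa>" "\<kappa> < 1"
  obtains H where "0 \<le> H" "\<And>n w x y. w \<in> W n \<Longrightarrow> x \<in> Vs \<Longrightarrow> y \<in> Vs \<Longrightarrow>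
     \<bar>u (Fw w x) - u (Fw w y)\<bar> \<le> H * sqrt \<kappa> ^ n"
proof -
  obtain C where C: "0 < C"
    "\<And>u x y. x \<in> V (Suc 0) \<Longrightarrow> y \<in> V (Suc 0) \<Longrightarrow> (u x - u y)\<^sup>2 \<le> C * En (Suc 0) u" by (rule V1_chain) (rule that)
  define q where "q = sqrt \<kappa>"
  define s where "s = sqrt (C * A)"
  have q: "0 < q" "q < 1" using \<kappa> by (auto simp: q_def)
  have s: "0 \<le> s" using C A by (simp add: s_def)
  have step: "\<bar>u (Fw w x) - u (Fw w y)\<bar> \<le> s * q ^ n" if "w \<in> W n" "x \<in> V (Suc 0)" "y \<in> V (Suc 0)" for n w x y
  proof -
    have "(u (Fw w x) - u (Fw w y))\<^sup>2 \<le> C * En (Suc 0) (u \<circ> Fw w)" using C(2)[OF that(2,3), of "u \<circ> Fw w"] by simp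
    also have "\<dots> \<le> C * (A * \<kappa> ^ Suc n)"
      using local_energy_le[OF that(1), of "Suc 0" u] u[of "Suc n"] C by (intro mult_left_mono) auto
    also have "\<dots> \<le> C * (A * \<kappa> ^ n)" using C A \<kappa> by (intro mult_left_mono power_decreasing) auto
    also have "\<dots> = (s * q ^ n)\<^sup>2"
      using C A \<kappa> by (simp add: s_def q_def power_mult_distrib power_mult[symmetric] mult.commute[of n] power_mult)
    finally show ?thesis using s q by (simp add: power2_le_iff_abs_le)
  qed
  obtain p0 where p0: "p0 \<in> V 0" using V0_nonempty by blast
  define G where "G n = s * q ^ n / (1 - q)" for n
  have G: "s * q ^ n + G (Suc n) = G n" for n using q by (simp add: G_def field_simps)
  have G0: "0 \<le> G n" for n using s q by (simp add: G_def)
  have base: "\<bar>u (Fw w (Fw v p)) - u (Fw w p0)\<bar> \<le> G n" if "w \<in> W n" "v \<in> W m" "p \<in> V 0" for n m w v p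
    using that
  proof (induction m arbitrary: n w v)
    case 0
    then have "\<bar>u (Fw w (Fw v p)) - u (Fw w p0)\<bar> \<le> s * q ^ n"
      using step[of w n p p0] p0 V0_V1 by (auto simp: words_0)
    also have "\<dots> \<le> G n" using G[of n] G0[of "Suc n"] by linarith
    finally show ?case .
  next
    case (Suc m)
    obtain i v' where v: "v = i # v'" "i \<in> {1..N}" "v' \<in> W m" using Suc.prems(2) by (auto simp: words_Suc)
    have wi: "w @ [i] \<in> W (Suc n)" using Suc.prems(1) v(2) by (auto simp: words_def)
    have "\<bar>u (Fw w (Fw v p)) - u (Fw w (F i p0))\<bar> \<le> G (Suc n)"
      using Suc.IH[OF wi v(3) Suc.prems(3)] by (simp add: v(1) word_map_append)
    moreover have "\<bar>u (Fw w (F i p0)) - u (Fw w p0)\<bar> \<le> s * q ^ n"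
    proof (rule step[OF Suc.prems(1)])
      show "F i p0 \<in> V (Suc 0)" using v(2) p0 unfolding vertices.simps(2) by blast
      show "p0 \<in> V (Suc 0)" using p0 V0_V1 by blast
    qed
    ultimately show ?case using G[of n] by linarith
  qed
  have "\<bar>u (Fw w x) - u (Fw w y)\<bar> \<le> 2 * s / (1 - q) * q ^ n"
    if w: "w \<in> W n" and xy: "x \<in> Vs" "y \<in> Vs" for n w x y
  proof -
    obtain m v p m' v' p' where "v \<in> W m" "p \<in> V 0" "x = Fw v p" "v' \<in> W m'" "p' \<in> V 0" "y = Fw v' p'"
      using xy unfolding Vs_iff by blast
    then have "\<bar>u (Fw w x) - u (Fw w p0)\<bar> \<le> G n" "\<bar>u (Fw w y) - u (Fw w p0)\<bar> \<le> G n"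
      using base[OF w] by auto
    moreover have "2 * s / (1 - q) * q ^ n = 2 * G n" by (simp add: G_def)
    ultimately show ?thesis by linarith
  qed
  moreover have "0 \<le> 2 * s / (1 - q)" using s q by simp
  ultimately show ?thesis using that unfolding q_def by blast
qed

lemma closure_Vs: "closure Vs = K"
proof
  show "closure Vs \<subseteq> K" using Vs_K compact_imp_closed[OF compact_K] by (simp add: closure_minimal)
  show "K \<subseteq> closure Vs"
  proof
    fix x assume x: "x \<in> K"
    obtain p where p: "p \<in> V 0" using V0_nonempty by blast
    show "x \<in> closure Vs"
    proof (subst closure_approachable, intro allI impI)
      fix e :: real assume "0 < e"
      then obtain n where n: "\<rho> ^ n * diameter K < e" using rho_pow_small by blast
      obtain w y where w: "w \<in> W n" "y \<in> K" "x = Fw w y" using K_word_cover[OF x] by blast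
      have "dist (Fw w p) x \<le> \<rho> ^ n * diameter K"
        using rho diameter_bounded_bound[OF compact_imp_bounded[OF compact_K], of p y] p V0_K w
        by (auto simp: dist_Fw words_def mult_left_mono)
      then have "dist (Fw w p) x < e" using n by simp
      moreover have "Fw w p \<in> Vs" using p w(1) Vs_iff by blast
      ultimately show "\<exists>y\<in>Vs. dist y x < e" by blast
    qed
  qed
qed

lemma bound_on_K:
  fixes g :: "'a \<Rightarrow> real"
  assumes "continuous_on K g" "\<And>x. x \<in> Vs \<Longrightarrow> g x \<le> c" "x \<in> K"
  shows "g x \<le> c"
  using continuous_le_on_closure[of Vs g x c] assms by (simp add: closure_Vs)

end

section \<open>Integration against the self-similar measure\<close>

lemma geometric_sum_le:
  fixes s :: real
  assumes "0 < s" "s < 1" shows "(\<Sum>k<m. s ^ k) \<le> 1 / (1 - s)"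
proof -
  have "(\<Sum>k<m. s ^ k) \<le> (\<Sum>k. s ^ k)"
    using assms by (intro sum_le_suminf summable_geometric) auto
  then show ?thesis using assms by (simp add: suminf_geometric)
qed

text \<open>
  The Cauchy-Schwarz inequality with geometric weights.  It controls a telescoping sum by its squared terms, at the
  price of an exponential factor that the decay of the terms can absorb.
\<close>

lemma square_sum_le_weighted:
  fixes d :: "nat \<Rightarrow> real"
  assumes s: "0 < s" "s < 1"
  shows "(\<Sum>k<m. d k)\<^sup>2 \<le> (\<Sum>k<m. (d k)\<^sup>2 / s ^ k) / (1 - s)"
proof -
  have "(\<Sum>k<m. d k)\<^sup>2 = (\<Sum>k<m. (sqrt s ^ k) * (d k / sqrt s ^ k))\<^sup>2"
    using s by simp
  also have "\<dots> \<le> (\<Sum>k<m. (sqrt s ^ k)\<^sup>2) * (\<Sum>k<m. (d k / sqrt s ^ k)\<^sup>2)"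
    by (rule Cauchy_Schwarz_ineq_sum)
  also have "(\<Sum>k<m. (sqrt s ^ k)\<^sup>2) = (\<Sum>k<m. s ^ k)"
    using s by (intro sum.cong) (auto simp: power_mult[symmetric] mult.commute[of _ 2] power_mult)
  also have "(\<Sum>k<m. (d k / sqrt s ^ k)\<^sup>2) = (\<Sum>k<m. (d k)\<^sup>2 / s ^ k)"
    using s by (intro sum.cong) (auto simp: power_divide power_mult[symmetric] mult.commute[of _ 2] power_mult)
  also have "(\<Sum>k<m. s ^ k) * (\<Sum>k<m. (d k)\<^sup>2 / s ^ k) \<le> (1 / (1 - s)) * (\<Sum>k<m. (d k)\<^sup>2 / s ^ k)"
  proof (intro mult_right_mono)
    show "(\<Sum>k<m. s ^ k) \<le> 1 / (1 - s)" by (rule geometric_sum_le[OF s])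
    show "0 \<le> (\<Sum>k<m. (d k)\<^sup>2 / s ^ k)" using s by (intro sum_nonneg) auto
  qed
  finally show ?thesis by simp
qed

locale homogeneous_pcf_measure = homogeneous_pcf +
  fixes \<mu> :: "'a measure"
  assumes self_similar_measure: "self_similar_measure N F K \<mu>"
begin

lemma sets_mu: "sets \<mu> = sets (restrict_space borel K)"
  using self_similar_measure by (simp add: self_similar_measure_def)

lemma space_mu: "space \<mu> = K"
  using sets_eq_imp_space_eq[OF sets_mu] by (simp add: space_restrict_space)

lemma emeasure_mu_K: "emeasure \<mu> K = 1"
  using self_similar_measure by (simp add: self_similar_measure_def)

lemma emeasure_mu: "A \<in> sets \<mu> \<Longrightarrow> emeasure \<mu> A = (\<Sum>i=1..N. emeasure \<mu> (F i -` A \<inter> K)) / of_nat N"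
  using self_similar_measure by (simp add: self_similar_measure_def)

sublocale finite_measure \<mu>
  by (rule finite_measureI) (simp add: space_mu emeasure_mu_K)

lemma measure_space_mu: "measure \<mu> (space \<mu>) = 1"
  by (simp add: measure_def space_mu emeasure_mu_K)

lemma continuous_measurable: "continuous_on K f \<Longrightarrow> f \<in> borel_measurable \<mu>"
  using borel_measurable_continuous_on_restrict[of K f] measurable_cong_sets[OF sets_mu refl] by blast

lemma Fw_measurable [measurable]: "set w \<subseteq> {1..N} \<Longrightarrow> Fw w \<in> measurable \<mu> \<mu>"
proof -
  assume w: "set w \<subseteq> {1..N}"
  have "Fw w \<in> measurable \<mu> (restrict_space borel K)"
    using w Fw_in_K by (intro measurable_restrict_space2 continuous_measurable continuous_Fw) (auto simp: space_mu)
  then show ?thesis using measurable_cong_sets[OF refl sets_mu, of \<mu>] by blast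
qed

lemma words_measurable [measurable]: "w \<in> W n \<Longrightarrow> Fw w \<in> measurable \<mu> \<mu>"
  by (rule Fw_measurable) (auto simp: words_def)

lemma F_measurable [measurable]: "i \<in> {1..N} \<Longrightarrow> F i \<in> measurable \<mu> \<mu>"
  using Fw_measurable[of "[i]"] by simp

lemma continuous_integrable:
  fixes f :: "'a \<Rightarrow> real"
  assumes "continuous_on K f" shows "integrable \<mu> f"
proof -
  have "bounded (f ` K)" using compact_continuous_image[OF assms compact_K] compact_imp_bounded by blast
  then obtain B where "\<And>x. x \<in> K \<Longrightarrow> norm (f x) \<le> B" unfolding bounded_iff by blast
  then show ?thesis using continuous_measurable[OF assms]
    by (intro integrable_const_bound[of _ B]) (auto simp: space_mu)
qed

lemma continuous_comp_Fw: "continuous_on K f \<Longrightarrow> w \<in> W n \<Longrightarrow> continuous_on K (\<lambda>x. f (Fw w x))"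
  using continuous_on_compose2[of K f K "Fw w"] continuous_Fw words_in_K by blast

lemma continuous_comp_F: "continuous_on K f \<Longrightarrow> i \<in> {1..N} \<Longrightarrow> continuous_on K (\<lambda>x. f (F i x))"
  using continuous_comp_Fw[of f "[i]" 1] by (auto simp: words_def)

text \<open>
  Integration over a cell is written throughout as integration of the composition with \<open>F i\<close> against \<open>\<mu>\<close>; for a
  function of two variables this turns the double integral into a sum over pairs of words (\<open>increment_words\<close>).
\<close>

lemma nn_integral_self_similar:
  assumes "f \<in> borel_measurable \<mu>"
  shows "of_nat N * (\<integral>\<^sup>+x. f x \<partial>\<mu>) = (\<Sum>i=1..N. \<integral>\<^sup>+x. f (F i x) \<partial>\<mu>)"
  using assms
proof (induction rule: borel_measurable_induct)
  case (cong f g)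
  have "(\<integral>\<^sup>+x. f x \<partial>\<mu>) = (\<integral>\<^sup>+x. g x \<partial>\<mu>)" using cong by (intro nn_integral_cong)
  moreover have "(\<integral>\<^sup>+x. f (F i x) \<partial>\<mu>) = (\<integral>\<^sup>+x. g (F i x) \<partial>\<mu>)" if "i \<in> {1..N}" for i
    using cong(3) F_in_K[OF that] by (intro nn_integral_cong) (auto simp: space_mu)
  ultimately show ?case using cong.IH by simp
next
  case (set A)
  have "(\<integral>\<^sup>+x. indicator A (F i x) \<partial>\<mu>) = emeasure \<mu> (F i -` A \<inter> K)" if i: "i \<in> {1..N}" for i
  proof -
    have "(\<integral>\<^sup>+x. indicator A (F i x) \<partial>\<mu>) = (\<integral>\<^sup>+x. indicator (F i -` A \<inter> K) x \<partial>\<mu>)"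
      by (intro nn_integral_cong) (auto simp: space_mu indicator_def)
    also have "\<dots> = emeasure \<mu> (F i -` A \<inter> K)"
      using measurable_sets[OF F_measurable[OF i] set] by (simp add: space_mu)
    finally show ?thesis .
  qed
  moreover have "of_nat N * emeasure \<mu> A = (\<Sum>i=1..N. emeasure \<mu> (F i -` A \<inter> K))"
  proof -
    have "of_nat N \<noteq> (0::ennreal)" using N_ge_2 by simp
    moreover have "of_nat N \<noteq> (top::ennreal)" by simp
    ultimately show ?thesis
      unfolding emeasure_mu[OF set] ennreal_times_divide
      by (subst mult.commute) (rule mult_divide_eq_ennreal)
  qed
  ultimately show ?case using set by simp
next
  case (mult u c)
  have [measurable]: "u \<in> borel_measurable \<mu>" by (rule mult(2))
  have "(\<integral>\<^sup>+x. c * u (F i x) \<partial>\<mu>) = c * (\<integral>\<^sup>+x. u (F i x) \<partial>\<mu>)" if "i \<in> {1..N}" for i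
    by (rule nn_integral_cmult) (use F_measurable[OF that] in measurable)
  then have "(\<Sum>i=1..N. \<integral>\<^sup>+x. c * u (F i x) \<partial>\<mu>) = c * (\<Sum>i=1..N. \<integral>\<^sup>+x. u (F i x) \<partial>\<mu>)"
    by (simp add: sum_distrib_left)
  also have "\<dots> = of_nat N * (\<integral>\<^sup>+x. c * u x \<partial>\<mu>)"
    unfolding mult.IH[symmetric] by (subst nn_integral_cmult) (auto simp: ac_simps)
  finally show ?case by simp
next
  case (add u v)
  have [measurable]: "u \<in> borel_measurable \<mu>" "v \<in> borel_measurable \<mu>" by (fact add)+
  have "(\<integral>\<^sup>+x. v (F i x) + u (F i x) \<partial>\<mu>) = (\<integral>\<^sup>+x. v (F i x) \<partial>\<mu>) + (\<integral>\<^sup>+x. u (F i x) \<partial>\<mu>)"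
    if "i \<in> {1..N}" for i
    by (rule nn_integral_add) (use F_measurable[OF that] in measurable)
  then have "(\<Sum>i=1..N. \<integral>\<^sup>+x. v (F i x) + u (F i x) \<partial>\<mu>)
     = (\<Sum>i=1..N. \<integral>\<^sup>+x. v (F i x) \<partial>\<mu>) + (\<Sum>i=1..N. \<integral>\<^sup>+x. u (F i x) \<partial>\<mu>)"
    by (simp add: sum.distrib)
  also have "\<dots> = of_nat N * (\<integral>\<^sup>+x. v x + u x \<partial>\<mu>)"
    unfolding add.IH[symmetric] by (subst nn_integral_add) (auto simp: distrib_left)
  finally show ?case by simp
next
  case (seq U)
  have m: "U k \<in> borel_measurable \<mu>" for k by (rule seq(1))
  note [measurable] = m
  have "(\<integral>\<^sup>+x. (SUP k. U k (F i x)) \<partial>\<mu>) = (SUP k. \<integral>\<^sup>+x. U k (F i x) \<partial>\<mu>)" if i: "i \<in> {1..N}" for i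
  proof (rule nn_integral_monotone_convergence_SUP)
    show "incseq (\<lambda>k x. U k (F i x))" using \<open>incseq U\<close> by (auto simp: incseq_def le_fun_def)
    show "(\<lambda>x. U k (F i x)) \<in> borel_measurable \<mu>" for k using F_measurable[OF i] by measurable
  qed
  then have "(\<Sum>i=1..N. \<integral>\<^sup>+x. (SUP k. U k) (F i x) \<partial>\<mu>) = (\<Sum>i=1..N. (SUP k. \<integral>\<^sup>+x. U k (F i x) \<partial>\<mu>))"
    by (simp add: SUP_apply image_image)
  also have "\<dots> = (SUP k. \<Sum>i=1..N. \<integral>\<^sup>+x. U k (F i x) \<partial>\<mu>)"
    using \<open>incseq U\<close> by (intro ennreal_SUP_sum[symmetric])
      (auto simp: incseq_def le_fun_def intro!: nn_integral_mono)
  also have "\<dots> = (SUP k. of_nat N * (\<integral>\<^sup>+x. U k x \<partial>\<mu>))" by (simp only: seq.IH)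
  also have "\<dots> = of_nat N * (SUP k. \<integral>\<^sup>+x. U k x \<partial>\<mu>)" by (simp add: SUP_mult_left_ennreal)
  also have "(SUP k. \<integral>\<^sup>+x. U k x \<partial>\<mu>) = (\<integral>\<^sup>+x. (SUP k. U k x) \<partial>\<mu>)"
    using \<open>incseq U\<close> m by (intro nn_integral_monotone_convergence_SUP[symmetric]) auto
  finally show ?case by (simp add: SUP_apply image_image)
qed

lemma nn_integral_words:
  assumes "f \<in> borel_measurable \<mu>"
  shows "of_nat N ^ n * (\<integral>\<^sup>+x. f x \<partial>\<mu>) = (\<Sum>w\<in>W n. \<integral>\<^sup>+x. f (Fw w x) \<partial>\<mu>)"
proof (induction n)
  case 0
  then show ?case by (simp add: words_0)
next
  case (Suc n)
  have "of_nat N ^ Suc n * (\<integral>\<^sup>+x. f x \<partial>\<mu>) = (\<Sum>w\<in>W n. of_nat N * (\<integral>\<^sup>+x. f (Fw w x) \<partial>\<mu>))"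
    using Suc by (simp add: mult.assoc sum_distrib_left)
  also have "\<dots> = (\<Sum>w\<in>W n. \<Sum>i=1..N. \<integral>\<^sup>+x. f (Fw (w @ [i]) x) \<partial>\<mu>)"
  proof (intro sum.cong refl)
    fix w assume "w \<in> W n"
    then have "(\<lambda>x. f (Fw w x)) \<in> borel_measurable \<mu>"
      using measurable_compose[OF words_measurable assms] by simp
    from nn_integral_self_similar[OF this]
    show "of_nat N * (\<integral>\<^sup>+x. f (Fw w x) \<partial>\<mu>) = (\<Sum>i=1..N. \<integral>\<^sup>+x. f (Fw (w @ [i]) x) \<partial>\<mu>)"
      by (simp add: word_map_append)
  qed
  also have "\<dots> = (\<Sum>w\<in>W (Suc n). \<integral>\<^sup>+x. f (Fw w x) \<partial>\<mu>)" by (simp add: sum_words_Suc)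
  finally show ?case .
qed

lemma integral_self_similar:
  assumes g: "continuous_on K g" "\<And>x. 0 \<le> g x"
  shows "real N * (\<integral>x. g x \<partial>\<mu>) = (\<Sum>i=1..N. \<integral>x. g (F i x) \<partial>\<mu>)"
proof -
  have nn: "(\<integral>\<^sup>+x. ennreal (h x) \<partial>\<mu>) = ennreal (\<integral>x. h x \<partial>\<mu>)" if "continuous_on K h" "\<And>x. 0 \<le> h x" for h
    using that by (intro nn_integral_eq_integral continuous_integrable) auto
  have m: "(\<lambda>x. ennreal (g x)) \<in> borel_measurable \<mu>" using continuous_measurable[OF g(1)] by measurable
  have pos: "0 \<le> (\<integral>x. g x \<partial>\<mu>)" "\<And>i. 0 \<le> (\<integral>x. g (F i x) \<partial>\<mu>)" using g(2) by (auto intro: Bochner_Integration.integral_nonneg)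
  have "ennreal (real N * (\<integral>x. g x \<partial>\<mu>)) = of_nat N * (\<integral>\<^sup>+x. ennreal (g x) \<partial>\<mu>)"
    using nn[OF g] pos by (simp add: ennreal_mult'' ennreal_of_nat_eq_real_of_nat)
  also have "\<dots> = (\<Sum>i=1..N. \<integral>\<^sup>+x. ennreal (g (F i x)) \<partial>\<mu>)" by (rule nn_integral_self_similar[OF m])
  also have "\<dots> = (\<Sum>i=1..N. ennreal (\<integral>x. g (F i x) \<partial>\<mu>))"
    by (intro sum.cong refl nn continuous_comp_F g) auto
  also have "\<dots> = ennreal (\<Sum>i=1..N. \<integral>x. g (F i x) \<partial>\<mu>)" using pos by (intro sum_ennreal) auto
  finally show ?thesis using pos by (subst (asm) ennreal_inj) (auto intro!: sum_nonneg)
qed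

text \<open>
  The double integral at scale \<open>r\<close> in the Besov seminorm.
\<close>

definition increment :: "real \<Rightarrow> ('a \<Rightarrow> real) \<Rightarrow> ennreal" where
  "increment r u = (\<integral>\<^sup>+x. (\<integral>\<^sup>+y. ennreal (\<bar>u x - u y\<bar>\<^sup>2) * indicator (ball x r) y \<partial>\<mu>) \<partial>\<mu>)"

lemma id_measurable [measurable]: "(\<lambda>x. x) \<in> measurable \<mu> borel"
  by (rule continuous_measurable) (rule continuous_on_id)

lemma increment_words:
  assumes u: "continuous_on K u"
  shows "of_nat N ^ n * (of_nat N ^ n * increment r u) =
    (\<Sum>w\<in>W n. \<Sum>w'\<in>W n. \<integral>\<^sup>+x. (\<integral>\<^sup>+y. ennreal (\<bar>u (Fw w x) - u (Fw w' y)\<bar>\<^sup>2) * indicator (ball (Fw w x) r) (Fw w' y) \<partial>\<mu>) \<partial>\<mu>)"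
proof -
  have [measurable]: "u \<in> borel_measurable \<mu>" by (rule continuous_measurable[OF u])
  define k where "k x y = ennreal (\<bar>u x - u y\<bar>\<^sup>2) * (if dist x y < r then 1 else 0)" for x y :: 'a
  have k_eq: "ennreal (\<bar>u x - u y\<bar>\<^sup>2) * indicator (ball x r) y = k x y" for x y
    by (simp add: k_def indicator_def)
  have km: "(\<lambda>z. k (fst z) (snd z)) \<in> borel_measurable (\<mu> \<Otimes>\<^sub>M \<mu>)" unfolding k_def by measurable
  have km1: "(\<lambda>y. k x y) \<in> borel_measurable \<mu>" for x
  proof -
    have [measurable]: "(\<lambda>y. dist x y) \<in> borel_measurable \<mu>"
      by (rule continuous_measurable) (intro continuous_intros)
    show ?thesis unfolding k_def by measurable
  qed
  have kw: "(\<lambda>z. k (fst z) (Fw w' (snd z))) \<in> borel_measurable (\<mu> \<Otimes>\<^sub>M \<mu>)" if "w' \<in> W n" for w'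
  proof -
    have [measurable]: "Fw w' \<in> measurable \<mu> \<mu>" by (rule words_measurable[OF that])
    have "(\<lambda>z. (fst z, Fw w' (snd z))) \<in> measurable (\<mu> \<Otimes>\<^sub>M \<mu>) (\<mu> \<Otimes>\<^sub>M \<mu>)" by measurable
    from measurable_compose[OF this km] show ?thesis by simp
  qed
  have h1: "(\<lambda>x. \<integral>\<^sup>+y. k x y \<partial>\<mu>) \<in> borel_measurable \<mu>"
    by (rule borel_measurable_nn_integral) (use km in \<open>simp add: case_prod_unfold\<close>)
  have h2: "(\<lambda>x. \<integral>\<^sup>+y. k x (Fw w' y) \<partial>\<mu>) \<in> borel_measurable \<mu>" if "w' \<in> W n" for w'
    by (rule borel_measurable_nn_integral) (use kw[OF that] in \<open>simp add: case_prod_unfold\<close>)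
  have h3: "(\<lambda>x. \<integral>\<^sup>+y. k (Fw w x) (Fw w' y) \<partial>\<mu>) \<in> borel_measurable \<mu>" if "w \<in> W n" "w' \<in> W n" for w w'
    using measurable_compose[OF words_measurable[OF that(1)] h2[OF that(2)]] .
  have "of_nat N ^ n * (of_nat N ^ n * increment r u) = of_nat N ^ n * (of_nat N ^ n * (\<integral>\<^sup>+x. \<integral>\<^sup>+y. k x y \<partial>\<mu> \<partial>\<mu>))"
    by (simp only: increment_def k_eq)
  also have "\<dots> = of_nat N ^ n * (\<Sum>w\<in>W n. \<integral>\<^sup>+x. (\<integral>\<^sup>+y. k (Fw w x) y \<partial>\<mu>) \<partial>\<mu>)"
    by (subst nn_integral_words[OF h1]) simp
  also have "\<dots> = (\<Sum>w\<in>W n. \<integral>\<^sup>+x. of_nat N ^ n * (\<integral>\<^sup>+y. k (Fw w x) y \<partial>\<mu>) \<partial>\<mu>)"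
    unfolding sum_distrib_left
    by (intro sum.cong refl nn_integral_cmult[symmetric] measurable_compose[OF words_measurable h1])
  also have "\<dots> = (\<Sum>w\<in>W n. \<integral>\<^sup>+x. (\<Sum>w'\<in>W n. \<integral>\<^sup>+y. k (Fw w x) (Fw w' y) \<partial>\<mu>) \<partial>\<mu>)"
    by (simp only: nn_integral_words[OF km1])
  also have "\<dots> = (\<Sum>w\<in>W n. \<Sum>w'\<in>W n. \<integral>\<^sup>+x. \<integral>\<^sup>+y. k (Fw w x) (Fw w' y) \<partial>\<mu> \<partial>\<mu>)"
    by (intro sum.cong refl nn_integral_sum h3)
  finally show ?thesis by (simp only: k_eq)
qed

definition variance_mu :: "('a \<Rightarrow> real) \<Rightarrow> real" where
  "variance_mu g = (\<integral>x. (g x - (\<integral>y. g y \<partial>\<mu>))\<^sup>2 \<partial>\<mu>)"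

lemma integral_square_diff:
  fixes g :: "'a \<Rightarrow> real"
  assumes "continuous_on K g"
  shows "(\<integral>x. (g x - c)\<^sup>2 \<partial>\<mu>) = (\<integral>x. (g x)\<^sup>2 \<partial>\<mu>) - 2 * c * (\<integral>x. g x \<partial>\<mu>) + c\<^sup>2"
proof -
  have i: "integrable \<mu> g" "integrable \<mu> (\<lambda>x. (g x)\<^sup>2)"
    using assms by (auto intro!: continuous_integrable continuous_intros)
  have "(\<integral>x. (g x - c)\<^sup>2 \<partial>\<mu>) = (\<integral>x. (g x)\<^sup>2 - 2 * c * g x + c\<^sup>2 \<partial>\<mu>)"
    by (intro Bochner_Integration.integral_cong refl) (simp add: power2_eq_square algebra_simps)
  also have "\<dots> = (\<integral>x. (g x)\<^sup>2 \<partial>\<mu>) - 2 * c * (\<integral>x. g x \<partial>\<mu>) + c\<^sup>2"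
    using i by (simp add: measure_space_mu)
  finally show ?thesis .
qed

lemma variance_eq:
  assumes "continuous_on K g"
  shows "variance_mu g = (\<integral>x. (g x)\<^sup>2 \<partial>\<mu>) - (\<integral>x. g x \<partial>\<mu>)\<^sup>2"
  unfolding variance_mu_def integral_square_diff[OF assms] by (simp add: power2_eq_square)

lemma variance_nonneg: "0 \<le> variance_mu g"
  unfolding variance_mu_def by (intro Bochner_Integration.integral_nonneg) auto

lemma square_integral_le:
  fixes g :: "'a \<Rightarrow> real"
  assumes "continuous_on K g"
  shows "((\<integral>x. g x \<partial>\<mu>) - c)\<^sup>2 \<le> (\<integral>x. (g x - c)\<^sup>2 \<partial>\<mu>)"
proof -
  have "0 \<le> (\<integral>x. (g x)\<^sup>2 \<partial>\<mu>) - (\<integral>x. g x \<partial>\<mu>)\<^sup>2" using variance_nonneg[of g] variance_eq[OF assms] by simp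
  then show ?thesis unfolding integral_square_diff[OF assms] by (simp add: power2_eq_square algebra_simps)
qed

lemma double_integral_eq_variance:
  assumes g: "continuous_on K g"
  shows "(\<integral>\<^sup>+x. (\<integral>\<^sup>+y. ennreal (\<bar>g x - g y\<bar>\<^sup>2) \<partial>\<mu>) \<partial>\<mu>) = ennreal (2 * variance_mu g)"
proof -
  let ?m = "\<integral>y. g y \<partial>\<mu>" and ?s = "\<integral>y. (g y)\<^sup>2 \<partial>\<mu>"
  have c: "continuous_on K (\<lambda>x. (g x)\<^sup>2 - 2 * ?m * g x + ?s)" "\<And>c. continuous_on K (\<lambda>x. (g x - c)\<^sup>2)"
    using g by (auto intro!: continuous_intros)
  have inner: "(\<integral>\<^sup>+y. ennreal (\<bar>g x - g y\<bar>\<^sup>2) \<partial>\<mu>) = ennreal ((g x)\<^sup>2 - 2 * ?m * g x + ?s)" for x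
  proof -
    have "(\<integral>\<^sup>+y. ennreal (\<bar>g x - g y\<bar>\<^sup>2) \<partial>\<mu>) = (\<integral>\<^sup>+y. ennreal ((g y - g x)\<^sup>2) \<partial>\<mu>)"
      by (simp add: power2_commute)
    also have "\<dots> = ennreal (\<integral>y. (g y - g x)\<^sup>2 \<partial>\<mu>)"
      by (intro nn_integral_eq_integral continuous_integrable c) auto
    also have "(\<integral>y. (g y - g x)\<^sup>2 \<partial>\<mu>) = (g x)\<^sup>2 - 2 * ?m * g x + ?s"
      unfolding integral_square_diff[OF g] by simp
    finally show ?thesis .
  qed
  have pos: "0 \<le> (g x)\<^sup>2 - 2 * ?m * g x + ?s" for x
  proof -
    have "0 \<le> (\<integral>y. (g y - g x)\<^sup>2 \<partial>\<mu>)" by (intro Bochner_Integration.integral_nonneg) auto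
    then show ?thesis unfolding integral_square_diff[OF g] by (simp add: algebra_simps)
  qed
  have "(\<integral>\<^sup>+x. ennreal ((g x)\<^sup>2 - 2 * ?m * g x + ?s) \<partial>\<mu>) = ennreal (\<integral>x. (g x)\<^sup>2 - 2 * ?m * g x + ?s \<partial>\<mu>)"
    using pos by (intro nn_integral_eq_integral continuous_integrable c) auto
  also have "(\<integral>x. (g x)\<^sup>2 - 2 * ?m * g x + ?s \<partial>\<mu>) = 2 * variance_mu g"
  proof -
    have "integrable \<mu> g" "integrable \<mu> (\<lambda>x. (g x)\<^sup>2)"
      using g by (auto intro!: continuous_integrable continuous_intros)
    then show ?thesis unfolding variance_eq[OF g] by (simp add: measure_space_mu power2_eq_square)
  qed
  finally show ?thesis by (simp only: inner)
qed

lemma dist_Fw_le: "w \<in> W n \<Longrightarrow> x \<in> K \<Longrightarrow> y \<in> K \<Longrightarrow> dist (Fw w x) (Fw w y) \<le> \<rho> ^ n * diameter K"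
  using rho diameter_bounded_bound[OF compact_imp_bounded[OF compact_K], of x y]
  by (simp add: dist_Fw mult_left_mono words_def)

text \<open>
  Only the pairs of equal words are kept; two points of one cell of level \<open>n\<close> are closer than \<open>r\<close>.
\<close>

lemma sum_variance_le_increment:
  assumes u: "continuous_on K u" and r: "\<rho> ^ n * diameter K < r"
  shows "ennreal (\<Sum>w\<in>W n. 2 * variance_mu (u \<circ> Fw w)) \<le> of_nat N ^ n * (of_nat N ^ n * increment r u)"
proof -
  let ?J = "\<lambda>w w'. \<integral>\<^sup>+x. (\<integral>\<^sup>+y. ennreal (\<bar>u (Fw w x) - u (Fw w' y)\<bar>\<^sup>2) * indicator (ball (Fw w x) r) (Fw w' y) \<partial>\<mu>) \<partial>\<mu>"
  have "ennreal (2 * variance_mu (u \<circ> Fw w)) = ?J w w" if w: "w \<in> W n" for w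
  proof -
    have c: "continuous_on K (u \<circ> Fw w)" using continuous_comp_Fw[OF u w] by (simp add: o_def)
    have "Fw w y \<in> ball (Fw w x) r" if "x \<in> K" "y \<in> K" for x y
      using dist_Fw_le[OF w that] r by simp
    then have "?J w w = (\<integral>\<^sup>+x. (\<integral>\<^sup>+y. ennreal (\<bar>(u \<circ> Fw w) x - (u \<circ> Fw w) y\<bar>\<^sup>2) \<partial>\<mu>) \<partial>\<mu>)"
      by (intro nn_integral_cong) (simp add: space_mu)
    then show ?thesis using double_integral_eq_variance[OF c] by simp
  qed
  then have "ennreal (\<Sum>w\<in>W n. 2 * variance_mu (u \<circ> Fw w)) = (\<Sum>w\<in>W n. ?J w w)"
    by (subst sum_ennreal[symmetric]) (auto simp: variance_nonneg)
  also have "\<dots> \<le> (\<Sum>w\<in>W n. \<Sum>w'\<in>W n. ?J w w')"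
    by (intro sum_mono member_le_sum finite_words) auto
  also have "\<dots> = of_nat N ^ n * (of_nat N ^ n * increment r u)" by (rule increment_words[OF u, symmetric])
  finally show ?thesis .
qed

lemma mean_child_diff_le:
  assumes g: "continuous_on K g" and i: "i \<in> {1..N}"
  shows "((\<integral>x. g (F i x) \<partial>\<mu>) - (\<integral>x. g x \<partial>\<mu>))\<^sup>2 \<le> real N * variance_mu g"
proof -
  let ?m = "\<integral>x. g x \<partial>\<mu>"
  have "((\<integral>x. g (F i x) \<partial>\<mu>) - ?m)\<^sup>2 \<le> (\<integral>x. (g (F i x) - ?m)\<^sup>2 \<partial>\<mu>)"
    by (rule square_integral_le[OF continuous_comp_F[OF g i]])
  also have "\<dots> \<le> (\<Sum>i=1..N. \<integral>x. (g (F i x) - ?m)\<^sup>2 \<partial>\<mu>)"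
    using i by (intro member_le_sum) (auto intro!: Bochner_Integration.integral_nonneg)
  also have "\<dots> = real N * (\<integral>x. (g x - ?m)\<^sup>2 \<partial>\<mu>)"
    using g by (intro integral_self_similar[symmetric] continuous_intros) auto
  finally show ?thesis by (simp add: variance_mu_def)
qed


section \<open>Cell averages and discrete energies\<close>

lemma cell_path:
  assumes "p \<in> K"
  obtains \<omega> where "\<And>k. map \<omega> [0..<k] \<in> W k" "\<And>k. \<omega> k \<in> {1..N}" "\<And>k. p \<in> Fw (map \<omega> [0..<k]) ` K"
proof -
  obtain \<omega> where \<omega>: "\<omega> \<in> inf_words N" "coding F K \<omega> = p" using coding_surj[OF assms] .
  show ?thesis
  proof (rule that[of \<omega>])
    show "map \<omega> [0..<k] \<in> W k" for k using \<omega>(1) by (auto simp: words_def inf_words_def)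
    show "\<omega> k \<in> {1..N}" for k using \<omega>(1) by (simp add: inf_words_def)
    show "p \<in> Fw (map \<omega> [0..<k]) ` K" for k using coding_mem[OF \<omega>(1), of k] \<omega>(2) by simp
  qed
qed

lemma mean_tendsto:
  fixes u :: "'a \<Rightarrow> real"
  assumes u: "continuous_on K u" and w: "w \<in> W n" and path: "\<And>k. v k \<in> W k" "\<And>k. p \<in> Fw (v k) ` K"
  shows "(\<lambda>k. \<integral>x. u (Fw (w @ v k) x) \<partial>\<mu>) \<longlonglongrightarrow> u (Fw w p)"
proof (rule LIMSEQ_I)
  fix e :: real assume e: "0 < e"
  have "uniformly_continuous_on K u" by (rule compact_uniformly_continuous[OF u compact_K])
  then obtain d where d: "0 < d" "\<And>x y. x \<in> K \<Longrightarrow> y \<in> K \<Longrightarrow> dist x y < d \<Longrightarrow> dist (u x) (u y) < e / 2"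
    unfolding uniformly_continuous_on_def using half_gt_zero[OF e] by (metis dist_commute)
  have "(\<lambda>k. \<rho> ^ (n + k) * diameter K) \<longlonglongrightarrow> 0 * diameter K"
    using rho LIMSEQ_ignore_initial_segment[OF LIMSEQ_power_zero, of \<rho> n]
    by (intro tendsto_mult tendsto_const) (auto simp: add.commute)
  then have "eventually (\<lambda>k. \<rho> ^ (n + k) * diameter K < d) sequentially"
    using d(1) by (intro order_tendstoD(2)) auto
  then obtain k0 where k0: "\<And>k. k \<ge> k0 \<Longrightarrow> \<rho> ^ (n + k) * diameter K < d"
    unfolding eventually_sequentially by blast
  have "norm ((\<integral>x. u (Fw (w @ v k) x) \<partial>\<mu>) - u (Fw w p)) < e" if k: "k \<ge> k0" for k
  proof -
    have wv: "w @ v k \<in> W (n + k)" using append_in_words[OF w path(1)] .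
    obtain q where q: "q \<in> K" "p = Fw (v k) q" using path(2)[of k] by blast
    let ?g = "\<lambda>x. u (Fw (w @ v k) x)"
    have c: "continuous_on K ?g" by (rule continuous_comp_Fw[OF u wv])
    have bd: "\<bar>?g x - ?g q\<bar> \<le> e / 2" if "x \<in> K" for x
      using d(2)[of "Fw (w @ v k) x" "Fw (w @ v k) q"] dist_Fw_le[OF wv that q(1)] k0[OF k]
        words_in_K[OF wv] that q(1) by (simp add: dist_real_def)
    have "(\<integral>x. ?g x \<partial>\<mu>) - u (Fw w p) = (\<integral>x. ?g x - ?g q \<partial>\<mu>)"
      using continuous_integrable[OF c] q by (simp add: measure_space_mu word_map_append)
    also have "\<bar>\<dots>\<bar> \<le> (\<integral>x. \<bar>?g x - ?g q\<bar> \<partial>\<mu>)" by (rule integral_abs_bound)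
    also have "\<dots> \<le> (\<integral>x. e / 2 \<partial>\<mu>)"
      using c bd by (intro integral_mono continuous_integrable continuous_intros) (auto simp: space_mu)
    also have "\<dots> < e" using e by (simp add: measure_space_mu)
    finally show ?thesis by simp
  qed
  then show "\<exists>k0. \<forall>k\<ge>k0. norm ((\<integral>x. u (Fw (w @ v k) x) \<partial>\<mu>) - u (Fw w p)) < e" by blast
qed

text \<open>
  A vertex value is the limit of the averages over the cells that shrink to the vertex.  Successive averages differ by
  at most the standard deviation in the larger cell, up to a constant.  For a fixed vertex \<open>p\<close> of \<open>V 0\<close> the cells
  used at depth \<open>k\<close> below the different cells of level \<open>n\<close> are distinct cells of level \<open>n + k\<close>, so the sum of their
  variances is at most the total variance at that level.
\<close>

lemma energy_le_of_variance:
  assumes u: "continuous_on K u" and \<kappa>: "0 < \<kappa>" "\<kappa> < 1" and A: "0 \<le> A"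
    and var: "\<And>n. n0 \<le> n \<Longrightarrow> (\<Sum>w\<in>W n. variance_mu (u \<circ> Fw w)) \<le> A * \<kappa> ^ n"
  obtains B where "0 \<le> B" "\<And>n. n0 \<le> n \<Longrightarrow> En n u \<le> B * \<kappa> ^ n"
proof -
  define s where "s = sqrt \<kappa>"
  have s: "0 < s" "s < 1" "s * s = \<kappa>" using \<kappa> by (auto simp: s_def)
  define B where "B = real N * A / (1 - s) / (1 - s)"
  let ?a = "\<lambda>w. \<integral>x. u (Fw w x) \<partial>\<mu>"
  have child: "(?a (v @ [i]) - ?a v)\<^sup>2 \<le> real N * variance_mu (u \<circ> Fw v)" if "v \<in> W k" "i \<in> {1..N}" for v k i
    using mean_child_diff_le[OF continuous_comp_Fw[OF u that(1)] that(2)] by (simp add: word_map_append o_def)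
  have vertex: "(\<Sum>w\<in>W n. (u (Fw w p) - ?a w)\<^sup>2) \<le> B * \<kappa> ^ n" if n: "n0 \<le> n" and p: "p \<in> V 0" for n p
  proof -
    have "p \<in> K" using p V0_K by blast
    then obtain \<omega> where \<omega>: "\<And>k. map \<omega> [0..<k] \<in> W k" "\<And>k. \<omega> k \<in> {1..N}" "\<And>k. p \<in> Fw (map \<omega> [0..<k]) ` K"
      using cell_path by metis
    define v where "v k = map \<omega> [0..<k]" for k
    have v: "v k \<in> W k" "v (Suc k) = v k @ [\<omega> k]" for k using \<omega>(1) by (auto simp: v_def)
    have step: "(\<Sum>w\<in>W n. (?a (w @ v (Suc k)) - ?a (w @ v k))\<^sup>2) \<le> real N * (A * \<kappa> ^ (n + k))" for k
    proof -
      have "(\<Sum>w\<in>W n. (?a (w @ v (Suc k)) - ?a (w @ v k))\<^sup>2)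
         \<le> (\<Sum>w\<in>W n. real N * variance_mu (u \<circ> Fw (w @ v k)))"
        using child[OF append_in_words[OF _ v(1)] \<omega>(2)] by (intro sum_mono) (simp add: v(2))
      also have "\<dots> \<le> (\<Sum>w\<in>W n. \<Sum>v\<in>W k. real N * variance_mu (u \<circ> Fw (w @ v)))"
        using v(1) by (intro sum_mono member_le_sum finite_words) (auto simp: variance_nonneg)
      also have "\<dots> = real N * (\<Sum>w\<in>W (n + k). variance_mu (u \<circ> Fw w))"
        by (simp add: sum_words_add sum_distrib_left)
      also have "\<dots> \<le> real N * (A * \<kappa> ^ (n + k))" using var[of "n + k"] n by (intro mult_left_mono) auto
      finally show ?thesis .
    qed
    have part: "(\<Sum>w\<in>W n. (?a (w @ v m) - ?a w)\<^sup>2) \<le> B * \<kappa> ^ n" for m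
    proof -
      have "(\<Sum>w\<in>W n. (?a (w @ v m) - ?a w)\<^sup>2)
         = (\<Sum>w\<in>W n. (\<Sum>k<m. ?a (w @ v (Suc k)) - ?a (w @ v k))\<^sup>2)"
        by (subst sum_lessThan_telescope) (simp add: v_def)
      also have "\<dots> \<le> (\<Sum>w\<in>W n. (\<Sum>k<m. (?a (w @ v (Suc k)) - ?a (w @ v k))\<^sup>2 / s ^ k) / (1 - s))"
        by (intro sum_mono square_sum_le_weighted s)
      also have "\<dots> = (\<Sum>k<m. (\<Sum>w\<in>W n. (?a (w @ v (Suc k)) - ?a (w @ v k))\<^sup>2) / s ^ k) / (1 - s)"
        by (subst sum_divide_distrib[symmetric], subst sum.swap) (simp add: sum_divide_distrib)
      also have "\<dots> \<le> (\<Sum>k<m. real N * (A * \<kappa> ^ (n + k)) / s ^ k) / (1 - s)"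
        using s by (intro divide_right_mono sum_mono step) auto
      also have "\<dots> = (real N * A * \<kappa> ^ n / (1 - s)) * (\<Sum>k<m. s ^ k)"
      proof -
        have "\<kappa> ^ (n + k) / s ^ k = \<kappa> ^ n * s ^ k" for k
          using s by (simp add: power_add power_mult_distrib flip: s(3))
        then have "real N * (A * \<kappa> ^ (n + k)) / s ^ k = real N * A * \<kappa> ^ n * s ^ k" for k
          by (metis mult.assoc times_divide_eq_right)
        then show ?thesis by (simp add: sum_distrib_left sum_divide_distrib)
      qed
      also have "\<dots> \<le> (real N * A * \<kappa> ^ n / (1 - s)) * (1 / (1 - s))"
      proof (intro mult_left_mono)
        show "(\<Sum>k<m. s ^ k) \<le> 1 / (1 - s)" by (rule geometric_sum_le[OF s(1,2)])
        show "0 \<le> real N * A * \<kappa> ^ n / (1 - s)" using A \<kappa> s by simp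
      qed
      finally show ?thesis by (simp add: B_def)
    qed
    have "(\<lambda>m. \<Sum>w\<in>W n. (?a (w @ v m) - ?a w)\<^sup>2) \<longlonglongrightarrow> (\<Sum>w\<in>W n. (u (Fw w p) - ?a w)\<^sup>2)"
      using \<omega>(3) v(1) by (intro tendsto_intros mean_tendsto[OF u]) (auto simp: v_def)
    then show ?thesis by (rule LIMSEQ_le_const2) (use part in blast)
  qed
  define M where "M = 2 * real (card (V 0)) * real (card (V 0)) * B"
  have B: "0 \<le> B" using A s by (simp add: B_def)
  show ?thesis
  proof (rule that[of M])
    show "0 \<le> M" using B by (simp add: M_def)
    fix n assume n: "n0 \<le> n"
    have pe: "pair_energy (V 0) g \<le> 2 * real (card (V 0)) * (\<Sum>p\<in>V 0. (g p - a)\<^sup>2)" for g and a :: real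
    proof -
      have "pair_energy (V 0) g \<le> 1/2 * (\<Sum>x\<in>V 0. \<Sum>y\<in>V 0. 2 * (g x - a)\<^sup>2 + 2 * (g y - a)\<^sup>2)"
        unfolding pair_energy_def
      proof (intro mult_left_mono sum_mono)
        fix x y
        show "\<bar>g x - g y\<bar>\<^sup>2 \<le> 2 * (g x - a)\<^sup>2 + 2 * (g y - a)\<^sup>2"
          using zero_le_power2[of "(g x - a) + (g y - a)"] by (simp add: power2_eq_square algebra_simps)
      qed auto
      also have "\<dots> = 2 * real (card (V 0)) * (\<Sum>p\<in>V 0. (g p - a)\<^sup>2)"
        by (simp add: sum.distrib sum_distrib_left algebra_simps)
      finally show ?thesis .
    qed
    have "En n u \<le> (\<Sum>w\<in>W n. 2 * real (card (V 0)) * (\<Sum>p\<in>V 0. ((u \<circ> Fw w) p - ?a w)\<^sup>2))"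
      unfolding energy_eq by (intro sum_mono pe)
    also have "\<dots> = 2 * real (card (V 0)) * (\<Sum>p\<in>V 0. \<Sum>w\<in>W n. (u (Fw w p) - ?a w)\<^sup>2)"
      by (simp add: sum_distrib_left) (rule sum.swap)
    also have "\<dots> \<le> 2 * real (card (V 0)) * (\<Sum>p\<in>V 0. B * \<kappa> ^ n)"
      using vertex[OF n] by (intro mult_left_mono sum_mono) auto
    also have "\<dots> = M * \<kappa> ^ n" by (simp add: M_def)
    finally show "En n u \<le> M * \<kappa> ^ n" .
  qed
qed

definition deviation :: "('a \<Rightarrow> real) \<Rightarrow> real" where
  "deviation g = (\<Sum>p\<in>V 0. \<integral>x. (g x - g p)\<^sup>2 \<partial>\<mu>)"

lemma deviation_nonneg: "0 \<le> deviation g"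
  unfolding deviation_def by (intro sum_nonneg Bochner_Integration.integral_nonneg) auto

text \<open>
  In the child \<open>i\<close> the comparison value \<open>g p\<close> is replaced by \<open>g (F i p)\<close>; the error is bounded by the energy of
  level 1.  The weighted inequality \<open>(a + b)\<^sup>2 \<le> t * a\<^sup>2 + t / (t - 1) * b\<^sup>2\<close> keeps the factor in front of the main term
  near 1, so that iteration does not spoil the decay.
\<close>

lemma deviation_self_similar:
  assumes t: "1 < t"
  obtains C where "0 \<le> C" "\<And>g. continuous_on K g \<Longrightarrow>
     deviation g \<le> t / real N * (\<Sum>i=1..N. deviation (g \<circ> F i)) + C * En (Suc 0) g"
proof -
  obtain C where C: "0 < C"
    "\<And>u x y. x \<in> V (Suc 0) \<Longrightarrow> y \<in> V (Suc 0) \<Longrightarrow> (u x - u y)\<^sup>2 \<le> C * En (Suc 0) u" by (rule V1_chain) (rule that)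
  define t' where "t' = t / (t - 1)"
  have t': "0 \<le> t'" using t by (simp add: t'_def)
  have young: "(a + b)\<^sup>2 \<le> t * a\<^sup>2 + t' * b\<^sup>2" for a b :: real
  proof -
    have "t * a\<^sup>2 + t' * b\<^sup>2 - (a + b)\<^sup>2 = ((t - 1) * a - b)\<^sup>2 / (t - 1)"
      using t unfolding t'_def by (simp add: field_simps power2_eq_square)
    also have "\<dots> \<ge> 0" using t by simp
    finally show ?thesis by simp
  qed
  have N: "0 < real N" using N_ge_2 by simp
  show ?thesis
  proof (rule that[of "t' * real (card (V 0)) * C"])
    show "0 \<le> t' * real (card (V 0)) * C" using t' C by simp
    fix g :: "'a \<Rightarrow> real" assume g: "continuous_on K g"
    have gi: "continuous_on K (\<lambda>x. (g (F i x) - c)\<^sup>2)" if "i \<in> {1..N}" for i c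
      by (intro continuous_intros continuous_comp_F g that)
    have one: "real N * (\<integral>x. (g x - g p)\<^sup>2 \<partial>\<mu>) \<le>
       (\<Sum>i=1..N. t * (\<integral>x. (g (F i x) - g (F i p))\<^sup>2 \<partial>\<mu>) + t' * (C * En (Suc 0) g))" if p: "p \<in> V 0" for p
    proof -
      have "real N * (\<integral>x. (g x - g p)\<^sup>2 \<partial>\<mu>) = (\<Sum>i=1..N. \<integral>x. (g (F i x) - g p)\<^sup>2 \<partial>\<mu>)"
        using g by (intro integral_self_similar continuous_intros) auto
      also have "\<dots> \<le> (\<Sum>i=1..N. t * (\<integral>x. (g (F i x) - g (F i p))\<^sup>2 \<partial>\<mu>) + t' * (C * En (Suc 0) g))"
      proof (rule sum_mono)
        fix i assume i: "i \<in> {1..N}"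
        have Fp: "F i p \<in> V (Suc 0)" unfolding vertices.simps(2) using i p by blast
        have p1: "p \<in> V (Suc 0)" using p V0_V1 by blast
        have "(\<integral>x. (g (F i x) - g p)\<^sup>2 \<partial>\<mu>)
            \<le> (\<integral>x. t * (g (F i x) - g (F i p))\<^sup>2 + t' * (g (F i p) - g p)\<^sup>2 \<partial>\<mu>)"
          using young[of "g (F i x) - g (F i p)" "g (F i p) - g p" for x]
          by (intro integral_mono continuous_integrable gi[OF i] continuous_intros) auto
        also have "\<dots> = t * (\<integral>x. (g (F i x) - g (F i p))\<^sup>2 \<partial>\<mu>) + t' * (g (F i p) - g p)\<^sup>2"
          using continuous_integrable[OF gi[OF i]] by (simp add: measure_space_mu)
        also have "\<dots> \<le> t * (\<integral>x. (g (F i x) - g (F i p))\<^sup>2 \<partial>\<mu>) + t' * (C * En (Suc 0) g)"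
          using C(2)[OF Fp p1, of g] t' by (intro add_left_mono mult_left_mono) auto
        finally show "(\<integral>x. (g (F i x) - g p)\<^sup>2 \<partial>\<mu>)
            \<le> t * (\<integral>x. (g (F i x) - g (F i p))\<^sup>2 \<partial>\<mu>) + t' * (C * En (Suc 0) g)" .
      qed
      finally show ?thesis .
    qed
    have "real N * deviation g \<le> (\<Sum>p\<in>V 0. \<Sum>i=1..N. t * (\<integral>x. (g (F i x) - g (F i p))\<^sup>2 \<partial>\<mu>) + t' * (C * En (Suc 0) g))"
      unfolding deviation_def sum_distrib_left by (intro sum_mono one)
    also have "\<dots> = t * (\<Sum>p\<in>V 0. \<Sum>i=1..N. \<integral>x. (g (F i x) - g (F i p))\<^sup>2 \<partial>\<mu>)
        + real N * (t' * real (card (V 0)) * C * En (Suc 0) g)"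
      by (simp add: sum.distrib sum_distrib_left algebra_simps)
    also have "(\<Sum>p\<in>V 0. \<Sum>i=1..N. \<integral>x. (g (F i x) - g (F i p))\<^sup>2 \<partial>\<mu>) = (\<Sum>i=1..N. deviation (g \<circ> F i))"
      unfolding deviation_def by (subst sum.swap) simp
    finally show "deviation g \<le> t / real N * (\<Sum>i=1..N. deviation (g \<circ> F i)) + t' * real (card (V 0)) * C * En (Suc 0) g"
      using N by (simp add: field_simps)
  qed
qed

text \<open>
  Iterating \<open>deviation_self_similar\<close> \<open>k\<close> times leaves a multiple of the total deviation at level \<open>n + k\<close>, for which
  \<open>cell_oscillation\<close> gives the crude bound \<open>O((N * \<kappa>) ^ (n + k))\<close>.  With \<open>t = 1 / sqrt \<kappa>\<close> this remainder is of order
  \<open>sqrt \<kappa> ^ k\<close> and disappears as \<open>k\<close> grows.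
\<close>

lemma sum_deviation_le:
  assumes u: "continuous_on K u" and E: "\<And>n. En n u \<le> A * \<kappa> ^ n" and A: "0 \<le> A" and \<kappa>: "0 < \<kappa>" "\<kappa> < 1"
  obtains B where "0 \<le> B" "\<And>n. (\<Sum>w\<in>W n. deviation (u \<circ> Fw w)) \<le> B * \<kappa> ^ n"
proof -
  define D where "D n = (\<Sum>w\<in>W n. deviation (u \<circ> Fw w))" for n
  define s where "s = sqrt \<kappa>"
  have s: "0 < s" "s < 1" "s * s = \<kappa>" using \<kappa> by (auto simp: s_def)
  \<comment> \<open>chosen so that \<open>t > 1\<close> while \<open>t * \<kappa>\<close> stays below 1\<close>
  define t where "t = 1 / s"
  have t: "1 < t" "t * \<kappa> = s" using s by (auto simp: t_def field_simps)
  have N: "1 \<le> real N" "0 < real N" using N_ge_2 by auto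
  obtain C where C: "0 \<le> C" "\<And>g. continuous_on K g \<Longrightarrow>
     deviation g \<le> t / real N * (\<Sum>i=1..N. deviation (g \<circ> F i)) + C * En (Suc 0) g"
    by (rule deviation_self_similar[OF t(1)]) (rule that)
  have rec: "D n \<le> t / real N * D (Suc n) + C * A * \<kappa> ^ n" for n
  proof -
    have "D n \<le> (\<Sum>w\<in>W n. t / real N * (\<Sum>i=1..N. deviation ((u \<circ> Fw w) \<circ> F i)) + C * En (Suc 0) (u \<circ> Fw w))"
      unfolding D_def using continuous_comp_Fw[OF u] by (intro sum_mono C(2)) (simp add: o_def)
    also have "\<dots> = t / real N * (\<Sum>w\<in>W n. \<Sum>i=1..N. deviation (u \<circ> Fw (w @ [i]))) + C * En (Suc n) u"
      by (simp only: sum.distrib sum_distrib_left energy_Suc[of n] word_map_append word_map_Cons word_map_Nil comp_assoc id_comp comp_id)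
    also have "\<dots> = t / real N * D (Suc n) + C * En (Suc n) u" by (simp add: D_def sum_words_Suc)
    also have "C * En (Suc n) u \<le> C * (A * \<kappa> ^ n)"
    proof (rule mult_left_mono[OF _ C(1)])
      have "A * \<kappa> ^ Suc n \<le> A * \<kappa> ^ n" using A \<kappa> by (intro mult_left_mono power_decreasing) auto
      then show "En (Suc n) u \<le> A * \<kappa> ^ n" using E[of "Suc n"] by linarith
    qed
    finally show ?thesis by (simp add: mult.assoc)
  qed
  obtain H where H: "0 \<le> H" "\<And>n w x y. w \<in> W n \<Longrightarrow> x \<in> Vs \<Longrightarrow> y \<in> Vs \<Longrightarrow>
     \<bar>u (Fw w x) - u (Fw w y)\<bar> \<le> H * sqrt \<kappa> ^ n"
    by (rule cell_oscillation[OF E A \<kappa>]) (rule that)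
  define G where "G = real (card (V 0)) * H\<^sup>2"
  have G: "0 \<le> G" by (simp add: G_def)
  have base: "D n \<le> real N ^ n * G * \<kappa> ^ n" for n
  proof -
    have "deviation (u \<circ> Fw w) \<le> G * \<kappa> ^ n" if w: "w \<in> W n" for w
    proof -
      have "(\<integral>x. ((u \<circ> Fw w) x - (u \<circ> Fw w) p)\<^sup>2 \<partial>\<mu>) \<le> H\<^sup>2 * \<kappa> ^ n" if p: "p \<in> V 0" for p
      proof -
        have c: "continuous_on K (\<lambda>x. (u (Fw w x) - u (Fw w p))\<^sup>2)"
          by (intro continuous_intros continuous_comp_Fw[OF u w])
        have "(u (Fw w x) - u (Fw w p))\<^sup>2 \<le> H\<^sup>2 * \<kappa> ^ n" if x: "x \<in> K" for x
        proof (rule bound_on_K[OF c _ x])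
          fix x assume "x \<in> Vs"
          then have "\<bar>u (Fw w x) - u (Fw w p)\<bar> \<le> H * sqrt \<kappa> ^ n" using H(2)[OF w] p V_in_Vs by blast
          then have "\<bar>u (Fw w x) - u (Fw w p)\<bar>\<^sup>2 \<le> (H * sqrt \<kappa> ^ n)\<^sup>2" by (intro power_mono) auto
          also have "\<dots> = H\<^sup>2 * \<kappa> ^ n"
            using \<kappa> by (simp add: power_mult_distrib power_mult[symmetric] mult.commute[of n] power_mult)
          finally show "(u (Fw w x) - u (Fw w p))\<^sup>2 \<le> H\<^sup>2 * \<kappa> ^ n" by simp
        qed
        then have "(\<integral>x. (u (Fw w x) - u (Fw w p))\<^sup>2 \<partial>\<mu>) \<le> (\<integral>x. H\<^sup>2 * \<kappa> ^ n \<partial>\<mu>)"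
          using c by (intro integral_mono continuous_integrable) (auto simp: space_mu)
        then show ?thesis by (simp add: measure_space_mu)
      qed
      then have "deviation (u \<circ> Fw w) \<le> (\<Sum>p\<in>V 0. H\<^sup>2 * \<kappa> ^ n)" unfolding deviation_def by (intro sum_mono)
      then show ?thesis by (simp add: G_def mult.assoc)
    qed
    then have "D n \<le> (\<Sum>w\<in>W n. G * \<kappa> ^ n)" unfolding D_def by (intro sum_mono)
    then show ?thesis by (simp add: card_words)
  qed
  define B where "B = C * A / (1 - s)"
  have B: "0 \<le> B" using C A s by (simp add: B_def)
  have Bs: "s * B + C * A = B" using s by (simp add: B_def field_simps)
  have iter: "D n \<le> B * \<kappa> ^ n + s ^ k * (real N ^ n * G * \<kappa> ^ n)" for n k
  proof (induction k arbitrary: n)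
    case 0
    show ?case using base[of n] B \<kappa> by (simp add: add_increasing)
  next
    case (Suc k)
    have "D n \<le> t / real N * (B * \<kappa> ^ Suc n + s ^ k * (real N ^ Suc n * G * \<kappa> ^ Suc n)) + C * A * \<kappa> ^ n"
      using rec[of n] Suc[of "Suc n"] t N
        mult_left_mono[OF Suc[of "Suc n"], of "t / real N"] by auto
    also have "\<dots> = (t * \<kappa>) * B / real N * \<kappa> ^ n + (t * \<kappa>) * s ^ k * (real N ^ n * G * \<kappa> ^ n) + C * A * \<kappa> ^ n"
      using N by (simp add: field_simps)
    also have "\<dots> = s * B / real N * \<kappa> ^ n + s ^ Suc k * (real N ^ n * G * \<kappa> ^ n) + C * A * \<kappa> ^ n"
      by (simp add: t(2))
    also have "s * B / real N * \<kappa> ^ n \<le> s * B * \<kappa> ^ n"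
    proof (rule mult_right_mono)
      show "s * B / real N \<le> s * B" using N B s divide_left_mono[of 1 "real N" "s * B"] by simp
    qed (use \<kappa> in simp)
    finally show ?case using arg_cong[OF Bs, of "\<lambda>z. z * \<kappa> ^ n"] by (simp add: algebra_simps)
  qed
  have "D n \<le> B * \<kappa> ^ n" for n
  proof -
    have "(\<lambda>k. B * \<kappa> ^ n + s ^ k * (real N ^ n * G * \<kappa> ^ n)) \<longlonglongrightarrow> B * \<kappa> ^ n + 0 * (real N ^ n * G * \<kappa> ^ n)"
      using s by (intro tendsto_intros LIMSEQ_power_zero) auto
    then show ?thesis using LIMSEQ_le_const[of _ "B * \<kappa> ^ n" "D n"] iter by auto
  qed
  then show ?thesis using that B unfolding D_def by blast
qed

end

section \<open>The Besov seminorm in terms of discrete energies\<close>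

lemma ennreal_le_of_mult_le:
  assumes "0 < a" "ennreal a * x \<le> ennreal X"
  shows "x \<le> ennreal (X / a)"
proof -
  have "ennreal X = ennreal a * ennreal (X / a)"
    using assms(1) by (subst ennreal_mult'[symmetric]) auto
  then have "ennreal a * x \<le> ennreal a * ennreal (X / a)" using assms(2) by simp
  then show ?thesis using assms(1) by (subst (asm) ennreal_mult_le_mult_iff) auto
qed

context homogeneous_pcf_measure
begin

lemma touching_sym: "touching w w' \<longleftrightarrow> touching w' w"
  unfolding touching_def by metis

text \<open>
  Both values are compared with the value at a common vertex.
\<close>

lemma touching_integral_le:
  assumes u: "continuous_on K u" and w: "w \<in> W n" "w' \<in> W n" and t: "touching w w'"
  shows "(\<integral>\<^sup>+x. (\<integral>\<^sup>+y. ennreal (\<bar>u (Fw w x) - u (Fw w' y)\<bar>\<^sup>2) \<partial>\<mu>) \<partial>\<mu>)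
     \<le> ennreal (2 * deviation (u \<circ> Fw w) + 2 * deviation (u \<circ> Fw w'))"
proof -
  obtain p q where pq: "p \<in> V 0" "q \<in> V 0" "Fw w p = Fw w' q" using t unfolding touching_def by blast
  define g where "g x = (u (Fw w x) - u (Fw w p))\<^sup>2" for x
  define h where "h y = (u (Fw w' y) - u (Fw w' q))\<^sup>2" for y
  have c: "continuous_on K g" "continuous_on K h"
    unfolding g_def h_def by (intro continuous_intros continuous_comp_Fw[OF u w(1)] continuous_comp_Fw[OF u w(2)])+
  have pos: "0 \<le> g x" "0 \<le> h x" for x by (auto simp: g_def h_def)
  have ih: "0 \<le> (\<integral>x. h x \<partial>\<mu>)" "0 \<le> (\<integral>x. g x \<partial>\<mu>)" using pos by (auto intro: Bochner_Integration.integral_nonneg)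
  have "(\<integral>\<^sup>+x. (\<integral>\<^sup>+y. ennreal (\<bar>u (Fw w x) - u (Fw w' y)\<bar>\<^sup>2) \<partial>\<mu>) \<partial>\<mu>)
      \<le> (\<integral>\<^sup>+x. (\<integral>\<^sup>+y. ennreal (2 * g x + 2 * h y) \<partial>\<mu>) \<partial>\<mu>)"
  proof (intro nn_integral_mono ennreal_leI)
    fix x y
    show "\<bar>u (Fw w x) - u (Fw w' y)\<bar>\<^sup>2 \<le> 2 * g x + 2 * h y"
      using zero_le_power2[of "(u (Fw w x) - u (Fw w p)) + (u (Fw w' y) - u (Fw w' q))"] pq(3)
      by (simp add: g_def h_def power2_eq_square algebra_simps)
  qed
  also have "\<dots> = (\<integral>\<^sup>+x. ennreal (2 * g x + 2 * (\<integral>y. h y \<partial>\<mu>)) \<partial>\<mu>)"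
  proof (rule nn_integral_cong)
    fix x
    have "(\<integral>\<^sup>+y. ennreal (2 * g x + 2 * h y) \<partial>\<mu>) = ennreal (\<integral>y. 2 * g x + 2 * h y \<partial>\<mu>)"
      using pos by (intro nn_integral_eq_integral continuous_integrable continuous_intros c) auto
    then show "(\<integral>\<^sup>+y. ennreal (2 * g x + 2 * h y) \<partial>\<mu>) = ennreal (2 * g x + 2 * (\<integral>y. h y \<partial>\<mu>))"
      using continuous_integrable[OF c(2)] by (simp add: measure_space_mu)
  qed
  also have "\<dots> = ennreal (\<integral>x. 2 * g x + 2 * (\<integral>y. h y \<partial>\<mu>) \<partial>\<mu>)"
    using pos ih by (intro nn_integral_eq_integral continuous_integrable continuous_intros c) auto
  also have "(\<integral>x. 2 * g x + 2 * (\<integral>y. h y \<partial>\<mu>) \<partial>\<mu>) = 2 * (\<integral>x. g x \<partial>\<mu>) + 2 * (\<integral>y. h y \<partial>\<mu>)"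
    using continuous_integrable[OF c(1)] by (simp add: measure_space_mu)
  also have "ennreal \<dots> \<le> ennreal (2 * deviation (u \<circ> Fw w) + 2 * deviation (u \<circ> Fw w'))"
  proof (intro ennreal_leI add_mono mult_left_mono)
    show "(\<integral>x. g x \<partial>\<mu>) \<le> deviation (u \<circ> Fw w)"
      unfolding deviation_def g_def o_def
      by (rule member_le_sum[OF pq(1) _ finite_V0, of "\<lambda>p. \<integral>x. (u (Fw w x) - u (Fw w p))\<^sup>2 \<partial>\<mu>"])
        (auto intro: Bochner_Integration.integral_nonneg)
    show "(\<integral>x. h x \<partial>\<mu>) \<le> deviation (u \<circ> Fw w')"
      unfolding deviation_def h_def o_def
      by (rule member_le_sum[OF pq(2) _ finite_V0, of "\<lambda>p. \<integral>x. (u (Fw w' x) - u (Fw w' p))\<^sup>2 \<partial>\<mu>"])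
        (auto intro: Bochner_Integration.integral_nonneg)
  qed auto
  finally show ?thesis .
qed

text \<open>
  Pairs of points at distance less than \<open>r\<close> lie in touching cells by \<open>cells_separated\<close>, and a cell touches at most
  \<open>card (V 0) * (N * card P + 1)\<close> cells of its level.
\<close>

lemma increment_le_deviation:
  obtains c M where "0 < c" "0 \<le> M" "\<And>n r u. continuous_on K u \<Longrightarrow> r \<le> c * \<rho> ^ n \<Longrightarrow>
     of_nat N ^ n * (of_nat N ^ n * increment r u) \<le> ennreal (M * (\<Sum>w\<in>W n. deviation (u \<circ> Fw w)))"
proof -
  obtain c where c: "0 < c"
    "\<And>n w w' x y. w \<in> W n \<Longrightarrow> w' \<in> W n \<Longrightarrow> x \<in> K \<Longrightarrow> y \<in> K \<Longrightarrow>
       dist (Fw w x) (Fw w' y) < c * \<rho> ^ n \<Longrightarrow> touching w w'"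
    by (rule cells_separated) (rule that)
  define m where "m = card (V 0) * (N * card P + 1)"
  show ?thesis
  proof (rule that[of c "4 * real m"])
    show "0 < c" "0 \<le> 4 * real m" using c by auto
    fix n r and u :: "'a \<Rightarrow> real" assume u: "continuous_on K u" and r: "r \<le> c * \<rho> ^ n"
    let ?d = "\<lambda>w. deviation (u \<circ> Fw w)"
    let ?J = "\<lambda>w w'. \<integral>\<^sup>+x. (\<integral>\<^sup>+y. ennreal (\<bar>u (Fw w x) - u (Fw w' y)\<bar>\<^sup>2) * indicator (ball (Fw w x) r) (Fw w' y) \<partial>\<mu>) \<partial>\<mu>"
    define T where "T w w' = (if touching w w' then 2 * ?d w + 2 * ?d w' else 0)" for w w'
    have T0: "0 \<le> T w w'" for w w' by (simp add: T_def deviation_nonneg)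
    have J: "?J w w' \<le> ennreal (T w w')" if w: "w \<in> W n" "w' \<in> W n" for w w'
    proof (cases "touching w w'")
      case True
      have "?J w w' \<le> (\<integral>\<^sup>+x. (\<integral>\<^sup>+y. ennreal (\<bar>u (Fw w x) - u (Fw w' y)\<bar>\<^sup>2) \<partial>\<mu>) \<partial>\<mu>)"
        by (intro nn_integral_mono) (auto simp: indicator_def)
      also have "\<dots> \<le> ennreal (T w w')" using touching_integral_le[OF u w True] True by (simp add: T_def)
      finally show ?thesis .
    next
      case False
      have "Fw w' y \<notin> ball (Fw w x) r" if "x \<in> K" "y \<in> K" for x y
        using c(2)[OF w that] False r by fastforce
      then have "?J w w' = (\<integral>\<^sup>+x. (\<integral>\<^sup>+y. 0 \<partial>\<mu>) \<partial>\<mu>)"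
        by (intro nn_integral_cong) (simp add: space_mu)
      then show ?thesis by simp
    qed
    have "of_nat N ^ n * (of_nat N ^ n * increment r u) = (\<Sum>w\<in>W n. \<Sum>w'\<in>W n. ?J w w')"
      by (rule increment_words[OF u])
    also have "\<dots> \<le> (\<Sum>w\<in>W n. \<Sum>w'\<in>W n. ennreal (T w w'))" by (intro sum_mono J)
    also have "\<dots> = ennreal (\<Sum>w\<in>W n. \<Sum>w'\<in>W n. T w w')"
      by (subst sum_ennreal, simp add: T0, subst sum_ennreal) (auto intro: sum_nonneg T0)
    also have "\<dots> \<le> ennreal (4 * real m * (\<Sum>w\<in>W n. ?d w))"
    proof (rule ennreal_leI)
      let ?S = "\<lambda>w w'. if touching w w' then 2 * ?d w else 0"
      have "T w w' = ?S w w' + ?S w' w" for w w' using touching_sym[of w w'] by (simp add: T_def)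
      then have "(\<Sum>w\<in>W n. \<Sum>w'\<in>W n. T w w') = (\<Sum>w\<in>W n. \<Sum>w'\<in>W n. ?S w w') + (\<Sum>w\<in>W n. \<Sum>w'\<in>W n. ?S w' w)"
        by (simp add: sum.distrib)
      also have "(\<Sum>w\<in>W n. \<Sum>w'\<in>W n. ?S w' w) = (\<Sum>w\<in>W n. \<Sum>w'\<in>W n. ?S w w')" by (rule sum.swap)
      also have "(\<Sum>w\<in>W n. \<Sum>w'\<in>W n. ?S w w') = (\<Sum>w\<in>W n. real (card {w' \<in> W n. touching w w'}) * (2 * ?d w))"
        by (intro sum.cong refl) (simp add: sum.If_cases finite_words Int_def)
      also have "\<dots> \<le> (\<Sum>w\<in>W n. real m * (2 * ?d w))"
        using card_touching_le deviation_nonneg unfolding m_def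
        by (intro sum_mono mult_right_mono of_nat_mono) auto
      finally show "(\<Sum>w\<in>W n. \<Sum>w'\<in>W n. T w w') \<le> 4 * real m * (\<Sum>w\<in>W n. ?d w)"
        by (simp add: sum_distrib_left mult.assoc[symmetric]) 
    qed
    finally show "of_nat N ^ n * (of_nat N ^ n * increment r u) \<le> ennreal (4 * real m * (\<Sum>w\<in>W n. ?d w))" .
  qed
qed

lemma of_nat_pow_ennreal: "(of_nat N ^ n * (of_nat N ^ n * x) :: ennreal) = ennreal (real N ^ n * real N ^ n) * x"
  by (simp add: ennreal_mult ennreal_power[symmetric] ennreal_of_nat_eq_real_of_nat mult.assoc)

lemma dimension_pos:
  assumes "\<alpha> = ln (real N) / \<bar>ln \<rho>\<bar>"
  shows "0 < \<alpha>" and "real N = \<rho> powr (- \<alpha>)"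
proof -
  have l: "ln \<rho> < 0" "0 < ln (real N)" using rho N_ge_2 by auto
  then show "0 < \<alpha>" unfolding assms by (intro divide_pos_pos) auto
  have "ln (real N) = - \<alpha> * ln \<rho>" using l by (simp add: assms field_simps)
  then have "exp (ln (real N)) = \<rho> powr (- \<alpha>)" using rho by (simp add: powr_def)
  then show "real N = \<rho> powr (- \<alpha>)" using N_ge_2 by simp
qed

text \<open>
  For \<open>c * \<rho> ^ Suc n \<le> r \<le> c * \<rho> ^ n\<close> the increment is \<open>O(\<kappa> ^ n / N ^ (2 * n))\<close>, which is of order \<open>r powr (\<alpha> + 2 * \<sigma>)\<close>
  because \<open>N = \<rho> powr (- \<alpha>)\<close>.  For \<open>r \<ge> c\<close> the whole double integral serves as a bound.
\<close>

lemma besov_cont_of_energy: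
  assumes \<alpha>: "\<alpha> = ln (real N) / \<bar>ln \<rho>\<bar>" and \<sigma>: "\<alpha> < 2 * \<sigma>"
    and u: "continuous_on K u" and E: "\<And>n. En n u \<le> A * (\<rho> powr (2 * \<sigma> - \<alpha>)) ^ n" and A: "0 \<le> A"
  shows "u \<in> besov_cont K \<mu> \<alpha> \<sigma>"
proof -
  define \<kappa> where "\<kappa> = \<rho> powr (2 * \<sigma> - \<alpha>)"
  define e where "e = \<alpha> + 2 * \<sigma>"
  have e: "0 < e" using \<sigma> dimension_pos(1)[OF \<alpha>] by (simp add: e_def)
  have \<kappa>: "0 < \<kappa>" "\<kappa> < 1" using rho \<sigma> powr_less_mono2[of "2 * \<sigma> - \<alpha>" \<rho> 1] by (auto simp: \<kappa>_def)
  obtain B where B: "0 \<le> B" "\<And>n. (\<Sum>w\<in>W n. deviation (u \<circ> Fw w)) \<le> B * \<kappa> ^ n"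
    by (rule sum_deviation_le[OF u E[folded \<kappa>_def] A \<kappa>]) (rule that)
  obtain c M where cM: "0 < c" "0 \<le> M" "\<And>n r u. continuous_on K u \<Longrightarrow> r \<le> c * \<rho> ^ n \<Longrightarrow>
     of_nat N ^ n * (of_nat N ^ n * increment r u) \<le> ennreal (M * (\<Sum>w\<in>W n. deviation (u \<circ> Fw w)))"
    by (rule increment_le_deviation) (rule that)
  have Npos: "0 < real N ^ n * real N ^ n" for n using N_ge_2 by simp
  have Nk: "\<kappa> ^ n / (real N ^ n * real N ^ n) = (\<rho> powr e) ^ n" for n
  proof -
    have "\<kappa> = \<rho> powr e * (real N * real N)"
      unfolding \<kappa>_def dimension_pos(2)[OF \<alpha>] powr_add[symmetric] by (simp add: e_def)
    then show ?thesis using N_ge_2 by (simp add: power_mult_distrib)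
  qed
  have small: "increment r u \<le> ennreal (M * B * (\<rho> powr e) ^ n)" if "r \<le> c * \<rho> ^ n" for r n
  proof -
    have "ennreal (real N ^ n * real N ^ n) * increment r u \<le> ennreal (M * (\<Sum>w\<in>W n. deviation (u \<circ> Fw w)))"
      using cM(3)[OF u that] unfolding of_nat_pow_ennreal .
    also have "\<dots> \<le> ennreal (M * (B * \<kappa> ^ n))" by (intro ennreal_leI mult_left_mono B cM)
    finally have "increment r u \<le> ennreal (M * (B * \<kappa> ^ n) / (real N ^ n * real N ^ n))"
      by (rule ennreal_le_of_mult_le[OF Npos])
    also have "M * (B * \<kappa> ^ n) / (real N ^ n * real N ^ n) = M * B * (\<rho> powr e) ^ n"
      by (simp flip: Nk)
    finally show ?thesis .
  qed
  define S where "S = max (c powr (- e) * (2 * variance_mu u)) (c powr (- e) * \<rho> powr (- e) * (M * B))"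
  have bound: "ennreal (r powr (- e)) * increment r u \<le> ennreal S" if r: "0 < r" "r < 1" for r
  proof (cases "r < c")
    case False
    have "increment r u \<le> (\<integral>\<^sup>+x. (\<integral>\<^sup>+y. ennreal (\<bar>u x - u y\<bar>\<^sup>2) \<partial>\<mu>) \<partial>\<mu>)"
      unfolding increment_def by (intro nn_integral_mono) (auto simp: indicator_def)
    also have "\<dots> = ennreal (2 * variance_mu u)" by (rule double_integral_eq_variance[OF u])
    finally have "ennreal (r powr (- e)) * increment r u \<le> ennreal (c powr (- e)) * ennreal (2 * variance_mu u)"
      using False cM(1) e by (intro mult_mono ennreal_leI powr_mono2') auto
    also have "\<dots> = ennreal (c powr (- e) * (2 * variance_mu u))" by (simp add: ennreal_mult' )
    also have "\<dots> \<le> ennreal S" by (intro ennreal_leI) (simp add: S_def)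
    finally show ?thesis .
  next
    case True
    define n where "n = (LEAST n. c * \<rho> ^ Suc n \<le> r)"
    have ex: "\<exists>n. c * \<rho> ^ Suc n \<le> r"
    proof -
      obtain n where "\<rho> ^ n * c < r" using rho_pow_small[OF r(1)] by blast
      moreover have "c * \<rho> ^ Suc n \<le> c * \<rho> ^ n" using rho cM(1) by (intro mult_left_mono power_decreasing) auto
      ultimately show ?thesis by (intro exI[of _ n]) (simp add: mult.commute)
    qed
    have n1: "c * \<rho> ^ Suc n \<le> r" unfolding n_def by (rule LeastI_ex[OF ex])
    have n2: "r \<le> c * \<rho> ^ n"
    proof (cases n)
      case 0
      then show ?thesis using True by simp
    next
      case (Suc k)
      then have "\<not> c * \<rho> ^ Suc k \<le> r" using not_less_Least[of k "\<lambda>n. c * \<rho> ^ Suc n \<le> r"] n_def by auto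
      then show ?thesis using Suc by simp
    qed
    have "ennreal (r powr (- e)) * increment r u
        \<le> ennreal ((c * \<rho> ^ Suc n) powr (- e)) * ennreal (M * B * (\<rho> powr e) ^ n)"
      using n1 cM(1) rho e by (intro mult_mono ennreal_leI powr_mono2' small n2) auto
    also have "\<dots> = ennreal ((c * \<rho> ^ Suc n) powr (- e) * (M * B * (\<rho> powr e) ^ n))"
      using cM B by (simp add: ennreal_mult)
    also have "(c * \<rho> ^ Suc n) powr (- e) * (M * B * (\<rho> powr e) ^ n) = c powr (- e) * \<rho> powr (- e) * (M * B)"
    proof -
      have "(c * \<rho> ^ Suc n) powr (- e) = c powr (- e) * \<rho> powr (- e) * (\<rho> ^ n) powr (- e)"
        using cM(1) rho by (simp add: powr_mult)
      moreover have "(\<rho> ^ n) powr (- e) * (\<rho> powr e) ^ n = 1"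
        using rho by (simp add: powr_minus powr_powr powr_realpow[symmetric] mult.commute)
      ultimately show ?thesis by (simp add: algebra_simps)
    qed
    also have "ennreal (c powr (- e) * \<rho> powr (- e) * (M * B)) \<le> ennreal S" by (intro ennreal_leI) (simp add: S_def)
    finally show ?thesis .
  qed
  have "besov_seminorm_sq \<mu> \<alpha> \<sigma> u \<le> ennreal S"
    unfolding besov_seminorm_sq_def increment_def[symmetric]
    using bound by (intro SUP_least) (simp add: e_def)
  then have "besov_seminorm_sq \<mu> \<alpha> \<sigma> u < \<infinity>" by (rule order.strict_trans1) simp
  moreover have "integrable \<mu> (\<lambda>x. (u x)\<^sup>2)" by (intro continuous_integrable continuous_intros u)
  ultimately show ?thesis
    unfolding besov_cont_def besov_def using u continuous_measurable[OF u] by simp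
qed

text \<open>
  The seminorm is used at the radius \<open>\<rho> ^ n * D\<close>, slightly larger than the diameter of a cell of level \<open>n\<close>.  The
  definition only involves radii below 1, which accounts for the threshold \<open>n0\<close>.
\<close>

lemma energy_of_besov_cont:
  assumes \<alpha>: "\<alpha> = ln (real N) / \<bar>ln \<rho>\<bar>" and \<sigma>: "\<alpha> < 2 * \<sigma>" and u: "u \<in> besov_cont K \<mu> \<alpha> \<sigma>"
  obtains B n0 where "0 \<le> B" "\<And>n. n0 \<le> n \<Longrightarrow> En n u \<le> B * (\<rho> powr (2 * \<sigma> - \<alpha>)) ^ n"
proof -
  define \<kappa> where "\<kappa> = \<rho> powr (2 * \<sigma> - \<alpha>)"
  define e where "e = \<alpha> + 2 * \<sigma>"
  have e: "0 < e" using \<sigma> dimension_pos(1)[OF \<alpha>] by (simp add: e_def)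
  have \<kappa>: "0 < \<kappa>" "\<kappa> < 1" using rho \<sigma> powr_less_mono2[of "2 * \<sigma> - \<alpha>" \<rho> 1] by (auto simp: \<kappa>_def)
  have uc: "continuous_on K u" and fin: "besov_seminorm_sq \<mu> \<alpha> \<sigma> u < \<infinity>"
    using u by (auto simp: besov_cont_def besov_def)
  obtain S where S: "0 \<le> S" "besov_seminorm_sq \<mu> \<alpha> \<sigma> u = ennreal S"
    using fin by (cases "besov_seminorm_sq \<mu> \<alpha> \<sigma> u") auto
  have inc: "increment r u \<le> ennreal (S * r powr e)" if r: "0 < r" "r < 1" for r
  proof -
    have "ennreal (r powr (- e)) * increment r u \<le> ennreal S"
      unfolding S(2)[symmetric] besov_seminorm_sq_def increment_def[symmetric]
      using r by (intro SUP_upper2[of r]) (auto simp: e_def)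
    then have "increment r u \<le> ennreal (S / r powr (- e))"
      using r by (intro ennreal_le_of_mult_le) auto
    then show ?thesis using r by (simp add: powr_minus divide_inverse)
  qed
  \<comment> \<open>the summand 1 makes the radius strictly larger than the diameter of a cell\<close>
  define D where "D = diameter K + 1"
  have D: "0 < D" using diameter_ge_0[OF compact_imp_bounded[OF compact_K]] by (simp add: D_def)
  obtain n0 where n0: "\<rho> ^ n0 * D < 1" using rho_pow_small[of 1] by auto
  have rn: "\<rho> ^ n * D < 1" if "n0 \<le> n" for n
  proof -
    have "\<rho> ^ n * D \<le> \<rho> ^ n0 * D" using that rho D by (intro mult_right_mono power_decreasing) auto
    then show ?thesis using n0 by simp
  qed
  have "(\<Sum>w\<in>W n. variance_mu (u \<circ> Fw w)) \<le> (S * D powr e) * \<kappa> ^ n" if n: "n0 \<le> n" for n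
  proof -
    let ?r = "\<rho> ^ n * D"
    have "ennreal (\<Sum>w\<in>W n. 2 * variance_mu (u \<circ> Fw w)) \<le> of_nat N ^ n * (of_nat N ^ n * increment ?r u)"
      using rho by (intro sum_variance_le_increment[OF uc]) (simp add: D_def)
    also have "\<dots> \<le> ennreal (real N ^ n * real N ^ n) * ennreal (S * ?r powr e)"
      unfolding of_nat_pow_ennreal using rho D by (intro mult_left_mono inc rn[OF n]) auto
    also have "\<dots> = ennreal (real N ^ n * real N ^ n * (S * ?r powr e))"
      using S(1) by (simp add: ennreal_mult)
    finally have "(\<Sum>w\<in>W n. 2 * variance_mu (u \<circ> Fw w)) \<le> real N ^ n * real N ^ n * (S * ?r powr e)"
      using S(1) by (subst (asm) ennreal_le_iff) auto
    also have "\<dots> = (S * D powr e) * \<kappa> ^ n"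
    proof -
      have "\<kappa> = \<rho> powr e * (real N * real N)"
        unfolding \<kappa>_def dimension_pos(2)[OF \<alpha>] powr_add[symmetric] by (simp add: e_def)
      moreover have "?r powr e = (\<rho> powr e) ^ n * D powr e"
        using rho D by (simp add: powr_mult powr_powr powr_realpow[symmetric] mult.commute)
      ultimately show ?thesis by (simp add: power_mult_distrib)
    qed
    finally have "(\<Sum>w\<in>W n. 2 * variance_mu (u \<circ> Fw w)) \<le> (S * D powr e) * \<kappa> ^ n" .
    moreover have "0 \<le> (\<Sum>w\<in>W n. variance_mu (u \<circ> Fw w))" by (intro sum_nonneg variance_nonneg)
    ultimately show ?thesis by (simp add: sum_distrib_left[symmetric])
  qed
  moreover have "0 \<le> S * D powr e" using S by simp
  ultimately obtain B where "0 \<le> B" "\<And>n. n0 \<le> n \<Longrightarrow> En n u \<le> B * \<kappa> ^ n"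
    using energy_le_of_variance[OF uc \<kappa>, of "S * D powr e" n0] by blast
  then show ?thesis using that unfolding \<kappa>_def by blast
qed

end

section \<open>Density from extensions of boundary values\<close>

lemma geometric_bound_from:
  fixes a :: "nat \<Rightarrow> real"
  assumes "0 < \<kappa>" "0 \<le> A" "\<And>n. n0 \<le> n \<Longrightarrow> a n \<le> A * \<kappa> ^ n"
  obtains A' where "0 \<le> A'" "\<And>n. a n \<le> A' * \<kappa> ^ n"
proof -
  define A' where "A' = A + (\<Sum>k<n0. \<bar>a k\<bar> / \<kappa> ^ k)"
  have s: "0 \<le> (\<Sum>k<n0. \<bar>a k\<bar> / \<kappa> ^ k)" using assms(1) by (intro sum_nonneg) auto
  have "a n \<le> A' * \<kappa> ^ n" for n
  proof (cases "n0 \<le> n")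
    case True
    have "A * \<kappa> ^ n \<le> A' * \<kappa> ^ n" using s assms(1) by (intro mult_right_mono) (auto simp: A'_def)
    then show ?thesis using assms(3)[OF True] by linarith
  next
    case False
    have "\<bar>a n\<bar> / \<kappa> ^ n \<le> (\<Sum>k<n0. \<bar>a k\<bar> / \<kappa> ^ k)"
      using False assms(1) by (intro member_le_sum) auto
    also have "\<dots> \<le> A'" using assms(2) by (simp add: A'_def)
    finally show ?thesis using assms(1) by (simp add: divide_le_eq)
  qed
  moreover have "0 \<le> A'" using s assms(2) by (simp add: A'_def)
  ultimately show ?thesis using that by blast
qed

context homogeneous_pcf
begin

text \<open>
  Points that are close on the scale of level \<open>n\<close> lie in touching cells, and the oscillation in each cell is small.
\<close>

lemma uniformly_continuous_of_energy:
  assumes u: "\<And>n. En n u \<le> A * \<kappa> ^ n" and A: "0 \<le> A" and \<kappa>: "0 < \<kappa>" "\<kappa> < 1"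
  shows "uniformly_continuous_on Vs u"
  unfolding uniformly_continuous_on_def
proof (intro allI impI)
  fix e :: real assume e: "0 < e"
  obtain H where H: "0 \<le> H" "\<And>n w x y. w \<in> W n \<Longrightarrow> x \<in> Vs \<Longrightarrow> y \<in> Vs \<Longrightarrow>
     \<bar>u (Fw w x) - u (Fw w y)\<bar> \<le> H * sqrt \<kappa> ^ n"
    by (rule cell_oscillation[OF u A \<kappa>]) (rule that)
  obtain c where c: "0 < c"
    "\<And>n w w' x y. w \<in> W n \<Longrightarrow> w' \<in> W n \<Longrightarrow> x \<in> K \<Longrightarrow> y \<in> K \<Longrightarrow>
       dist (Fw w x) (Fw w' y) < c * \<rho> ^ n \<Longrightarrow> touching w w'"
    by (rule cells_separated) (rule that)
  have "(\<lambda>n. 2 * (H * sqrt \<kappa> ^ n)) \<longlonglongrightarrow> 2 * (H * 0)"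
    using \<kappa> by (intro tendsto_intros LIMSEQ_power_zero) auto
  then have "eventually (\<lambda>n. 2 * (H * sqrt \<kappa> ^ n) < e) sequentially"
    using e by (intro order_tendstoD(2)) auto
  then obtain n where n: "2 * (H * sqrt \<kappa> ^ n) < e" by (auto simp: eventually_sequentially)
  have "dist (u y) (u x) < e" if xy: "x \<in> Vs" "y \<in> Vs" "dist y x < c * \<rho> ^ n" for x y
  proof -
    obtain w x' where w: "w \<in> W n" "x' \<in> K" "x = Fw w x'" using K_word_cover[of x n] xy(1) Vs_K by blast
    obtain w' y' where w': "w' \<in> W n" "y' \<in> K" "y = Fw w' y'" using K_word_cover[of y n] xy(2) Vs_K by blast
    have V: "x' \<in> Vs" "y' \<in> Vs" using Vs_pullback w w' xy by auto
    have "touching w' w" using c(2)[OF w'(1) w(1) w'(2) w(2)] xy w w' by simp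
    then obtain p q where pq: "p \<in> Vs" "q \<in> Vs" "Fw w' p = Fw w q"
      unfolding touching_def using V_in_Vs by blast
    have "\<bar>u y - u (Fw w' p)\<bar> \<le> H * sqrt \<kappa> ^ n" using H(2)[OF w'(1) V(2) pq(1)] w' by simp
    moreover have "\<bar>u (Fw w q) - u x\<bar> \<le> H * sqrt \<kappa> ^ n" using H(2)[OF w(1) pq(2) V(1)] w by simp
    ultimately show ?thesis using n pq(3) by (simp add: dist_real_def)
  qed
  moreover have "0 < c * \<rho> ^ n" using c(1) rho by simp
  ultimately show "\<exists>d>0. \<forall>x\<in>Vs. \<forall>x'\<in>Vs. dist x' x < d \<longrightarrow> dist (u x') (u x) < e" by blast
qed

text \<open>
  Truncation at the extreme boundary values is a contraction of the real line, so it does not raise the energy, and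
  it leaves the boundary values alone.  The bounds are what makes the glued functions in \<open>finite_energy_dense\<close> close to
  the function that they interpolate.
\<close>

lemma continuous_markov_extension:
  assumes f: "\<And>p. p \<in> V 0 \<Longrightarrow> f p = g p" "\<And>n. En n f \<le> A * \<kappa> ^ n" "0 \<le> A" and \<kappa>: "0 < \<kappa>" "\<kappa> < 1"
  obtains h where "continuous_on K h" "\<And>p. p \<in> V 0 \<Longrightarrow> h p = g p" "\<And>n. En n h \<le> A * \<kappa> ^ n"
    "\<And>x. x \<in> K \<Longrightarrow> \<exists>p\<in>V 0. \<exists>q\<in>V 0. g p \<le> h x \<and> h x \<le> g q"
proof -
  define lo where "lo = Min (g ` V 0)"
  define hi where "hi = Max (g ` V 0)"
  have lohi: "lo \<le> g p" "g p \<le> hi" if "p \<in> V 0" for p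
    using that finite_V0 by (auto simp: lo_def hi_def)
  have "lo \<in> g ` V 0" "hi \<in> g ` V 0" using finite_V0 V0_nonempty by (auto simp: lo_def hi_def)
  then obtain p q where pq: "p \<in> V 0" "q \<in> V 0" "g p = lo" "g q = hi" by auto
  have lh: "lo \<le> hi" using lohi[OF pq(1)] pq by linarith
  define f' where "f' x = max lo (min hi (f x))" for x
  have E: "En n f' \<le> A * \<kappa> ^ n" for n
  proof -
    have "En n f' \<le> En n f" by (rule energy_mono) (auto simp: f'_def max_def min_def)
    then show ?thesis using f(2)[of n] by linarith
  qed
  have uc: "uniformly_continuous_on Vs f'" by (rule uniformly_continuous_of_energy[OF E f(3) \<kappa>])
  obtain h where h: "uniformly_continuous_on (closure Vs) h" "\<And>x. x \<in> Vs \<Longrightarrow> f' x = h x"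
    using uniformly_continuous_on_extension_on_closure[OF uc] by metis
  have hc: "continuous_on K h" using uniformly_continuous_imp_continuous[OF h(1)] by (simp add: closure_Vs)
  show ?thesis
  proof (rule that[OF hc])
    fix p assume p: "p \<in> V 0"
    then have "h p = f' p" using h(2) V_in_Vs by force
    then show "h p = g p" using f(1)[OF p] lohi[OF p] by (simp add: f'_def)
  next
    fix n
    have "En n h = En n f'" using h(2) V_in_Vs by (intro energy_cong) force
    then show "En n h \<le> A * \<kappa> ^ n" using E by simp
  next
    fix x assume x: "x \<in> K"
    have "h x \<le> hi"
      by (rule bound_on_K[OF hc _ x]) (use lh in \<open>auto simp: h(2)[symmetric] f'_def\<close>)
    moreover have "- h x \<le> - lo"
      by (rule bound_on_K[OF _ _ x]) (use hc lh in \<open>auto simp: h(2)[symmetric] f'_def intro!: continuous_intros\<close>)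
    ultimately show "\<exists>p\<in>V 0. \<exists>q\<in>V 0. g p \<le> h x \<and> h x \<le> g q" using pq by force
  qed
qed

text \<open>
  The values at the vertices of a fine level \<open>n\<close> are kept and each cell is filled with a truncated extension.  The
  energies of levels above \<open>n\<close> add up over the cells.
\<close>

lemma finite_energy_dense:
  assumes ext: "\<And>g. \<exists>f A. (\<forall>p\<in>V 0. f p = g p) \<and> 0 \<le> A \<and> (\<forall>n. En n f \<le> A * \<kappa> ^ n)"
    and \<kappa>: "0 < \<kappa>" "\<kappa> < 1" and \<phi>: "continuous_on K \<phi>" and e: "0 < e"
  obtains h A where "continuous_on K h" "0 \<le> A" "\<And>n. En n h \<le> A * \<kappa> ^ n" "\<And>x. x \<in> K \<Longrightarrow> \<bar>\<phi> x - h x\<bar> < e"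
proof -
  have "uniformly_continuous_on K \<phi>" by (rule compact_uniformly_continuous[OF \<phi> compact_K])
  then obtain d where d: "0 < d" "\<And>x y. x \<in> K \<Longrightarrow> y \<in> K \<Longrightarrow> dist y x < d \<Longrightarrow> dist (\<phi> y) (\<phi> x) < e"
    unfolding uniformly_continuous_on_def using e by metis
  obtain n where n: "\<rho> ^ n * diameter K < d" using rho_pow_small[OF d(1)] by blast
  have near: "\<bar>\<phi> (Fw w x) - \<phi> (Fw w y)\<bar> < e" if "w \<in> W n" "x \<in> K" "y \<in> K" for w x y
  proof -
    have "dist (Fw w x) (Fw w y) \<le> \<rho> ^ n * diameter K"
      using rho diameter_bounded_bound[OF compact_imp_bounded[OF compact_K], of x y] that
      by (auto simp: dist_Fw words_def mult_left_mono)
    then show ?thesis using d(2)[of "Fw w y" "Fw w x"] n that words_in_K by (simp add: dist_real_def)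
  qed
  have "\<exists>h A. continuous_on K h \<and> (\<forall>p\<in>V 0. h p = \<phi> (Fw w p)) \<and> 0 \<le> A \<and> (\<forall>m. En m h \<le> A * \<kappa> ^ m) \<and>
     (\<forall>x\<in>K. \<exists>p\<in>V 0. \<exists>q\<in>V 0. \<phi> (Fw w p) \<le> h x \<and> h x \<le> \<phi> (Fw w q))" for w
  proof -
    obtain f A where f: "\<And>p. p \<in> V 0 \<Longrightarrow> f p = \<phi> (Fw w p)" "0 \<le> A" "\<And>n. En n f \<le> A * \<kappa> ^ n"
      using ext[of "\<lambda>p. \<phi> (Fw w p)"] by blast
    obtain h where "continuous_on K h" "\<And>p. p \<in> V 0 \<Longrightarrow> h p = \<phi> (Fw w p)" "\<And>n. En n h \<le> A * \<kappa> ^ n"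
      "\<And>x. x \<in> K \<Longrightarrow> \<exists>p\<in>V 0. \<exists>q\<in>V 0. \<phi> (Fw w p) \<le> h x \<and> h x \<le> \<phi> (Fw w q)"
      by (rule continuous_markov_extension[where g = "\<lambda>p. \<phi> (Fw w p)", OF f(1) f(3) f(2) \<kappa>]) (assumption, rule that)
    then show ?thesis using f(2) by blast
  qed
  then obtain h A where h: "\<And>w. continuous_on K (h w)" "\<And>w p. p \<in> V 0 \<Longrightarrow> h w p = \<phi> (Fw w p)"
    "\<And>w. 0 \<le> A w" "\<And>w m. En m (h w) \<le> A w * \<kappa> ^ m"
    "\<And>w x. x \<in> K \<Longrightarrow> \<exists>p\<in>V 0. \<exists>q\<in>V 0. \<phi> (Fw w p) \<le> h w x \<and> h w x \<le> \<phi> (Fw w q)"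
    by metis
  have agree: "h w p = h w' p'" if "p \<in> V 0" "p' \<in> V 0" "Fw w p = Fw w' p'" for w w' p p'
    using that by (simp add: h(2))
  obtain g where g: "\<And>w x. w \<in> W n \<Longrightarrow> x \<in> K \<Longrightarrow> g (Fw w x) = h w x"
    by (rule glue_on_cells[of n h, OF agree]) (assumption | rule that)+
  have gc: "continuous_on K g"
  proof -
    have "continuous_on (\<Union>w\<in>W n. Fw w ` K) g"
    proof (rule continuous_on_closed_Union[OF finite_words])
      fix w assume w: "w \<in> W n"
      show "closed (Fw w ` K)"
        by (intro compact_imp_closed compact_continuous_image continuous_Fw compact_K)
      define iv where "iv y = (1 / \<rho> ^ n) *\<^sub>R (y - Fw w 0)" for y
      have iv: "iv (Fw w x) = x" for x
        using rho w unfolding iv_def Fw_diff by (simp add: words_def)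
      have "continuous_on (Fw w ` K) (\<lambda>y. h w (iv y))"
      proof (rule continuous_on_compose2[OF h(1)])
        show "continuous_on (Fw w ` K) iv" unfolding iv_def by (intro continuous_intros)
        show "iv ` Fw w ` K \<subseteq> K" using iv by auto
      qed
      moreover have "g y = h w (iv y)" if "y \<in> Fw w ` K" for y using that g[OF w] iv by auto
      ultimately show "continuous_on (Fw w ` K) g" by (simp cong: continuous_on_cong)
    qed
    moreover have "(\<Union>w\<in>W n. Fw w ` K) = K"
    proof
      show "(\<Union>w\<in>W n. Fw w ` K) \<subseteq> K" using words_in_K by blast
      show "K \<subseteq> (\<Union>w\<in>W n. Fw w ` K)" using K_word_cover by fast
    qed
    ultimately show ?thesis by simp
  qed
  have En_g: "En k g \<le> ((\<Sum>w\<in>W n. A w) / \<kappa> ^ n) * \<kappa> ^ k" if k: "n \<le> k" for k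
  proof -
    obtain m where m: "k = n + m" using k le_Suc_ex by blast
    have "En k g = (\<Sum>w\<in>W n. En m (h w))"
      unfolding m energy_add by (intro sum.cong refl energy_cong) (use V_K g in force)
    also have "\<dots> \<le> (\<Sum>w\<in>W n. A w * \<kappa> ^ m)" by (intro sum_mono h(4))
    also have "\<dots> = ((\<Sum>w\<in>W n. A w) / \<kappa> ^ n) * \<kappa> ^ k"
      using \<kappa> unfolding m power_add sum_distrib_right[symmetric] by simp
    finally show ?thesis .
  qed
  have A0: "0 \<le> (\<Sum>w\<in>W n. A w) / \<kappa> ^ n" using h(3) \<kappa> by (intro divide_nonneg_pos sum_nonneg) auto
  obtain A' where A': "0 \<le> A'" "\<And>k. En k g \<le> A' * \<kappa> ^ k"
    using geometric_bound_from[where a = "\<lambda>k. En k g", OF \<kappa>(1) A0 En_g] by metis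
  have "\<bar>\<phi> x - g x\<bar> < e" if x: "x \<in> K" for x
  proof -
    obtain w y where w: "w \<in> W n" "y \<in> K" "x = Fw w y" using K_word_cover[OF x] by blast
    obtain p q where pq: "p \<in> V 0" "q \<in> V 0" "\<phi> (Fw w p) \<le> h w y" "h w y \<le> \<phi> (Fw w q)"
      using h(5)[OF w(2), of w] by blast
    have "\<bar>\<phi> (Fw w y) - \<phi> (Fw w p)\<bar> < e" "\<bar>\<phi> (Fw w y) - \<phi> (Fw w q)\<bar> < e"
      using near[OF w(1,2)] pq V0_K by auto
    then show ?thesis using pq g[OF w(1,2)] unfolding w(3) by linarith
  qed
  then show ?thesis using that gc A' by blast
qed

end

section \<open>Compatible relations\<close>

lemma equiv_Inter:
  assumes "\<S> \<noteq> {}" "\<And>S. S \<in> \<S> \<Longrightarrow> equiv A S"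
  shows "equiv A (\<Inter>\<S>)"
proof (rule equivI)
  show "\<Inter>\<S> \<subseteq> A \<times> A" using assms by (auto elim!: equivE)
  show "refl_on A (\<Inter>\<S>)" using assms(2) by (auto simp: refl_on_def equiv_def)
  show "sym (\<Inter>\<S>)"
    using assms(2) by (intro symI) (auto simp: equiv_def dest: symD)
  show "trans (\<Inter>\<S>)"
  proof (rule transI)
    fix x y z assume xy: "(x, y) \<in> \<Inter>\<S>" "(y, z) \<in> \<Inter>\<S>"
    show "(x, z) \<in> \<Inter>\<S>"
    proof
      fix S assume S: "S \<in> \<S>"
      then have "trans S" using assms(2) by (simp add: equiv_def)
      then show "(x, z) \<in> S" using xy S by (auto elim: transD)
    qed
  qed
qed

locale homogeneous_pcf_relation = homogeneous_pcf +
  fixes E :: "('a \<times> 'a) set"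
  assumes equiv_E: "equiv (vertices N F K 0) E"
    and compatible: "compatible N F K E"
    and property_B: "property_B N F K E"
begin

abbreviation "L \<equiv> level_rel N F K E"
abbreviation "Ls \<equiv> limit_rel N F K E"

lemma E_V0: "(a, a') \<in> E \<Longrightarrow> a \<in> V 0 \<and> a' \<in> V 0"
  using equiv_E by (auto elim!: equivE)

lemma L_equiv: "equiv (V n) (L n)"
proof (induction n)
  case 0
  then show ?case using equiv_E by simp
next
  case (Suc n)
  show ?case unfolding level_rel.simps(2)
  proof (rule equiv_Inter)
    let ?S = "V (Suc n) \<times> V (Suc n)"
    have "L n \<subseteq> V n \<times> V n" using Suc by (auto elim!: equivE)
    then have "L n \<subseteq> ?S" "\<forall>i\<in>{1..N}. \<forall>(x, y)\<in>L n. (F i x, F i y) \<in> ?S"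
      using V_Suc[of n] by (auto simp: vertices.simps(2)[of N F K n])
    moreover have "equiv (V (Suc n)) ?S"
      by (rule equivI) (auto simp: refl_on_def sym_def trans_def)
    ultimately show "{S. equiv (V (Suc n)) S \<and> L n \<subseteq> S \<and> (\<forall>i\<in>{1..N}. \<forall>(x, y)\<in>L n. (F i x, F i y) \<in> S)} \<noteq> {}"
      by blast
  qed simp
qed

lemma L_V: "(x, y) \<in> L n \<Longrightarrow> x \<in> V n \<and> y \<in> V n"
  using L_equiv[of n] by (auto elim!: equivE)

lemma L_refl: "x \<in> V n \<Longrightarrow> (x, x) \<in> L n"
  using L_equiv[of n] by (auto elim!: equivE simp: refl_on_def)

lemma L_sym: "(x, y) \<in> L n \<Longrightarrow> (y, x) \<in> L n"
  using L_equiv[of n] by (auto elim!: equivE dest: symD)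

lemma L_trans: "(x, y) \<in> L n \<Longrightarrow> (y, z) \<in> L n \<Longrightarrow> (x, z) \<in> L n"
  using L_equiv[of n] by (auto elim!: equivE dest: transD)

lemma L_Suc: "L n \<subseteq> L (Suc n)"
  unfolding level_rel.simps(2) by blast

lemma L_F: "i \<in> {1..N} \<Longrightarrow> (x, y) \<in> L n \<Longrightarrow> (F i x, F i y) \<in> L (Suc n)"
  unfolding level_rel.simps(2) by blast

lemma L_mono: "m \<le> n \<Longrightarrow> L m \<subseteq> L n"
  by (rule lift_Suc_mono_le[of L, OF L_Suc])

lemma L_Fw: "w \<in> W m \<Longrightarrow> (x, y) \<in> L n \<Longrightarrow> (Fw w x, Fw w y) \<in> L (m + n)"
proof (induction m arbitrary: w)
  case 0
  then show ?case by (simp add: words_0)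
next
  case (Suc m)
  obtain i v where v: "w = i # v" "i \<in> {1..N}" "v \<in> W m" using Cons_word_cases[OF Suc.prems(1)] .
  show ?case using L_F[OF v(2) Suc.IH[OF v(3) Suc.prems(2)]] by (simp add: v(1))
qed

text \<open>
  The copies of \<open>E\<close> in the cells of levels up to \<open>n\<close>.  Arguments about the relation of level \<open>n\<close> become inductions
  along chains of such copies, which show where a chain leaves a cell.
\<close>

definition generators :: "nat \<Rightarrow> ('a \<times> 'a) set" where
  "generators n = {(Fw w a, Fw w a') | w a a'. set w \<subseteq> {1..N} \<and> length w \<le> n \<and> (a, a') \<in> E}"

lemma generators_L: "generators n \<subseteq> L n"
proof
  fix z assume "z \<in> generators n"
  then obtain w a a' where z: "z = (Fw w a, Fw w a')" "set w \<subseteq> {1..N}" "length w \<le> n" "(a, a') \<in> E"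
    unfolding generators_def by blast
  have "(Fw w a, Fw w a') \<in> L (length w + 0)" using z by (intro L_Fw) (auto simp: words_def)
  then show "z \<in> L n" using L_mono[OF z(3)] z(1) by auto
qed

lemma generators_mono: "generators n \<subseteq> generators (Suc n)"
  unfolding generators_def by fastforce

lemma generators_F:
  assumes "(x, y) \<in> (generators n)\<^sup>*" "i \<in> {1..N}"
  shows "(F i x, F i y) \<in> (generators (Suc n))\<^sup>*"
  using assms(1)
proof (induction rule: rtrancl_induct)
  case (step y z)
  obtain w a a' where w: "y = Fw w a" "z = Fw w a'" "set w \<subseteq> {1..N}" "length w \<le> n" "(a, a') \<in> E"
    using step(2) unfolding generators_def by blast
  have "(Fw (i # w) a, Fw (i # w) a') \<in> generators (Suc n)"
    unfolding generators_def using w(3-5) assms(2)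
    by (intro CollectI exI[of _ "i # w"] exI[of _ a] exI[of _ a']) auto
  then have "(F i y, F i z) \<in> generators (Suc n)" using w(1,2) by simp
  with step(3) show ?case by (rule rtrancl_into_rtrancl)
qed simp

text \<open>
  The equivalence relation generated on \<open>V (Suc n)\<close> by the copies of \<open>E\<close> satisfies the closure conditions that
  define the relation of that level as a smallest one.
\<close>

lemma L_generated: "L n \<subseteq> (generators n)\<^sup>*"
proof (induction n)
  case 0
  have "(a, a') \<in> generators 0" if "(a, a') \<in> E" for a a'
    unfolding generators_def using that by (intro CollectI exI[of _ "[]"] exI[of _ a] exI[of _ a']) auto
  then show ?case by auto
next
  case (Suc n)
  let ?S = "(generators (Suc n))\<^sup>* \<inter> (V (Suc n) \<times> V (Suc n))"
  have E_sym: "(a', a) \<in> E" if "(a, a') \<in> E" for a a'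
    using that equiv_E by (auto elim!: equivE dest: symD)
  have sym: "sym (generators (Suc n))"
  proof (rule symI)
    fix x y assume "(x, y) \<in> generators (Suc n)"
    then obtain w a a' where "x = Fw w a" "y = Fw w a'" "set w \<subseteq> {1..N}" "length w \<le> Suc n" "(a, a') \<in> E"
      unfolding generators_def by blast
    then show "(y, x) \<in> generators (Suc n)" unfolding generators_def using E_sym by blast
  qed
  have "equiv (V (Suc n)) ?S"
  proof (rule equivI)
    show "sym ?S" using sym_rtrancl[OF sym] by (auto simp: sym_def)
    show "trans ?S" using trans_rtrancl[of "generators (Suc n)"] by (auto simp: trans_def)
  qed (auto simp: refl_on_def)
  moreover have "L n \<subseteq> ?S"
    using Suc rtrancl_mono[OF generators_mono[of n]] L_V[of _ _ n] V_Suc[of n] by auto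
  moreover have "(F i x, F i y) \<in> ?S" if "i \<in> {1..N}" "(x, y) \<in> L n" for i x y
    using generators_F[of x y n i] that Suc L_V[OF L_F[OF that]] by auto
  ultimately have "L (Suc n) \<subseteq> ?S" unfolding level_rel.simps(2) by (intro Inter_lower) auto
  then show ?case by blast
qed

lemma Ls_iff: "(x, y) \<in> Ls \<longleftrightarrow> (\<exists>n. (x, y) \<in> L n)"
  unfolding limit_rel_def using L_V by auto

lemma Ls_Vs: "(x, y) \<in> Ls \<Longrightarrow> x \<in> Vs \<and> y \<in> Vs"
  unfolding Ls_iff using L_V V_in_Vs by blast

lemma Ls_refl: "x \<in> Vs \<Longrightarrow> (x, x) \<in> Ls"
  unfolding Ls_iff all_vertices_def using L_refl by blast

lemma Ls_sym: "(x, y) \<in> Ls \<Longrightarrow> (y, x) \<in> Ls"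
  unfolding Ls_iff using L_sym by blast

lemma Ls_trans:
  assumes "(x, y) \<in> Ls" "(y, z) \<in> Ls" shows "(x, z) \<in> Ls"
proof -
  obtain n m where nm: "(x, y) \<in> L n" "(y, z) \<in> L m" using assms unfolding Ls_iff by blast
  then have "(x, y) \<in> L (max n m)" "(y, z) \<in> L (max n m)"
    using L_mono[of n "max n m"] L_mono[of m "max n m"] by auto
  then show ?thesis unfolding Ls_iff using L_trans by blast
qed

lemma Ls_equiv: "equiv Vs Ls"
proof (rule equivI)
  show "Ls \<subseteq> Vs \<times> Vs" using Ls_Vs by auto
  show "refl_on Vs Ls" using Ls_refl by (auto simp: refl_on_def)
  show "sym Ls" using Ls_sym by (auto simp: sym_def)
  show "trans Ls" using Ls_trans by (auto simp: trans_def)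
qed

lemma Ls_Fw: "w \<in> W n \<Longrightarrow> (x, y) \<in> Ls \<Longrightarrow> (Fw w x, Fw w y) \<in> Ls"
  unfolding Ls_iff using L_Fw by blast

lemma Ls_E: "(a, a') \<in> E \<Longrightarrow> (a, a') \<in> Ls"
  unfolding Ls_iff by (intro exI[of _ 0]) simp

lemma Ls_compatible:
  assumes "(x, y) \<in> Ls" "x \<in> V n" "y \<in> V n"
  shows "(x, y) \<in> L n"
proof -
  obtain m where m: "(x, y) \<in> L m" using assms(1) unfolding Ls_iff by blast
  have "(x, y) \<in> L n" if "(x, y) \<in> L (n + k)" for k
    using that
  proof (induction k)
    case (Suc k)
    have "x \<in> V (n + k)" "y \<in> V (n + k)" using assms(2,3) V_mono[of n "n + k"] by auto
    then show ?case using Suc compatible unfolding compatible_def by simp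
  qed simp
  moreover have "(x, y) \<in> L (n + m)" using m L_mono[of m "n + m"] by auto
  ultimately show ?thesis by blast
qed

text \<open>
  Follow the chain that joins \<open>F i x\<close> to a point of \<open>V 0\<close>.  As long as it uses copies of \<open>E\<close> inside the cell \<open>i\<close> it
  can be pulled back by \<open>F i\<close>.  A step through any other copy starts at a point that the cell shares with another
  cell or with \<open>V 0\<close>, and this is the image under \<open>F i\<close> of a point of \<open>V 0\<close>.
\<close>

lemma exit_letter:
  assumes "i \<in> {1..N}" "x \<in> Vs" "(F i x, p) \<in> Ls" "p \<in> V 0"
  shows "\<exists>q\<in>V 0. (x, q) \<in> Ls"
proof -
  obtain n where "(F i x, p) \<in> L n" using assms(3) unfolding Ls_iff by blast
  then have "(F i x, p) \<in> (generators n)\<^sup>*" using L_generated by blast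
  then have "\<forall>x\<in>Vs. F i x = z \<longrightarrow> (\<exists>q\<in>V 0. (x, q) \<in> Ls)" if "z = F i x" for z
    unfolding that
  proof (induction rule: converse_rtrancl_induct)
    case base
    show ?case
    proof (intro ballI impI)
      fix x assume x: "x \<in> Vs" "F i x = p"
      then have "x \<in> V 0" using V0_pullback[of "[i]" x] assms(1,4) Vs_K by auto
      then show "\<exists>q\<in>V 0. (x, q) \<in> Ls" using Ls_refl[OF x(1)] by blast
    qed
  next
    case (step z z')
    show ?case
    proof (intro ballI impI)
      fix x assume x: "x \<in> Vs" "F i x = z"
      obtain v a a' where v: "z = Fw v a" "z' = Fw v a'" "set v \<subseteq> {1..N}" "(a, a') \<in> E"
        using step(1) unfolding generators_def by blast
      have ab: "a \<in> V 0" "a' \<in> V 0" using E_V0[OF v(4)] by auto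
      have xK: "x \<in> K" using x(1) Vs_K by blast
      have V0: "\<exists>q\<in>V 0. (x, q) \<in> Ls" if "x \<in> V 0" using that Ls_refl[OF x(1)] by blast
      show "\<exists>q\<in>V 0. (x, q) \<in> Ls"
      proof (cases v)
        case Nil
        then have "F i x \<in> V 0" using x v ab by simp
        then have "x \<in> V 0" using V0_pullback[of "[i]" x] assms(1) xK by auto
        then show ?thesis by (rule V0)
      next
        case (Cons j v')
        have j: "j \<in> {1..N}" "v' \<in> W (length v')" using v(3) Cons by (auto simp: words_def)
        show ?thesis
        proof (cases "j = i")
          case True
          have "x = Fw v' a" using x v(1) Cons True by (simp add: F_inj)
          then have "(x, Fw v' a') \<in> Ls" using Ls_Fw[OF j(2) Ls_E[OF v(4)]] by simp
          moreover obtain q where "q \<in> V 0" "(Fw v' a', q) \<in> Ls"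
            using step(3) Ls_Vs[OF calculation] v(2) Cons True by auto
          ultimately show ?thesis using Ls_trans by blast
        next
          case False
          have "Fw v' a \<in> K" using words_in_K[OF j(2)] ab V0_K by blast
          moreover have "F i x = F j (Fw v' a)" using x(2) v(1) Cons by simp
          ultimately have "x \<in> V 0" using junction_V0[OF assms(1) j(1) _ xK] False by metis
          then show ?thesis by (rule V0)
        qed
      qed
    qed
  qed
  then show ?thesis using assms(2) by blast
qed

text \<open>
  The union of the boundary classes of the limit relation.
\<close>

definition boundary_points :: "'a set" where
  "boundary_points = {x. \<exists>p\<in>V 0. (x, p) \<in> Ls}"

lemma boundary_points_saturated: "(x, y) \<in> Ls \<Longrightarrow> x \<in> boundary_points \<longleftrightarrow> y \<in> boundary_points"
  unfolding boundary_points_def using Ls_sym Ls_trans by blast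

lemma V0_boundary_points: "V 0 \<subseteq> boundary_points"
  unfolding boundary_points_def using Ls_refl V_in_Vs by blast

text \<open>
  A boundary class that meets a cell contains a vertex of that cell, and it even joins each of its points in the cell
  to such a vertex by a relation of the limit inside the cell.
\<close>

lemma exit_word:
  assumes "w \<in> W n" "x \<in> Vs" "Fw w x \<in> boundary_points"
  obtains q where "q \<in> V 0" "(x, q) \<in> Ls" "Fw w q \<in> boundary_points"
proof -
  have "\<exists>q\<in>V 0. (x, q) \<in> Ls" using assms(1,3)
  proof (induction n arbitrary: w)
    case 0
    then show ?case by (simp add: words_0 boundary_points_def)
  next
    case (Suc n)
    obtain i v where v: "w = i # v" "i \<in> {1..N}" "v \<in> W n" using Cons_word_cases[OF Suc.prems(1)] .
    obtain p where "p \<in> V 0" "(F i (Fw v x), p) \<in> Ls"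
      using Suc.prems(2) v(1) unfolding boundary_points_def by auto
    then have "Fw v x \<in> boundary_points"
      unfolding boundary_points_def using exit_letter[OF v(2) Fw_Vs[OF v(3) assms(2)]] by blast
    then show ?case by (rule Suc.IH[OF v(3)])
  qed
  then obtain q where q: "q \<in> V 0" "(x, q) \<in> Ls" by blast
  then have "Fw w q \<in> boundary_points"
    using Ls_Fw[OF assms(1) q(2)] boundary_points_saturated assms(3) by blast
  with q show ?thesis using that by blast
qed

lemma letter_single_class:
  assumes "i \<in> {1..N}" "p \<in> V 0" "q \<in> V 0" "F i p \<in> boundary_points" "F i q \<in> boundary_points"
  shows "(F i p, F i q) \<in> Ls"
proof -
  have V1: "F i p \<in> V (Suc 0)" "F i q \<in> V (Suc 0)"
    using assms(1-3) by (auto simp: vertices.simps(2)[of N F K 0])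
  have bc: "boundary_class N F K (L (Suc 0) `` {F i r})" if r: "r \<in> V 0" "F i r \<in> boundary_points" for r
  proof -
    obtain p' where p': "p' \<in> V 0" "(F i r, p') \<in> Ls" using r(2) unfolding boundary_points_def by blast
    have "F i r \<in> V (Suc 0)" using assms(1) r(1) by (auto simp: vertices.simps(2)[of N F K 0])
    then have "(F i r, p') \<in> L (Suc 0)" using Ls_compatible[OF p'(2)] p'(1) V0_V1 by blast
    then show ?thesis unfolding boundary_class_def using p'(1) by blast
  qed
  have w1: "[i] \<in> W 1" using assms(1) by (auto simp: words_def)
  have c: "F i r \<in> cell N F K [i]" if "r \<in> V 0" for r using that by (simp add: cell_def)
  have J: "L (Suc 0) `` {F i p} \<in> V 1 // L 1" "L (Suc 0) `` {F i q} \<in> V 1 // L 1"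
    using V1 by (auto intro: quotientI simp del: level_rel.simps)
  have "L (Suc 0) `` {F i p} = L (Suc 0) `` {F i q}"
  proof (rule property_B[unfolded property_B_def, rule_format, OF w1 J])
    show "boundary_class N F K (L (Suc 0) `` {F i p})" "boundary_class N F K (L (Suc 0) `` {F i q})"
      using bc assms by auto
    show "cell N F K [i] \<inter> L (Suc 0) `` {F i p} \<noteq> {}" using c[OF assms(2)] L_refl[OF V1(1)] by blast
    show "cell N F K [i] \<inter> L (Suc 0) `` {F i q} \<noteq> {}" using c[OF assms(3)] L_refl[OF V1(2)] by blast
  qed
  then have "(F i p, F i q) \<in> L (Suc 0)" using L_refl[OF V1(2)] by blast
  then show ?thesis unfolding Ls_iff by blast
qed

text \<open>
  Property (B) for cells of every positive level.  Each of the two points is related to a vertex of the cell of level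
  1 around it, by \<open>exit_word\<close>, and property (B) identifies these two vertices.
\<close>

lemma word_single_class:
  assumes "w \<in> W (Suc n)" "p \<in> V 0" "q \<in> V 0" "Fw w p \<in> boundary_points" "Fw w q \<in> boundary_points"
  shows "(Fw w p, Fw w q) \<in> Ls"
proof -
  obtain i v where v: "w = i # v" "i \<in> {1..N}" "v \<in> W n" using Cons_word_cases[OF assms(1)] .
  have i1: "[i] \<in> W 1" using v(2) by (auto simp: words_def)
  have ex: "\<exists>r'\<in>V 0. (Fw w r, F i r') \<in> Ls \<and> F i r' \<in> boundary_points"
    if r: "r \<in> V 0" "Fw w r \<in> boundary_points" for r
  proof -
    have "Fw v r \<in> Vs" using Fw_Vs[OF v(3)] r(1) V_in_Vs by blast
    moreover have "Fw [i] (Fw v r) \<in> boundary_points" using r(2) v(1) by simp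
    ultimately obtain r' where "r' \<in> V 0" "(Fw v r, r') \<in> Ls" "Fw [i] r' \<in> boundary_points"
      by (rule exit_word[OF i1])
    then show ?thesis using Ls_Fw[OF i1, of "Fw v r" r'] v(1) by auto
  qed
  obtain p' where p': "p' \<in> V 0" "(Fw w p, F i p') \<in> Ls" "F i p' \<in> boundary_points"
    using ex[OF assms(2,4)] by blast
  obtain q' where q': "q' \<in> V 0" "(Fw w q, F i q') \<in> Ls" "F i q' \<in> boundary_points"
    using ex[OF assms(3,5)] by blast
  have "(F i p', F i q') \<in> Ls" by (rule letter_single_class[OF v(2) p'(1) q'(1) p'(3) q'(3)])
  then show ?thesis using p'(2) q'(2) Ls_trans Ls_sym by blast
qed

definition relation_energy :: "('a \<Rightarrow> real) \<Rightarrow> real" where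
  "relation_energy g = (\<Sum>i=1..N. \<Sum>(a, a')\<in>E. (g (F i a) - g (F i a'))\<^sup>2)"

lemma finite_E: "finite E"
  by (rule finite_subset[of _ "V 0 \<times> V 0"]) (use E_V0 finite_V0 in auto)

lemma relation_energy_nonneg: "0 \<le> relation_energy g"
  unfolding relation_energy_def by (intro sum_nonneg) auto

text \<open>
  A vertex of level 1 in a boundary class is joined to \<open>V 0\<close> by a chain of copies of \<open>E\<close>.  The chain is cut at its
  first point in \<open>V 0\<close>, so that it only uses copies in cells of level 1; a copy at level 0 could join
  points that no cell of level 1 contains together.
\<close>

lemma relation_chain:
  obtains C where "0 \<le> C" "\<And>x p. (x, p) \<in> L (Suc 0) \<Longrightarrow> p \<in> V 0 \<Longrightarrow>
     \<exists>q\<in>V 0. (x, q) \<in> Ls \<and> (\<forall>g. (g x - g q)\<^sup>2 \<le> C * relation_energy g)"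
proof -
  have "\<exists>C\<ge>0. \<exists>q\<in>V 0. (x, q) \<in> Ls \<and> (\<forall>g. (g x - g q)\<^sup>2 \<le> C * relation_energy g)"
    if "(x, p) \<in> L (Suc 0)" "p \<in> V 0" for x p
  proof -
    have "(x, p) \<in> (generators (Suc 0))\<^sup>*" using L_generated that(1) by blast
    then show ?thesis
    proof (induction rule: converse_rtrancl_induct)
      case base
      have "(p, p) \<in> Ls" using that(2) Ls_refl V_in_Vs by blast
      then show ?case using that(2) by (intro exI[of _ 0] conjI bexI[of _ p]) auto
    next
      case (step z z')
      obtain v a a' where v: "z = Fw v a" "z' = Fw v a'" "set v \<subseteq> {1..N}" "length v \<le> Suc 0" "(a, a') \<in> E"
        using step(1) unfolding generators_def by blast
      show ?case
      proof (cases v)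
        case Nil
        then have "z \<in> V 0" using v(1) E_V0[OF v(5)] by simp
        moreover from this have "(z, z) \<in> Ls" using Ls_refl V_in_Vs by blast
        ultimately show ?thesis by (intro exI[of _ 0] conjI bexI[of _ z]) auto
      next
        case (Cons i v')
        then have i: "v = [i]" "i \<in> {1..N}" using v(3,4) by auto
        have zz: "(g z - g z')\<^sup>2 \<le> relation_energy g" for g
        proof -
          have "(g z - g z')\<^sup>2 \<le> (\<Sum>(a, a')\<in>E. (g (F i a) - g (F i a'))\<^sup>2)"
            using member_le_sum[OF v(5) _ finite_E, of "\<lambda>(a, a'). (g (F i a) - g (F i a'))\<^sup>2"] v(1,2) i
            by auto
          also have "\<dots> \<le> relation_energy g"
            unfolding relation_energy_def using i(2)
            by (intro member_le_sum) (auto intro!: sum_nonneg)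
          finally show ?thesis .
        qed
        obtain C q where C: "0 \<le> C" "q \<in> V 0" "(z', q) \<in> Ls" "\<And>g. (g z' - g q)\<^sup>2 \<le> C * relation_energy g"
          using step(3) by blast
        have "(z, z') \<in> Ls" using step(1) generators_L unfolding Ls_iff by blast
        then have "(z, q) \<in> Ls" using C(3) Ls_trans by blast
        moreover have "(g z - g q)\<^sup>2 \<le> (2 + 2 * C) * relation_energy g" for g
        proof -
          have "(g z - g q)\<^sup>2 \<le> 2 * (g z - g z')\<^sup>2 + 2 * (g z' - g q)\<^sup>2"
            using zero_le_power2[of "(g z - g z') - (g z' - g q)"] by (simp add: power2_eq_square algebra_simps)
          then show ?thesis using zz[of g] C(4)[of g] by (simp add: algebra_simps)
        qed
        ultimately show ?thesis using C(1,2) by (intro exI[of _ "2 + 2 * C"] conjI bexI[of _ q]) auto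
      qed
    qed
  qed
  then have "\<forall>x\<in>V (Suc 0). \<exists>C. 0 \<le> C \<and> (\<forall>p\<in>V 0. (x, p) \<in> L (Suc 0) \<longrightarrow>
     (\<exists>q\<in>V 0. (x, q) \<in> Ls \<and> (\<forall>g. (g x - g q)\<^sup>2 \<le> C * relation_energy g)))"
    by (smt (verit, best))
  then obtain C where C: "\<And>x. x \<in> V (Suc 0) \<Longrightarrow> 0 \<le> C x" "\<And>x p. x \<in> V (Suc 0) \<Longrightarrow> p \<in> V 0 \<Longrightarrow>
     (x, p) \<in> L (Suc 0) \<Longrightarrow> \<exists>q\<in>V 0. (x, q) \<in> Ls \<and> (\<forall>g. (g x - g q)\<^sup>2 \<le> C x * relation_energy g)"
    by metis
  show ?thesis
  proof (rule that[of "\<Sum>x\<in>V (Suc 0). C x"])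
    show "0 \<le> (\<Sum>x\<in>V (Suc 0). C x)" using C(1) by (rule sum_nonneg)
    fix x p assume xp: "(x, p) \<in> L (Suc 0)" "p \<in> V 0"
    have x: "x \<in> V (Suc 0)" using L_V[OF xp(1)] by simp
    obtain q where q: "q \<in> V 0" "(x, q) \<in> Ls" "\<And>g. (g x - g q)\<^sup>2 \<le> C x * relation_energy g"
      using C(2)[OF x xp(2,1)] by blast
    have "C x \<le> (\<Sum>x\<in>V (Suc 0). C x)" using x C(1) finite_V by (intro member_le_sum) auto
    then have "C x * relation_energy g \<le> (\<Sum>x\<in>V (Suc 0). C x) * relation_energy g" for g
      by (intro mult_right_mono relation_energy_nonneg)
    then show "\<exists>q\<in>V 0. (x, q) \<in> Ls \<and> (\<forall>g. (g x - g q)\<^sup>2 \<le> (\<Sum>x\<in>V (Suc 0). C x) * relation_energy g)"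
      using q by (meson order_trans)
  qed
qed

end

section \<open>Extensions along classes\<close>

lemma growth_rate_lower:
  assumes g: "has_growth_rate r S" and t: "0 < t" "t < S"
  obtains M where "\<And>n. M \<le> n \<Longrightarrow> t ^ n \<le> r n"
proof -
  have S: "1 < S" using g by (simp add: has_growth_rate_def)
  define \<epsilon> where "\<epsilon> = 1 - ln t / ln S"
  have "ln t < ln S" using t by simp
  then have "0 < \<epsilon>" using S by (simp add: \<epsilon>_def)
  then obtain M where M: "\<And>n. M \<le> n \<Longrightarrow> S powr ((1 - \<epsilon>) * real n) \<le> r n"
    using g unfolding has_growth_rate_def by blast
  have "S powr ((1 - \<epsilon>) * real n) = t ^ n" for n
  proof -
    have "S powr (1 - \<epsilon>) = t" using S t by (simp add: \<epsilon>_def powr_def)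
    then show ?thesis using S t by (simp add: powr_powr[symmetric] powr_realpow)
  qed
  with M show ?thesis using that by metis
qed

lemma growth_rate_upper:
  assumes g: "has_growth_rate r S" and t: "S < t"
  obtains M where "\<And>n. M \<le> n \<Longrightarrow> r n \<le> t ^ n"
proof -
  have S: "1 < S" using g by (simp add: has_growth_rate_def)
  define \<epsilon> where "\<epsilon> = ln t / ln S - 1"
  have "ln S < ln t" using t S by simp
  then have "0 < \<epsilon>" using S by (simp add: \<epsilon>_def)
  then obtain M where M: "\<And>n. M \<le> n \<Longrightarrow> r n \<le> S powr ((1 + \<epsilon>) * real n)"
    using g unfolding has_growth_rate_def by blast
  have "S powr ((1 + \<epsilon>) * real n) = t ^ n" for n
  proof -
    have "S powr (1 + \<epsilon>) = t" using S t by (simp add: \<epsilon>_def powr_def)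
    then show ?thesis using S t by (simp add: powr_powr[symmetric] powr_realpow)
  qed
  with M show ?thesis using that by metis
qed

lemma pair_energy_subset:
  assumes "A \<subseteq> A'" "finite A'"
  shows "pair_energy A u \<le> pair_energy A' u"
proof -
  have "(\<Sum>x\<in>A. \<Sum>y\<in>A. \<bar>u x - u y\<bar>\<^sup>2) \<le> (\<Sum>x\<in>A. \<Sum>y\<in>A'. \<bar>u x - u y\<bar>\<^sup>2)"
    using assms by (intro sum_mono sum_mono2) auto
  also have "\<dots> \<le> (\<Sum>x\<in>A'. \<Sum>y\<in>A'. \<bar>u x - u y\<bar>\<^sup>2)"
    using assms by (intro sum_mono2) (auto intro: sum_nonneg)
  finally show ?thesis unfolding pair_energy_def by simp
qed

context homogeneous_pcf_relation
begin

definition E_invariant :: "('a \<Rightarrow> real) \<Rightarrow> bool" where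
  "E_invariant g \<longleftrightarrow> (\<forall>(a, a')\<in>E. g a = g a')"

text \<open>
  The step extends an \<open>E\<close>-invariant function to level \<open>n0\<close>, and the result is again \<open>E\<close>-invariant in each cell of
  that level.  Hence the step can be repeated there, with the energy multiplied by \<open>\<theta>\<close> each time.
\<close>

lemma block_extension:
  assumes n0: "1 \<le> n0" and \<theta>: "0 \<le> \<theta>"
    and step: "\<And>g. E_invariant g \<Longrightarrow>
      \<exists>v. (\<forall>p\<in>V 0. v p = g p) \<and> (\<forall>(x, y)\<in>L n0. v x = v y) \<and> En n0 v \<le> \<theta> * En 0 g"
    and g: "E_invariant g"
  obtains T where "\<And>p. p \<in> V 0 \<Longrightarrow> T p = g p" "\<And>x y. (x, y) \<in> Ls \<Longrightarrow> T x = T y"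
    "\<And>k. En (k * n0) T \<le> \<theta> ^ k * En 0 g"
proof -
  let ?inv = "\<lambda>k f. (k = 0 \<longrightarrow> f = g) \<and> (\<forall>w\<in>W (k * n0). E_invariant (f \<circ> Fw w))"
  let ?next = "\<lambda>k f f'. (\<forall>w\<in>W (k * n0). \<forall>p\<in>V 0. f' (Fw w p) = f (Fw w p)) \<and>
     (\<forall>w\<in>W (k * n0). \<forall>m\<le>n0. \<forall>v\<in>W m. E_invariant (f' \<circ> Fw (w @ v))) \<and>
     En (Suc k * n0) f' \<le> \<theta> * En (k * n0) f"
  have "\<exists>f. \<forall>k. ?inv k (f k) \<and> ?next k (f k) (f (Suc k))"
  proof (rule dependent_nat_choice)
    show "\<exists>f. ?inv 0 f" using g by (intro exI[of _ g]) (simp add: words_0)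
    fix f k assume inv: "?inv k f"
    have "\<forall>w. \<exists>v. w \<in> W (k * n0) \<longrightarrow> (\<forall>p\<in>V 0. v p = f (Fw w p)) \<and> (\<forall>(x, y)\<in>L n0. v x = v y) \<and>
       En n0 v \<le> \<theta> * En 0 (f \<circ> Fw w)"
      using step inv by fastforce
    then obtain h where h: "\<And>w p. w \<in> W (k * n0) \<Longrightarrow> p \<in> V 0 \<Longrightarrow> h w p = f (Fw w p)"
      "\<And>w x y. w \<in> W (k * n0) \<Longrightarrow> (x, y) \<in> L n0 \<Longrightarrow> h w x = h w y"
      "\<And>w. w \<in> W (k * n0) \<Longrightarrow> En n0 (h w) \<le> \<theta> * En 0 (f \<circ> Fw w)"
      unfolding choice_iff by blast
    obtain f' where f': "\<And>w x. w \<in> W (k * n0) \<Longrightarrow> x \<in> K \<Longrightarrow> f' (Fw w x) = h w x"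
    proof (rule glue_on_cells[of "k * n0" h])
      show "h w p = h w' p'" if "w \<in> W (k * n0)" "w' \<in> W (k * n0)" "p \<in> V 0" "p' \<in> V 0" "Fw w p = Fw w' p'" for w w' p p'
        using that h(1) by simp
    qed (rule that)
    have ext: "f' (Fw w p) = f (Fw w p)" if "w \<in> W (k * n0)" "p \<in> V 0" for w p
      using that f' h(1) V0_K by (simp add: subset_iff)
    have invf': "E_invariant (f' \<circ> Fw (w @ v))" if "w \<in> W (k * n0)" "m \<le> n0" "v \<in> W m" for w m v
      unfolding E_invariant_def
    proof clarify
      fix a a' assume a: "(a, a') \<in> E"
      have "(Fw v a, Fw v a') \<in> L (m + 0)" using a by (intro L_Fw[OF that(3)]) simp
      then have "(Fw v a, Fw v a') \<in> L n0" using L_mono[OF that(2)] by auto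
      then have "h w (Fw v a) = h w (Fw v a')" by (rule h(2)[OF that(1)])
      moreover have "Fw v a \<in> K" "Fw v a' \<in> K" using words_in_K[OF that(3)] E_V0[OF a] V0_K by auto
      ultimately show "(f' \<circ> Fw (w @ v)) a = (f' \<circ> Fw (w @ v)) a'"
        using f'[OF that(1)] by (simp add: word_map_append)
    qed
    have "En (k * n0 + n0) f' \<le> \<theta> * En (k * n0) f"
    proof -
      have "En (k * n0 + n0) f' = (\<Sum>w\<in>W (k * n0). En n0 (h w))"
        unfolding energy_add by (intro sum.cong refl energy_cong) (use f' V_K in force)
      also have "\<dots> \<le> (\<Sum>w\<in>W (k * n0). \<theta> * En 0 (f \<circ> Fw w))" by (intro sum_mono h(3))
      also have "\<dots> = \<theta> * En (k * n0 + 0) f" unfolding energy_add sum_distrib_left ..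
      finally show ?thesis by simp
    qed
    moreover have "E_invariant (f' \<circ> Fw w)" if w: "w \<in> W (Suc k * n0)" for w
    proof -
      have "w \<in> W (k * n0 + n0)" using w by (simp add: add.commute)
      then obtain w1 w2 where "w1 \<in> W (k * n0)" "w2 \<in> W n0" "w = w1 @ w2" unfolding words_add by auto
      then show ?thesis using invf' by blast
    qed
    ultimately show "\<exists>f'. ?inv (Suc k) f' \<and> ?next k f f'"
      using ext invf' by (intro exI[of _ f']) (auto simp: add.commute)
  qed
  then obtain f where ff: "\<forall>k. ?inv k (f k) \<and> ?next k (f k) (f (Suc k))" by (rule exE)
  have f: "?inv k (f k)" "?next k (f k) (f (Suc k))" for k
    by (rule conjunct1[OF spec[OF ff]], rule conjunct2[OF spec[OF ff]])
  have f0: "f 0 = g" using f(1)[of 0] by simp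
  have stable: "f (k + j) x = f k x" if x: "x \<in> V (k * n0)" for k j x
  proof (induction j)
    case (Suc j)
    have "x \<in> V ((k + j) * n0)" using x V_mono[of "k * n0" "(k + j) * n0"] by auto
    then obtain w p where "w \<in> W ((k + j) * n0)" "p \<in> V 0" "x = Fw w p" using V_eq[of "(k + j) * n0"] by blast
    then have "f (Suc (k + j)) x = f (k + j) x" using f(2)[of "k + j"] by simp
    then show ?case using Suc by simp
  qed simp
  define T where "T x = f (LEAST k. x \<in> V (k * n0)) x" for x
  have T: "T x = f k x" if "x \<in> V (k * n0)" for k x
  proof -
    let ?l = "LEAST k. x \<in> V (k * n0)"
    have "x \<in> V (?l * n0)" by (rule LeastI[of "\<lambda>k. x \<in> V (k * n0)", OF that])
    moreover have "?l \<le> k" by (rule Least_le[of "\<lambda>k. x \<in> V (k * n0)", OF that])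
    ultimately show ?thesis unfolding T_def using stable[of x ?l "k - ?l"] by simp
  qed
  show ?thesis
  proof (rule that[of T])
    show "T p = g p" if "p \<in> V 0" for p using T[of p 0] that f0 by simp
    have gen: "T x = T y" if xy: "(x, y) \<in> generators n" for x y n
    proof -
      obtain w a a' where w: "x = Fw w a" "y = Fw w a'" "set w \<subseteq> {1..N}" "(a, a') \<in> E"
        using xy unfolding generators_def by blast
      define k where "k = length w div n0"
      have len: "k * n0 + length w mod n0 = length w" by (simp add: k_def)
      have mod: "length w mod n0 \<le> n0" using n0 by (simp add: less_imp_le)
      have "w \<in> W (k * n0 + length w mod n0)" using w(3) len by (simp add: words_def)
      then obtain w1 w2 where w12: "w1 \<in> W (k * n0)" "w2 \<in> W (length w mod n0)" "w = w1 @ w2"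
        unfolding words_add by auto
      have "E_invariant (f (Suc k) \<circ> Fw w)"
        using f(2)[of k] w12 mod by blast
      then have fk: "f (Suc k) x = f (Suc k) y" using w by (auto simp: E_invariant_def)
      have "V (length w) \<subseteq> V (Suc k * n0)" using len mod by (intro V_mono) simp
      moreover have "x \<in> V (length w)" "y \<in> V (length w)"
        using Fw_V[of w "length w" _ 0] w E_V0[OF w(4)] by (auto simp: words_def)
      ultimately have "x \<in> V (Suc k * n0)" "y \<in> V (Suc k * n0)" by auto
      then show ?thesis using T[of x "Suc k"] T[of y "Suc k"] fk by simp
    qed
    show "T x = T y" if xy: "(x, y) \<in> Ls" for x y
    proof -
      obtain n where "(x, y) \<in> L n" using xy unfolding Ls_iff by blast
      then have "(x, y) \<in> (generators n)\<^sup>*" using L_generated by blast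
      then show ?thesis by (induction rule: rtrancl_induct) (auto dest: gen)
    qed
    show "En (k * n0) T \<le> \<theta> ^ k * En 0 g" for k
    proof -
      have "En (k * n0) T = En (k * n0) (f k)" using T by (intro energy_cong) simp
      also have "\<dots> \<le> \<theta> ^ k * En 0 g"
      proof (induction k)
        case 0
        then show ?case by (simp add: f0)
      next
        case (Suc k)
        have "En (Suc k * n0) (f (Suc k)) \<le> \<theta> * En (k * n0) (f k)" using f(2)[of k] by blast
        also have "\<dots> \<le> \<theta> * (\<theta> ^ k * En 0 g)" using Suc \<theta> by (intro mult_left_mono)
        finally show ?case by (simp add: mult.assoc)
      qed
      finally show ?thesis .
    qed
  qed
qed

lemma finite_classes: "finite (V 0 // E)"
  using finite_quotient[OF finite_V0] equiv_E by (auto elim: equivE)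

text \<open>
  The minimiser in the quotient trace.  Choosing one point \<open>r J\<close> in each class \<open>J\<close> turns the quotient form into a part of
  the energy of \<open>g\<close> on \<open>V 0\<close>, so the energy is multiplied by at most the largest conductance.
\<close>

lemma quotient_trace_step:
  assumes qt: "is_quotient_trace N F K E n R"
    and R: "\<And>I J. I \<in> V 0 // E \<Longrightarrow> J \<in> V 0 // E \<Longrightarrow> I \<noteq> J \<Longrightarrow> 1 / R I J \<le> \<theta>"
    and \<theta>: "0 \<le> \<theta>" and g: "E_invariant g"
  shows "\<exists>v. (\<forall>p\<in>V 0. v p = g p) \<and> (\<forall>(x, y)\<in>L n. v x = v y) \<and> En n v \<le> \<theta> * En 0 g"
proof -
  define r where "r J = (SOME x. x \<in> J)" for J :: "'a set"
  have r: "r J \<in> J" if "J \<in> V 0 // E" for J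
    using in_quotient_imp_non_empty[OF equiv_E that] unfolding r_def by (simp add: some_in_eq)
  have rV: "r ` (V 0 // E) \<subseteq> V 0" using r in_quotient_imp_subset[OF equiv_E] by blast
  have inj: "inj_on r (V 0 // E)"
  proof (rule inj_onI)
    fix I J assume IJ: "I \<in> V 0 // E" "J \<in> V 0 // E" "r I = r J"
    then show "I = J" using r[OF IJ(1)] r[OF IJ(2)] quotient_disj[OF equiv_E IJ(1,2)] by auto
  qed
  let ?nf = "network_form (V 0 // E) R (g \<circ> r)"
  have "is_minimum ?nf {energy N F K n v | v. v respects L n \<and> (\<forall>J\<in>V 0 // E. \<forall>x\<in>J. v x = (g \<circ> r) J)}"
    using qt unfolding is_quotient_trace_def by blast
  then have "?nf \<in> {energy N F K n v | v. v respects L n \<and> (\<forall>J\<in>V 0 // E. \<forall>x\<in>J. v x = (g \<circ> r) J)}"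
    by (simp only: is_minimum_def)
  then obtain v where v: "?nf = En n v" "v respects L n" "\<And>J x. J \<in> V 0 // E \<Longrightarrow> x \<in> J \<Longrightarrow> v x = g (r J)"
    by auto
  have "v p = g p" if p: "p \<in> V 0" for p
  proof -
    have J: "E `` {p} \<in> V 0 // E" "p \<in> E `` {p}"
      using p quotientI equiv_class_self[OF equiv_E p] by auto
    then have "v p = g (r (E `` {p}))" by (rule v(3))
    moreover have "(p, r (E `` {p})) \<in> E" using r[OF J(1)] by blast
    ultimately show ?thesis using g unfolding E_invariant_def by fastforce
  qed
  moreover have "v x = v y" if "(x, y) \<in> L n" for x y using v(2) that by (auto simp: congruent_def)
  moreover have "En n v \<le> \<theta> * En 0 g"
  proof -
    have "En n v \<le> \<theta> * pair_energy (V 0 // E) (g \<circ> r)"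
      unfolding v(1)[symmetric] network_form_def pair_energy_def mult.left_commute[of \<theta>] sum_distrib_left[of \<theta>]
    proof (intro mult_left_mono sum_mono)
      fix I J assume IJ: "I \<in> V 0 // E" "J \<in> V 0 // E"
      show "1 / R I J * \<bar>(g \<circ> r) I - (g \<circ> r) J\<bar>\<^sup>2 \<le> \<theta> * \<bar>(g \<circ> r) I - (g \<circ> r) J\<bar>\<^sup>2"
      proof (cases "I = J")
        case False
        then show ?thesis by (intro mult_right_mono R[OF IJ]) auto
      qed simp
    qed auto
    also have "pair_energy (V 0 // E) (g \<circ> r) = pair_energy (r ` (V 0 // E)) g"
      by (rule pair_energy_image[OF inj, symmetric])
    also have "\<theta> * \<dots> \<le> \<theta> * En 0 g"
      unfolding energy_0 using \<theta> by (intro mult_left_mono pair_energy_subset[OF rV finite_V0])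
    finally show ?thesis .
  qed
  ultimately show ?thesis by (intro exI[of _ v]) auto
qed

lemma quotient_growth_uniform:
  assumes "\<And>I J. I \<in> V 0 // E \<Longrightarrow> J \<in> V 0 // E \<Longrightarrow> I \<noteq> J \<Longrightarrow>
      \<exists>S. has_growth_rate (\<lambda>n. Rq n I J) S \<and> S > R0" and R0: "1 < R0"
  obtains t M where "R0 < t"
    "\<And>n I J. M \<le> n \<Longrightarrow> I \<in> V 0 // E \<Longrightarrow> J \<in> V 0 // E \<Longrightarrow> I \<noteq> J \<Longrightarrow> t ^ n \<le> Rq n I J"
proof -
  have "\<exists>t M. R0 < t \<and> (\<forall>n\<ge>M. t ^ n \<le> Rq n I J)" if IJ: "I \<in> V 0 // E" "J \<in> V 0 // E" "I \<noteq> J" for I J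
  proof -
    obtain S where S: "has_growth_rate (\<lambda>n. Rq n I J) S" "S > R0" using assms(1)[OF IJ] by blast
    have "0 < (R0 + S) / 2" "(R0 + S) / 2 < S" "R0 < (R0 + S) / 2" using S(2) R0 by auto
    then show ?thesis using growth_rate_lower[OF S(1), of "(R0 + S) / 2"] by metis
  qed
  then obtain t M where tM: "\<And>I J. I \<in> V 0 // E \<Longrightarrow> J \<in> V 0 // E \<Longrightarrow> I \<noteq> J \<Longrightarrow>
      R0 < t I J \<and> (\<forall>n\<ge>M I J. t I J ^ n \<le> Rq n I J)" by metis
  let ?Q = "{(I, J). I \<in> V 0 // E \<and> J \<in> V 0 // E \<and> I \<noteq> J}"
  have fin: "finite ?Q" by (rule finite_subset[of _ "(V 0 // E) \<times> (V 0 // E)"]) (use finite_classes in auto)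
  define t0 where "t0 = Min (insert (R0 + 1) ((\<lambda>(I, J). t I J) ` ?Q))"
  define M0 where "M0 = Max (insert 0 ((\<lambda>(I, J). M I J) ` ?Q))"
  show ?thesis
  proof (rule that[of t0 M0])
    show t0: "R0 < t0" unfolding t0_def using fin tM by (subst Min_gr_iff) auto
    fix n I J assume n: "M0 \<le> n" and IJ: "I \<in> V 0 // E" "J \<in> V 0 // E" "I \<noteq> J"
    have "t0 \<le> t I J" unfolding t0_def using fin IJ by (intro Min_le) (auto intro!: image_eqI[of _ _ "(I, J)"])
    then have "t0 ^ n \<le> t I J ^ n" using t0 R0 by (intro power_mono) auto
    moreover have "M I J \<le> M0" unfolding M0_def using fin IJ by (intro Max_ge) (auto intro!: image_eqI[of _ _ "(I, J)"])
    ultimately show "t0 ^ n \<le> Rq n I J" using tM[OF IJ] n by (meson order_trans)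
  qed
qed

definition saturated :: "'a set \<Rightarrow> bool" where
  "saturated A \<longleftrightarrow> (\<forall>(a, a')\<in>E. a \<in> A \<longleftrightarrow> a' \<in> A)"

text \<open>
  The cutoffs are indexed by the sets on which they are 1, since the construction below needs one for the boundary part
  of each cell, all with the same constants \<open>D\<close> and \<open>\<tau>\<close>.
\<close>

definition cutoff_family :: "('a set \<Rightarrow> 'a \<Rightarrow> real) \<Rightarrow> real \<Rightarrow> real \<Rightarrow> bool" where
  "cutoff_family T D \<tau> \<longleftrightarrow> (\<forall>A. saturated A \<longrightarrow> (\<forall>p\<in>V 0. T A p = indicator A p) \<and>
     (\<forall>(x, y)\<in>Ls. T A x = T A y) \<and> (\<forall>n. En n (T A) \<le> D * \<tau> ^ n))"

text \<open>
  The quotient traces exceed \<open>t ^ n\<close> for some \<open>t > R0\<close> and all large \<open>n\<close>.  Iterating the step at one such level \<open>n0\<close> gives the rate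
  \<open>\<tau> = 1 / t\<close> along the multiples of \<open>n0\<close>, and \<open>energy_le_energy_Suc\<close> fills in the levels between them.
\<close>

lemma saturated_extension:
  assumes qt: "\<And>n. is_quotient_trace N F K E n (Rq n)"
    and growth: "\<And>I J. I \<in> V 0 // E \<Longrightarrow> J \<in> V 0 // E \<Longrightarrow> I \<noteq> J \<Longrightarrow>
      \<exists>S. has_growth_rate (\<lambda>n. Rq n I J) S \<and> S > R0" and R0: "1 < R0"
  obtains \<tau> D T where "0 < \<tau>" "\<tau> < 1 / R0" "0 \<le> D" "cutoff_family T D \<tau>"
proof -
  obtain t M where t: "R0 < t"
    "\<And>n I J. M \<le> n \<Longrightarrow> I \<in> V 0 // E \<Longrightarrow> J \<in> V 0 // E \<Longrightarrow> I \<noteq> J \<Longrightarrow> t ^ n \<le> Rq n I J"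
    by (rule quotient_growth_uniform[OF growth R0]) (assumption | rule that)+
  define n0 where "n0 = max 1 M"
  define \<tau> where "\<tau> = 1 / t"
  have \<tau>: "0 < \<tau>" "\<tau> < 1 / R0" "\<tau> < 1" using t(1) R0 by (auto simp: \<tau>_def field_simps)
  have n0: "1 \<le> n0" by (simp add: n0_def)
  have step: "\<exists>v. (\<forall>p\<in>V 0. v p = g p) \<and> (\<forall>(x, y)\<in>L n0. v x = v y) \<and> En n0 v \<le> \<tau> ^ n0 * En 0 g"
    if "E_invariant g" for g
  proof (rule quotient_trace_step[OF qt _ _ that])
    fix I J assume "I \<in> V 0 // E" "J \<in> V 0 // E" "I \<noteq> J"
    then have "t ^ n0 \<le> Rq n0 I J" by (intro t(2)) (simp add: n0_def)
    moreover have "0 < t ^ n0" using t(1) R0 by simp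
    ultimately show "1 / Rq n0 I J \<le> \<tau> ^ n0" by (simp add: \<tau>_def power_one_over frac_le)
  qed (use \<tau> in simp)
  obtain C where C: "1 \<le> C" "\<And>n u. En n u \<le> C * En (Suc n) u" by (rule energy_le_energy_Suc) (rule that)
  have Cpow: "En n u \<le> C ^ j * En (n + j) u" for n j u
  proof (induction j)
    case (Suc j)
    have "C ^ j * En (n + j) u \<le> C ^ j * (C * En (Suc (n + j)) u)" using C by (intro mult_left_mono) auto
    then show ?case using Suc by (simp add: mult_ac)
  qed simp
  define D where "D = C ^ n0 * (real (card (V 0)))\<^sup>2"
  have D: "0 \<le> D" using C by (simp add: D_def)
  define good where "good A T \<longleftrightarrow> (\<forall>p\<in>V 0. T p = indicator A p) \<and> (\<forall>x y. (x, y) \<in> Ls \<longrightarrow> T x = T y) \<and>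
    (\<forall>n. En n T \<le> D * \<tau> ^ n)" for A and T :: "'a \<Rightarrow> real"
  have ex: "\<exists>T. good A T" if A: "saturated A" for A
  proof -
    let ?g = "indicator A :: 'a \<Rightarrow> real"
    have g: "E_invariant ?g" unfolding E_invariant_def using A by (auto simp: indicator_def saturated_def)
    obtain T where T: "\<And>p. p \<in> V 0 \<Longrightarrow> T p = ?g p" "\<And>x y. (x, y) \<in> Ls \<Longrightarrow> T x = T y"
      "\<And>k. En (k * n0) T \<le> (\<tau> ^ n0) ^ k * En 0 ?g"
      by (rule block_extension[OF n0 _ step g]) (use \<tau> in simp, assumption, rule that)
    have g0: "En 0 ?g \<le> (real (card (V 0)))\<^sup>2"
    proof -
      have "(\<Sum>x\<in>V 0. \<Sum>y\<in>V 0. \<bar>?g x - ?g y\<bar>\<^sup>2) \<le> (\<Sum>x\<in>V 0. \<Sum>y\<in>V 0. 1)"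
        by (intro sum_mono) (auto simp: indicator_def)
      then have "(\<Sum>x\<in>V 0. \<Sum>y\<in>V 0. \<bar>?g x - ?g y\<bar>\<^sup>2) \<le> (real (card (V 0)))\<^sup>2" by (simp add: power2_eq_square)
      moreover have "0 \<le> (\<Sum>x\<in>V 0. \<Sum>y\<in>V 0. \<bar>?g x - ?g y\<bar>\<^sup>2)" by (intro sum_nonneg) auto
      ultimately show ?thesis unfolding energy_0 pair_energy_def by linarith
    qed
    have "En n T \<le> D * \<tau> ^ n" for n
    proof -
      \<comment> \<open>the first multiple of \<open>n0\<close> beyond \<open>n\<close>\<close>
      define k where "k = Suc (n div n0)"
      have kn: "n \<le> k * n0" "k * n0 - n \<le> n0"
      proof -
        have e: "(n div n0) * n0 + n mod n0 = n" by simp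
        have "n mod n0 < n0" using n0 by simp
        then show "n \<le> k * n0" using e unfolding k_def mult_Suc by linarith
        show "k * n0 - n \<le> n0" using e unfolding k_def mult_Suc by linarith
      qed
      have "En n T \<le> C ^ (k * n0 - n) * En (k * n0) T" using Cpow[of n T "k * n0 - n"] kn by simp
      also have "\<dots> \<le> C ^ n0 * ((\<tau> ^ n0) ^ k * (real (card (V 0)))\<^sup>2)"
      proof (rule mult_mono)
        show "C ^ (k * n0 - n) \<le> C ^ n0" using C kn by (intro power_increasing) auto
        have "(\<tau> ^ n0) ^ k * En 0 ?g \<le> (\<tau> ^ n0) ^ k * (real (card (V 0)))\<^sup>2"
          using \<tau> g0 by (intro mult_left_mono) auto
        then show "En (k * n0) T \<le> (\<tau> ^ n0) ^ k * (real (card (V 0)))\<^sup>2" using T(3)[of k] by linarith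
      qed (use C energy_nonneg in auto)
      also have "\<dots> = D * \<tau> ^ (k * n0)" by (simp add: D_def power_mult[symmetric] mult.commute)
      also have "\<dots> \<le> D * \<tau> ^ n" using D \<tau> kn by (intro mult_left_mono power_decreasing) auto
      finally show ?thesis .
    qed
    with T(1,2) have "good A T" unfolding good_def by blast
    then show ?thesis by blast
  qed
  then obtain T where T: "\<And>A. saturated A \<Longrightarrow> good A (T A)" by metis
  show ?thesis
    by (rule that[of \<tau> D T, OF \<tau>(1,2) D]) (use T in \<open>auto simp: good_def cutoff_family_def\<close>)
qed

definition boundary_part :: "nat list \<Rightarrow> 'a set" where
  "boundary_part w = {p \<in> V 0. Fw w p \<in> boundary_points}"

text \<open>
  The energy of \<open>v\<close> in the cell \<open>w\<close>, with ordered pairs, of which only the vertices in boundary classes are taken.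
\<close>

definition boundary_energy :: "nat list \<Rightarrow> ('a \<Rightarrow> real) \<Rightarrow> real" where
  "boundary_energy w v = (\<Sum>p\<in>boundary_part w. \<Sum>q\<in>boundary_part w. (v (Fw w p) - v (Fw w q))\<^sup>2)"

text \<open>
  The extensions to the single boundary classes are put together.  A cell of positive level meets one class only, so
  its boundary energy is at most twice its share in the energy of that class.
\<close>

lemma boundary_class_extension:
  assumes ext: "\<And>J u. J \<in> Vs // Ls \<Longrightarrow> boundary_class N F K J \<Longrightarrow> nontrivial_class J \<Longrightarrow>
      \<exists>v. (\<forall>x\<in>J \<inter> V 0. v x = (u x :: real)) \<and> bdd_above (range (\<lambda>n. R0 ^ n * class_energy N F K J n v))"
    and R0: "1 < R0"
  obtains v A where "\<And>p. p \<in> V 0 \<Longrightarrow> v p = u p" "0 \<le> A"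
    "\<And>n. 1 \<le> n \<Longrightarrow> (\<Sum>w\<in>W n. boundary_energy w v) \<le> A * (1 / R0) ^ n"
proof -
  let ?\<kappa> = "1 / R0"
  define cl where "cl x = Ls `` {x}" for x
  define CL where "CL = cl ` V 0"
  have fin: "finite CL" using finite_V0 by (simp add: CL_def)
  have cl_self: "x \<in> cl x" if "x \<in> Vs" for x using Ls_refl[OF that] by (simp add: cl_def)
  have cl_eq: "cl x = cl y" if "(x, y) \<in> Ls" for x y
    unfolding cl_def using equiv_class_eq[OF Ls_equiv that] .
  have "\<exists>v A. (\<forall>x\<in>J \<inter> V 0. v x = u x) \<and> 0 \<le> A \<and> (\<forall>n. class_energy N F K J n v \<le> A * ?\<kappa> ^ n)" if J: "J \<in> CL" for J
  proof -
    obtain p where p: "p \<in> V 0" "J = cl p" using J unfolding CL_def by blast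
    have pVs: "p \<in> Vs" using p V_in_Vs by blast
    show ?thesis
    proof (cases "nontrivial_class J")
      case True
      have J1: "J \<in> Vs // Ls" using pVs p(2) unfolding cl_def by (simp add: quotientI)
      have J2: "boundary_class N F K J" using p cl_self[OF pVs] unfolding boundary_class_def by blast
      from ext[OF J1 J2 True, of u] obtain v where v: "\<forall>x\<in>J \<inter> V 0. v x = u x"
          "bdd_above (range (\<lambda>n. R0 ^ n * class_energy N F K J n v))" by (elim exE conjE) (rule that)
      then obtain B where "\<And>n. R0 ^ n * class_energy N F K J n v \<le> B" unfolding bdd_above_def by auto
      then have "R0 ^ n * class_energy N F K J n v \<le> max 0 B" for n by (meson max.coboundedI2)
      then have "class_energy N F K J n v \<le> max 0 B * ?\<kappa> ^ n" for n
        using R0 by (simp add: power_one_over field_simps)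
      then show ?thesis using v(1) by (intro exI[of _ v] exI[of _ "max 0 B"]) auto
    next
      case False
      have "pair_energy (J \<inter> cell N F K w) u = 0" for w
        using False unfolding pair_energy_def nontrivial_class_def
        by (auto intro!: sum.neutral)
      then have "class_energy N F K J n u = 0" for n unfolding class_energy_def by simp
      then show ?thesis by (intro exI[of _ u] exI[of _ 0]) auto
    qed
  qed
  then obtain vj A where vA: "\<And>J x. J \<in> CL \<Longrightarrow> x \<in> J \<inter> V 0 \<Longrightarrow> vj J x = u x" "\<And>J. J \<in> CL \<Longrightarrow> 0 \<le> A J"
    "\<And>J n. J \<in> CL \<Longrightarrow> class_energy N F K J n (vj J) \<le> A J * ?\<kappa> ^ n" by metis
  define v where "v x = vj (cl x) x" for x
  show ?thesis
  proof (rule that[of v "2 * (\<Sum>J\<in>CL. A J)"])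
    show "v p = u p" if "p \<in> V 0" for p
    proof -
      have "p \<in> cl p \<inter> V 0" using that cl_self V_in_Vs by blast
      then show ?thesis unfolding v_def using that by (intro vA(1)) (auto simp: CL_def)
    qed
    show "0 \<le> 2 * (\<Sum>J\<in>CL. A J)" using vA(2) by (simp add: sum_nonneg)
    fix n :: nat assume "1 \<le> n"
    then obtain n' where n: "n = Suc n'" by (cases n) auto
    have one: "boundary_energy w v \<le> (\<Sum>J\<in>CL. 2 * pair_energy (J \<inter> cell N F K w) (vj J))" if w: "w \<in> W n" for w
    proof (cases "boundary_part w = {}")
      case True
      then show ?thesis unfolding boundary_energy_def by (simp add: sum_nonneg pair_energy_nonneg)
    next
      case False
      then obtain p0 where p0: "p0 \<in> V 0" "Fw w p0 \<in> boundary_points" by (auto simp: boundary_part_def)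
      define J where "J = cl (Fw w p0)"
      obtain p' where "p' \<in> V 0" "(Fw w p0, p') \<in> Ls" using p0(2) unfolding boundary_points_def by blast
      then have J: "J \<in> CL" unfolding J_def CL_def using cl_eq by blast
      have same: "cl (Fw w p) = J" if "p \<in> boundary_part w" for p
      proof -
        have "(Fw w p, Fw w p0) \<in> Ls"
          using that p0 w unfolding n boundary_part_def by (intro word_single_class[of w n' p p0]) auto
        then show ?thesis unfolding J_def by (rule cl_eq)
      qed
      have sub: "Fw w ` boundary_part w \<subseteq> J \<inter> cell N F K w"
      proof
        fix y assume "y \<in> Fw w ` boundary_part w"
        then obtain p where p: "p \<in> boundary_part w" "y = Fw w p" by blast
        then have pV: "p \<in> V 0" by (simp add: boundary_part_def)
        then have "y \<in> cl y" using p(2) Fw_Vs[OF w] V_in_Vs by (intro cl_self) blast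
        then show "y \<in> J \<inter> cell N F K w" using same[OF p(1)] p(2) pV by (auto simp: cell_def)
      qed
      have "boundary_energy w v = 2 * pair_energy (boundary_part w) (v \<circ> Fw w)"
        unfolding boundary_energy_def pair_energy_def by simp
      also have "pair_energy (boundary_part w) (v \<circ> Fw w) = pair_energy (Fw w ` boundary_part w) v"
        by (rule pair_energy_image[OF inj_Fw, symmetric])
      also have "\<dots> = pair_energy (Fw w ` boundary_part w) (vj J)"
        by (rule pair_energy_cong) (auto simp: v_def same)
      also have "\<dots> \<le> pair_energy (J \<inter> cell N F K w) (vj J)"
        by (rule pair_energy_subset[OF sub]) (simp add: cell_def finite_V0)
      also have "2 * \<dots> \<le> (\<Sum>J\<in>CL. 2 * pair_energy (J \<inter> cell N F K w) (vj J))"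
        using member_le_sum[OF J _ fin, of "\<lambda>J. 2 * pair_energy (J \<inter> cell N F K w) (vj J)"]
        by (simp add: pair_energy_nonneg)
      finally show ?thesis by simp
    qed
    have "(\<Sum>w\<in>W n. boundary_energy w v) \<le> (\<Sum>w\<in>W n. \<Sum>J\<in>CL. 2 * pair_energy (J \<inter> cell N F K w) (vj J))"
      by (intro sum_mono one)
    also have "\<dots> = (\<Sum>J\<in>CL. 2 * class_energy N F K J n (vj J))"
      unfolding class_energy_def sum_distrib_left by (rule sum.swap)
    also have "\<dots> \<le> (\<Sum>J\<in>CL. 2 * (A J * ?\<kappa> ^ n))" by (intro sum_mono mult_left_mono vA(3)) auto
    also have "\<dots> = 2 * (\<Sum>J\<in>CL. A J) * ?\<kappa> ^ n" by (simp add: sum_distrib_left sum_distrib_right mult_ac)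
    finally show "(\<Sum>w\<in>W n. boundary_energy w v) \<le> 2 * (\<Sum>J\<in>CL. A J) * ?\<kappa> ^ n" .
  qed
qed

end

section \<open>Extension of arbitrary boundary values\<close>

lemma pair_energy_add_le: "pair_energy A (\<lambda>x. f x + g x) \<le> 2 * pair_energy A f + 2 * pair_energy A g"
proof -
  have "(\<Sum>x\<in>A. \<Sum>y\<in>A. \<bar>f x + g x - (f y + g y)\<bar>\<^sup>2) \<le> (\<Sum>x\<in>A. \<Sum>y\<in>A. 2 * \<bar>f x - f y\<bar>\<^sup>2 + 2 * \<bar>g x - g y\<bar>\<^sup>2)"
  proof (intro sum_mono)
    fix x y
    show "\<bar>f x + g x - (f y + g y)\<bar>\<^sup>2 \<le> 2 * \<bar>f x - f y\<bar>\<^sup>2 + 2 * \<bar>g x - g y\<bar>\<^sup>2"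
      using zero_le_power2[of "(f x - f y) - (g x - g y)"] by (simp add: power2_eq_square algebra_simps)
  qed
  also have "\<dots> = 2 * (\<Sum>x\<in>A. \<Sum>y\<in>A. \<bar>f x - f y\<bar>\<^sup>2) + 2 * (\<Sum>x\<in>A. \<Sum>y\<in>A. \<bar>g x - g y\<bar>\<^sup>2)"
    by (simp add: sum.distrib sum_distrib_left)
  finally show ?thesis unfolding pair_energy_def by simp
qed

text \<open>
  Here the last term has weight 1.  In the application term \<open>k\<close> was created at level \<open>k\<close> and has decayed up to level
  \<open>n\<close>, so the exponential loss has to fall on the old terms.
\<close>

lemma square_sum_le_weighted_rev:
  fixes d :: "nat \<Rightarrow> real"
  assumes s: "0 < s" "s < 1"
  shows "(\<Sum>k<n. d k)\<^sup>2 \<le> (\<Sum>k<n. (d k)\<^sup>2 / s ^ (n - Suc k)) / (1 - s)"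
proof -
  have "(\<Sum>k<n. d k)\<^sup>2 = (\<Sum>k<n. d (n - Suc k))\<^sup>2" by (simp only: sum.nat_diff_reindex)
  also have "\<dots> \<le> (\<Sum>k<n. (d (n - Suc k))\<^sup>2 / s ^ k) / (1 - s)" by (rule square_sum_le_weighted[OF s])
  also have "(\<Sum>k<n. (d (n - Suc k))\<^sup>2 / s ^ k) = (\<Sum>k<n. (d (n - Suc k))\<^sup>2 / s ^ (n - Suc (n - Suc k)))"
    by (intro sum.cong) auto
  also have "\<dots> = (\<Sum>k<n. (d k)\<^sup>2 / s ^ (n - Suc k))"
    by (rule sum.nat_diff_reindex[of "\<lambda>k. (d k)\<^sup>2 / s ^ (n - Suc k)"])
  finally show ?thesis .
qed

lemma pair_energy_weighted_sum_le:
  fixes c :: "nat \<Rightarrow> real"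
  assumes s: "0 < s" "s < 1"
  shows "pair_energy A (\<lambda>x. \<Sum>m<n. c m * g m x)
     \<le> (\<Sum>m<n. (c m)\<^sup>2 * pair_energy A (g m) / s ^ (n - Suc m)) / (1 - s)"
proof -
  have "pair_energy A (\<lambda>x. \<Sum>m<n. c m * g m x) = 1/2 * (\<Sum>x\<in>A. \<Sum>y\<in>A. (\<Sum>m<n. c m * (g m x - g m y))\<^sup>2)"
    unfolding pair_energy_def by (simp add: sum_subtractf right_diff_distrib)
  also have "\<dots> \<le> 1/2 * (\<Sum>x\<in>A. \<Sum>y\<in>A. (\<Sum>m<n. (c m * (g m x - g m y))\<^sup>2 / s ^ (n - Suc m)) / (1 - s))"
    by (intro mult_left_mono sum_mono square_sum_le_weighted_rev[OF s]) auto
  also have "\<dots> = 1/2 * (\<Sum>m<n. (\<Sum>x\<in>A. \<Sum>y\<in>A. (c m * (g m x - g m y))\<^sup>2 / s ^ (n - Suc m))) / (1 - s)"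
  proof -
    have "(\<Sum>x\<in>A. \<Sum>y\<in>A. \<Sum>m<n. h x y m) = (\<Sum>m<n. \<Sum>x\<in>A. \<Sum>y\<in>A. h x y m)" for h :: "_ \<Rightarrow> _ \<Rightarrow> nat \<Rightarrow> real"
    proof -
      have "(\<Sum>x\<in>A. \<Sum>y\<in>A. \<Sum>m<n. h x y m) = (\<Sum>x\<in>A. \<Sum>m<n. \<Sum>y\<in>A. h x y m)"
        by (intro sum.cong refl) (rule sum.swap)
      also have "\<dots> = (\<Sum>m<n. \<Sum>x\<in>A. \<Sum>y\<in>A. h x y m)" by (rule sum.swap)
      finally show ?thesis .
    qed
    then show ?thesis by (simp add: sum_divide_distrib[symmetric])
  qed
  also have "\<dots> = (\<Sum>m<n. (c m)\<^sup>2 * pair_energy A (g m) / s ^ (n - Suc m)) / (1 - s)"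
    unfolding pair_energy_def
    by (simp add: power_mult_distrib sum_distrib_left sum_divide_distrib mult_ac)
  finally show ?thesis .
qed

context homogeneous_pcf_relation
begin

definition base_point :: "nat list \<Rightarrow> 'a" where
  "base_point w = (SOME p. p \<in> boundary_part w)"

text \<open>
  The empty word has value 0, since \<open>K\<close> itself may meet several boundary classes.  Hence the jumps of the nonempty
  prefixes of a word add up to its base value, as long as the boundary parts of these prefixes are nonempty.
\<close>

definition base_value :: "('a \<Rightarrow> real) \<Rightarrow> nat list \<Rightarrow> real" where
  "base_value v w = (if w = [] then 0 else v (Fw w (base_point w)))"

definition jump :: "('a \<Rightarrow> real) \<Rightarrow> nat list \<Rightarrow> real" where
  "jump v w = (if boundary_part w = {} then 0 else base_value v w - base_value v (butlast w))"

lemma base_point: "boundary_part w \<noteq> {} \<Longrightarrow> base_point w \<in> boundary_part w"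
  unfolding base_point_def by (simp add: some_in_eq)

lemma boundary_part_V0: "boundary_part w \<subseteq> V 0"
  by (auto simp: boundary_part_def)

lemma finite_boundary_part: "finite (boundary_part w)"
  using finite_subset[OF boundary_part_V0 finite_V0] .

lemma boundary_part_iff: "w \<in> W n \<Longrightarrow> (a, a') \<in> E \<Longrightarrow> a \<in> boundary_part w \<longleftrightarrow> a' \<in> boundary_part w"
  using boundary_points_saturated[OF Ls_Fw[OF _ Ls_E]] E_V0 unfolding boundary_part_def by blast

lemma saturated_boundary_part: "w \<in> W n \<Longrightarrow> saturated (boundary_part w)"
  unfolding saturated_def using boundary_part_iff by blast

lemma cutoff_family_V0: "cutoff_family T D \<tau> \<Longrightarrow> saturated A \<Longrightarrow> p \<in> V 0 \<Longrightarrow> T A p = indicator A p"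
  and cutoff_family_Ls: "cutoff_family T D \<tau> \<Longrightarrow> saturated A \<Longrightarrow> (x, y) \<in> Ls \<Longrightarrow> T A x = T A y"
  and cutoff_family_energy: "cutoff_family T D \<tau> \<Longrightarrow> saturated A \<Longrightarrow> En n (T A) \<le> D * \<tau> ^ n"
  unfolding cutoff_family_def by blast+

lemma boundary_energy_nonneg: "0 \<le> boundary_energy w v"
  unfolding boundary_energy_def by (intro sum_nonneg) auto

lemma diff_le_boundary_energy:
  assumes "p \<in> boundary_part w" "q \<in> boundary_part w"
  shows "(v (Fw w p) - v (Fw w q))\<^sup>2 \<le> boundary_energy w v"
proof -
  have "(v (Fw w p) - v (Fw w q))\<^sup>2 \<le> (\<Sum>q\<in>boundary_part w. (v (Fw w p) - v (Fw w q))\<^sup>2)"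
    using assms finite_boundary_part by (intro member_le_sum) auto
  also have "\<dots> \<le> boundary_energy w v" unfolding boundary_energy_def
    using assms finite_boundary_part
    by (intro member_le_sum[of p _ "\<lambda>p. \<Sum>q\<in>boundary_part w. (v (Fw w p) - v (Fw w q))\<^sup>2"]) (auto intro: sum_nonneg)
  finally show ?thesis .
qed

text \<open>
  The base point of the child is related to a vertex \<open>q\<close> of the parent through \<open>relation_chain\<close>, which is paid for by
  the boundary energies of the children; \<open>q\<close> and the base point of the parent are both vertices of the parent.
\<close>

lemma jump_le:
  obtains C where "0 \<le> C" "\<And>k w i v. w \<in> W (Suc k) \<Longrightarrow> i \<in> {1..N} \<Longrightarrow>
    (jump v (w @ [i]))\<^sup>2 \<le> C * (\<Sum>j=1..N. boundary_energy (w @ [j]) v) + 2 * boundary_energy w v"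
proof -
  obtain C where C: "0 \<le> C" "\<And>x p. (x, p) \<in> L (Suc 0) \<Longrightarrow> p \<in> V 0 \<Longrightarrow>
     \<exists>q\<in>V 0. (x, q) \<in> Ls \<and> (\<forall>g. (g x - g q)\<^sup>2 \<le> C * relation_energy g)"
    by (rule relation_chain) (rule that)
  show ?thesis
  proof (rule that[of "2 * C"])
    show "0 \<le> 2 * C" using C by simp
    fix k w i and v :: "'a \<Rightarrow> real" assume w: "w \<in> W (Suc k)" and i: "i \<in> {1..N}"
    have nonneg: "0 \<le> 2 * C * (\<Sum>j=1..N. boundary_energy (w @ [j]) v) + 2 * boundary_energy w v"
      using C(1) boundary_energy_nonneg by (intro add_nonneg_nonneg mult_nonneg_nonneg sum_nonneg) auto
    show "(jump v (w @ [i]))\<^sup>2 \<le> 2 * C * (\<Sum>j=1..N. boundary_energy (w @ [j]) v) + 2 * boundary_energy w v"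
    proof (cases "boundary_part (w @ [i]) = {}")
      case True
      then show ?thesis using nonneg by (simp add: jump_def)
    next
      case False
      let ?p = "base_point (w @ [i])"
      have p: "?p \<in> V 0" "Fw w (F i ?p) \<in> boundary_points"
        using base_point[OF False] by (auto simp: boundary_part_def word_map_append)
      have Fp: "F i ?p \<in> V (Suc 0)" unfolding vertices.simps(2) using i p(1) by blast
      then have "F i ?p \<in> Vs" using V_in_Vs by blast
      then obtain p' where p': "p' \<in> V 0" "(F i ?p, p') \<in> Ls" using exit_word[OF w _ p(2)] by metis
      have "(F i ?p, p') \<in> L (Suc 0)" using Ls_compatible[OF p'(2) Fp] p'(1) V0_V1 by blast
      then obtain q where q: "q \<in> V 0" "(F i ?p, q) \<in> Ls" "\<And>g. (g (F i ?p) - g q)\<^sup>2 \<le> C * relation_energy g"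
        using C(2)[OF _ p'(1)] by metis
      have wq: "Fw w q \<in> boundary_points" using Ls_Fw[OF w q(2)] boundary_points_saturated p(2) by blast
      then have qb: "q \<in> boundary_part w" using q(1) by (simp add: boundary_part_def)
      \<comment> \<open>only pairs of \<open>E\<close> in boundary classes may count, so \<open>v\<close> is replaced by 0 elsewhere; both points of a pair are on the same side\<close>
      define g where "g x = (if Fw w x \<in> boundary_points then v (Fw w x) else 0)" for x
      have local: "(\<Sum>(a, a')\<in>E. (g (F j a) - g (F j a'))\<^sup>2) \<le> boundary_energy (w @ [j]) v" if j: "j \<in> {1..N}" for j
      proof -
        have wj: "w @ [j] \<in> W (Suc (Suc k))" using w j by (auto simp: words_def)
        let ?B = "boundary_part (w @ [j])"
        have "(\<Sum>(a, a')\<in>E. (g (F j a) - g (F j a'))\<^sup>2) = (\<Sum>(a, a')\<in>E \<inter> ?B \<times> ?B. (g (F j a) - g (F j a'))\<^sup>2)"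
        proof (rule sum.mono_neutral_right[OF finite_E])
          show "\<forall>z\<in>E - E \<inter> ?B \<times> ?B. (case z of (a, a') \<Rightarrow> (g (F j a) - g (F j a'))\<^sup>2) = 0"
          proof
            fix z assume "z \<in> E - E \<inter> ?B \<times> ?B"
            moreover obtain a a' where z: "z = (a, a')" by (cases z)
            ultimately have a: "(a, a') \<in> E" "(a, a') \<notin> ?B \<times> ?B" by auto
            then have "a \<notin> ?B" "a' \<notin> ?B" using boundary_part_iff[OF wj a(1)] by auto
            then have "g (F j a) = 0" "g (F j a') = 0"
              using E_V0[OF a(1)] by (auto simp: g_def boundary_part_def word_map_append)
            then show "(case z of (a, a') \<Rightarrow> (g (F j a) - g (F j a'))\<^sup>2) = 0" by (simp add: z)
          qed
        qed auto
        also have "\<dots> \<le> (\<Sum>(a, a')\<in>?B \<times> ?B. (g (F j a) - g (F j a'))\<^sup>2)"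
          using finite_boundary_part by (intro sum_mono2) auto
        also have "\<dots> = boundary_energy (w @ [j]) v"
          unfolding boundary_energy_def sum.cartesian_product[symmetric]
          by (intro sum.cong refl) (simp add: g_def boundary_part_def word_map_append)
        finally show ?thesis .
      qed
      have "(g (F i ?p) - g q)\<^sup>2 \<le> C * relation_energy g" by (rule q(3))
      also have "\<dots> \<le> C * (\<Sum>j=1..N. boundary_energy (w @ [j]) v)"
        unfolding relation_energy_def using C(1) local by (intro mult_left_mono sum_mono) auto
      finally have 1: "(g (F i ?p) - g q)\<^sup>2 \<le> C * (\<Sum>j=1..N. boundary_energy (w @ [j]) v)" .
      have ne: "w \<noteq> []" using w by (auto simp: words_def)
      have 2: "(v (Fw w q) - v (Fw w (base_point w)))\<^sup>2 \<le> boundary_energy w v"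
        using qb base_point[of w] by (intro diff_le_boundary_energy) auto
      have young: "(x + y)\<^sup>2 \<le> 2 * x\<^sup>2 + 2 * y\<^sup>2" for x y :: real
        using zero_le_power2[of "x - y"] by (simp add: power2_eq_square algebra_simps)
      have "jump v (w @ [i]) = (g (F i ?p) - g q) + (v (Fw w q) - v (Fw w (base_point w)))"
        using False ne p(2) wq by (simp add: jump_def base_value_def g_def word_map_append)
      then have "(jump v (w @ [i]))\<^sup>2 \<le> 2 * (g (F i ?p) - g q)\<^sup>2 + 2 * (v (Fw w q) - v (Fw w (base_point w)))\<^sup>2"
        using young by simp
      then show ?thesis using 1 2 by linarith
    qed
  qed
qed

lemma sum_jump_le:
  assumes \<kappa>: "0 < \<kappa>" "\<kappa> < 1" and A: "0 \<le> A"
    and v: "\<And>n. 1 \<le> n \<Longrightarrow> (\<Sum>w\<in>W n. boundary_energy w v) \<le> A * \<kappa> ^ n"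
  obtains B where "0 \<le> B" "\<And>n. (\<Sum>w\<in>W n. (jump v w)\<^sup>2) \<le> B * \<kappa> ^ n"
proof -
  obtain C where C: "0 \<le> C" "\<And>k w i v. w \<in> W (Suc k) \<Longrightarrow> i \<in> {1..N} \<Longrightarrow>
    (jump v (w @ [i]))\<^sup>2 \<le> C * (\<Sum>j=1..N. boundary_energy (w @ [j]) v) + 2 * boundary_energy w v"
    by (rule jump_le) (rule that)
  define M where "M = real N * (C * A + 2 * A) / \<kappa>"
  have M: "0 \<le> M" using C A \<kappa> by (simp add: M_def)
  have "(\<Sum>w\<in>W n. (jump v w)\<^sup>2) \<le> M * \<kappa> ^ n" if n: "2 \<le> n" for n
  proof -
    obtain k where k: "n = Suc (Suc k)" using n by (metis Suc_le_D numeral_2_eq_2 Suc_le_mono)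
    have "(\<Sum>w\<in>W n. (jump v w)\<^sup>2) = (\<Sum>w\<in>W (Suc k). \<Sum>i=1..N. (jump v (w @ [i]))\<^sup>2)"
      unfolding k by (rule sum_words_Suc)
    also have "\<dots> \<le> (\<Sum>w\<in>W (Suc k). \<Sum>i=1..N. C * (\<Sum>j=1..N. boundary_energy (w @ [j]) v) + 2 * boundary_energy w v)"
      by (intro sum_mono C(2))
    also have "\<dots> = real N * (C * (\<Sum>w\<in>W n. boundary_energy w v) + 2 * (\<Sum>w\<in>W (Suc k). boundary_energy w v))"
      unfolding k sum_words_Suc[of _ N "Suc k"] by (simp add: sum.distrib sum_distrib_left algebra_simps)
    also have "\<dots> \<le> real N * (C * (A * \<kappa> ^ Suc k) + 2 * (A * \<kappa> ^ Suc k))"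
    proof (intro mult_left_mono add_mono C(1))
      have "A * \<kappa> ^ n \<le> A * \<kappa> ^ Suc k" using A \<kappa> by (intro mult_left_mono power_decreasing) (auto simp: k)
      then show "(\<Sum>w\<in>W n. boundary_energy w v) \<le> A * \<kappa> ^ Suc k" using v[of n] n by linarith
      show "(\<Sum>w\<in>W (Suc k). boundary_energy w v) \<le> A * \<kappa> ^ Suc k" by (rule v) simp
    qed auto
    also have "\<dots> = M * \<kappa> ^ n" using \<kappa> by (simp add: M_def k field_simps)
    finally show ?thesis .
  qed
  then show ?thesis using geometric_bound_from[where a = "\<lambda>n. \<Sum>w\<in>W n. (jump v w)\<^sup>2", OF \<kappa>(1) M] that by metis
qed

lemma sum_take_drop:
  assumes "m < n"
  shows "(\<Sum>w\<in>W n. h (take (Suc m) w) (drop (Suc m) w)) = (\<Sum>w1\<in>W (Suc m). \<Sum>w2\<in>W (n - Suc m). h w1 w2)"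
proof -
  have n: "n = Suc m + (n - Suc m)" using assms by simp
  have "(\<Sum>w\<in>W n. h (take (Suc m) w) (drop (Suc m) w)) = (\<Sum>w1\<in>W (Suc m). \<Sum>w2\<in>W (n - Suc m). h (take (Suc m) (w1 @ w2)) (drop (Suc m) (w1 @ w2)))"
    by (subst n) (rule sum_words_add)
  also have "\<dots> = (\<Sum>w1\<in>W (Suc m). \<Sum>w2\<in>W (n - Suc m). h w1 w2)"
    by (intro sum.cong refl) (simp add: words_def)
  finally show ?thesis .
qed

lemma take_drop_words: "w \<in> W n \<Longrightarrow> m \<le> n \<Longrightarrow> take m w \<in> W m \<and> drop m w \<in> W (n - m)"
  by (auto simp: words_def dest: in_set_takeD in_set_dropD)

lemma Fw_take_drop: "Fw (take m w) (Fw (drop m w) x) = Fw w x"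
  using word_map_append[of F "take m w" "drop m w"] by simp

text \<open>
  The value at \<open>Fw w p\<close> of the constants carried by the cutoffs: every ancestor of the cell \<open>w\<close>, of positive level,
  contributes its jump times its cutoff.
\<close>

definition interpolant :: "('a set \<Rightarrow> 'a \<Rightarrow> real) \<Rightarrow> ('a \<Rightarrow> real) \<Rightarrow> nat list \<Rightarrow> 'a \<Rightarrow> real" where
  "interpolant T v w p = (\<Sum>m<length w. jump v (take (Suc m) w) *
     T (boundary_part (take (Suc m) w)) (Fw (drop (Suc m) w) p))"

text \<open>
  At a boundary point the cutoffs of all ancestors are 1: such a point is related, inside each ancestor, to a vertex in
  its boundary part, and cutoffs are constant on classes.  The jumps then telescope.
\<close>

lemma interpolant_boundary:
  assumes T: "cutoff_family T D \<tau>"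
    and w: "w \<in> W n" and p: "p \<in> V 0" "Fw w p \<in> boundary_points"
  shows "interpolant T v w p = base_value v w"
proof -
  have len: "length w = n" using w by (simp add: words_def)
  have one: "jump v (take (Suc m) w) * T (boundary_part (take (Suc m) w)) (Fw (drop (Suc m) w) p)
     = base_value v (take (Suc m) w) - base_value v (take m w)" if m: "m < n" for m
  proof -
    let ?u = "take (Suc m) w" and ?x = "Fw (drop (Suc m) w) p"
    have u: "?u \<in> W (Suc m)" "drop (Suc m) w \<in> W (n - Suc m)" using take_drop_words[OF w, of "Suc m"] m by auto
    have x: "?x \<in> Vs" using Fw_Vs[OF u(2)] p V_in_Vs by blast
    have "Fw ?u ?x \<in> boundary_points" using p(2) by (simp only: Fw_take_drop)
    then obtain q where q: "q \<in> V 0" "(?x, q) \<in> Ls" "Fw ?u q \<in> boundary_points"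
      using exit_word[OF u(1) x] by metis
    then have qb: "q \<in> boundary_part ?u" by (simp add: boundary_part_def)
    have "T (boundary_part ?u) ?x = T (boundary_part ?u) q"
      by (rule cutoff_family_Ls[OF T saturated_boundary_part[OF u(1)] q(2)])
    also have "\<dots> = indicator (boundary_part ?u) q" by (rule cutoff_family_V0[OF T saturated_boundary_part[OF u(1)] q(1)])
    also have "\<dots> = 1" using qb by simp
    finally have "T (boundary_part ?u) ?x = 1" .
    moreover have "butlast ?u = take m w" using m len by (simp add: butlast_take)
    ultimately show ?thesis using qb by (auto simp: jump_def)
  qed
  have "interpolant T v w p = (\<Sum>m<n. base_value v (take (Suc m) w) - base_value v (take m w))"
    unfolding interpolant_def len by (intro sum.cong refl one) simp
  also have "\<dots> = base_value v (take n w) - base_value v (take 0 w)" by (rule sum_lessThan_telescope)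
  finally show ?thesis using len by (simp add: base_value_def)
qed

text \<open>
  Away from the boundary points the interpolant does not depend on the cell that is used to reach the vertex.
  Ancestors common to both words contribute the same term.  Any other ancestor has the point as one of
  its vertices, where its cutoff vanishes.
\<close>

lemma interpolant_prefix_le:
  assumes T: "cutoff_family T D \<tau>"
    and w: "w \<in> W n" "w' \<in> W n'" "n \<le> n'" and p: "p \<in> V 0" "p' \<in> V 0"
    and eq: "Fw w p = Fw w' p'" and nb: "Fw w p \<notin> boundary_points"
  shows "interpolant T v w p = interpolant T v w' p'"
proof -
  have len: "length w = n" "length w' = n'" using w by (auto simp: words_def)
  have pK: "p \<in> K" "p' \<in> K" using p V0_K by auto
  \<comment> \<open>a term of either sum vanishes as soon as its argument is a vertex of level 0\<close>
  have zero: "T (boundary_part u) x = 0" if "u \<in> W k" "x \<in> V 0" "Fw u x = Fw w p" for u k x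
  proof -
    have "x \<notin> boundary_part u" using that nb by (simp add: boundary_part_def)
    then show ?thesis using cutoff_family_V0[OF T saturated_boundary_part[OF that(1)] that(2)] by simp
  qed
  have split: "interpolant T v w' p' = (\<Sum>m<n. jump v (take (Suc m) w') *
       T (boundary_part (take (Suc m) w')) (Fw (drop (Suc m) w') p'))"
    unfolding interpolant_def len
  proof (rule sum.mono_neutral_right)
    show "{..<n} \<subseteq> {..<n'}" using w(3) by auto
    show "\<forall>m\<in>{..<n'} - {..<n}. jump v (take (Suc m) w') * T (boundary_part (take (Suc m) w')) (Fw (drop (Suc m) w') p') = 0"
    proof
      fix m assume "m \<in> {..<n'} - {..<n}"
      then have m: "Suc m \<le> n'" "n \<le> Suc m" by auto
      have t: "take (Suc m) w' \<in> W (Suc m)" "drop (Suc m) w' \<in> W (n' - Suc m)"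
        using take_drop_words[OF w(2) m(1)] by auto
      have e: "Fw w p = Fw (take (Suc m) w') (Fw (drop (Suc m) w') p')" by (simp only: Fw_take_drop eq)
      have "Fw (drop (Suc m) w') p' \<in> V 0"
        using prefix_junction[OF w(1) t(1) m(2) pK(1) words_in_K[OF t(2) pK(2)] e] p(1) by blast
      then show "jump v (take (Suc m) w') * T (boundary_part (take (Suc m) w')) (Fw (drop (Suc m) w') p') = 0"
        using zero[OF t(1) _ e[symmetric]] by simp
    qed
  qed simp
  show ?thesis unfolding split unfolding interpolant_def[of T v w] len
  proof (intro sum.cong refl)
    fix m assume "m \<in> {..<n}"
    then have m: "Suc m \<le> n" "Suc m \<le> n'" using w(3) by auto
    let ?u = "take (Suc m) w" and ?u' = "take (Suc m) w'"
    let ?x = "Fw (drop (Suc m) w) p" and ?x' = "Fw (drop (Suc m) w') p'"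
    have t: "?u \<in> W (Suc m)" "drop (Suc m) w \<in> W (n - Suc m)" using take_drop_words[OF w(1) m(1)] by auto
    have t': "?u' \<in> W (Suc m)" "drop (Suc m) w' \<in> W (n' - Suc m)" using take_drop_words[OF w(2) m(2)] by auto
    have e: "Fw ?u ?x = Fw w p" "Fw ?u' ?x' = Fw w p" by (simp_all only: Fw_take_drop eq)
    have xK: "?x \<in> K" "?x' \<in> K" using words_in_K[OF t(2) pK(1)] words_in_K[OF t'(2) pK(2)] by auto
    show "jump v ?u * T (boundary_part ?u) ?x = jump v ?u' * T (boundary_part ?u') ?x'"
    proof (cases "?u = ?u'")
      case True
      then have "?x = ?x'" using e Fw_inj[of ?u ?x ?x'] by simp
      with True show ?thesis by simp
    next
      case False
      have "?x \<in> V 0" using words_junction[OF t(1) t'(1) False xK] e by simp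
      moreover have "?x' \<in> V 0" using words_junction[OF t'(1) t(1) _ xK(2,1)] False e by auto
      ultimately show ?thesis using zero[OF t(1) _ e(1)] zero[OF t'(1) _ e(2)] by simp
    qed
  qed
qed

text \<open>
  The extension is \<open>v\<close> on the boundary classes and the interpolant elsewhere.  In each cell it differs from the
  interpolant by a remainder that lives on the boundary part of the cell and is controlled by the boundary energy.
\<close>

lemma finite_energy_extension:
  assumes R0: "1 < R0"
    and qt: "\<And>n. is_quotient_trace N F K E n (Rq n)"
    and growth: "\<And>I J. I \<in> V 0 // E \<Longrightarrow> J \<in> V 0 // E \<Longrightarrow> I \<noteq> J \<Longrightarrow>
      \<exists>S. has_growth_rate (\<lambda>n. Rq n I J) S \<and> S > R0"
    and ext: "\<And>J u. J \<in> Vs // Ls \<Longrightarrow> boundary_class N F K J \<Longrightarrow> nontrivial_class J \<Longrightarrow>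
      \<exists>v. (\<forall>x\<in>J \<inter> V 0. v x = (u x :: real)) \<and> bdd_above (range (\<lambda>n. R0 ^ n * class_energy N F K J n v))"
  shows "\<exists>f A. (\<forall>p\<in>V 0. f p = u p) \<and> 0 \<le> A \<and> (\<forall>n. En n f \<le> A * (1 / R0) ^ n)"
proof -
  obtain \<kappa> where \<kappa>_eq: "1 / R0 = \<kappa>" by simp
  have \<kappa>: "0 < \<kappa>" "\<kappa> < 1" using R0 by (auto simp: \<kappa>_eq[symmetric])
  obtain \<tau> D T where \<tau>: "0 < \<tau>" "\<tau> < \<kappa>" and D: "0 \<le> D" and T: "cutoff_family T D \<tau>"
    by (rule saturated_extension[OF qt growth R0, unfolded \<kappa>_eq]) (assumption | rule that)+
  obtain v A where v: "\<And>p. p \<in> V 0 \<Longrightarrow> v p = u p" and A: "0 \<le> A"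
    and be: "\<And>n. 1 \<le> n \<Longrightarrow> (\<Sum>w\<in>W n. boundary_energy w v) \<le> A * \<kappa> ^ n"
    by (rule boundary_class_extension[OF ext R0, unfolded \<kappa>_eq]) (assumption | rule that)+
  obtain B where B: "0 \<le> B" "\<And>n. (\<Sum>w\<in>W n. (jump v w)\<^sup>2) \<le> B * \<kappa> ^ n"
    by (rule sum_jump_le[OF \<kappa> A be]) (assumption | rule that)+
  \<comment> \<open>the choice of a cell is immaterial by \<open>interpolant_prefix_le\<close>\<close>
  define f where "f y = (if y \<in> boundary_points then v y else
     (let z = SOME z. set (fst z) \<subseteq> {1..N} \<and> snd z \<in> V 0 \<and> y = Fw (fst z) (snd z) in interpolant T v (fst z) (snd z)))" for y
  have f_off: "f (Fw w p) = interpolant T v w p" if w: "w \<in> W n" "p \<in> V 0" "Fw w p \<notin> boundary_points" for w n p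
  proof -
    define z where "z = (SOME z. set (fst z) \<subseteq> {1..N} \<and> snd z \<in> V 0 \<and> Fw w p = Fw (fst z) (snd z))"
    have "set (fst z) \<subseteq> {1..N} \<and> snd z \<in> V 0 \<and> Fw w p = Fw (fst z) (snd z)"
      unfolding z_def by (rule someI[of _ "(w, p)"]) (use w in \<open>simp add: words_def\<close>)
    then have z: "fst z \<in> W (length (fst z))" "snd z \<in> V 0" "Fw w p = Fw (fst z) (snd z)"
      by (auto simp: words_def)
    have "interpolant T v (fst z) (snd z) = interpolant T v w p"
    proof (cases "n \<le> length (fst z)")
      case True
      then show ?thesis using interpolant_prefix_le[OF T w(1) z(1) True w(2) z(2,3) w(3), of v] by simp
    next
      case False
      then show ?thesis
        using interpolant_prefix_le[OF T z(1) w(1) _ z(2) w(2) z(3)[symmetric], of v] w(3) z(3) by simp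
    qed
    then show ?thesis unfolding f_def z_def[symmetric] using w(3) by (simp add: Let_def)
  qed
  define rem where "rem w p = (if Fw w p \<in> boundary_points then v (Fw w p) - base_value v w else 0)" for w p
  have f_eq: "f (Fw w p) = interpolant T v w p + rem w p" if w: "w \<in> W n" "p \<in> V 0" for w n p
  proof (cases "Fw w p \<in> boundary_points")
    case True
    have "interpolant T v w p = base_value v w" by (rule interpolant_boundary[OF T w True])
    then show ?thesis using True by (simp add: rem_def f_def)
  next
    case False
    then show ?thesis using f_off[OF w False] by (simp add: rem_def)
  qed
  \<comment> \<open>the weight lies strictly between \<open>\<tau> / \<kappa>\<close> and 1, so that the decay of the cutoffs relative to \<open>\<kappa> ^ n\<close> beats the loss in the weighted inequality\<close>
  define s where "s = sqrt (\<tau> / \<kappa>)"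
  have s: "0 < s" "s < 1" "s * s = \<tau> / \<kappa>" using \<tau> \<kappa> by (auto simp: s_def)
  have main: "(\<Sum>w\<in>W n. pair_energy (V 0) (interpolant T v w)) \<le> D * B / (1 - s) / (1 - s) * \<kappa> ^ n" for n
  proof -
    let ?t = "\<lambda>m w. (jump v (take (Suc m) w))\<^sup>2 * pair_energy (V 0) (T (boundary_part (take (Suc m) w)) \<circ> Fw (drop (Suc m) w))"
    have level: "(\<Sum>w\<in>W n. ?t m w) \<le> B * \<kappa> ^ Suc m * (D * \<tau> ^ (n - Suc m))" if m: "m < n" for m
    proof -
      have "(\<Sum>w\<in>W n. ?t m w) = (\<Sum>w1\<in>W (Suc m). \<Sum>w2\<in>W (n - Suc m). (jump v w1)\<^sup>2 * pair_energy (V 0) (T (boundary_part w1) \<circ> Fw w2))"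
        by (rule sum_take_drop[OF m])
      also have "\<dots> = (\<Sum>w1\<in>W (Suc m). (jump v w1)\<^sup>2 * En (n - Suc m) (T (boundary_part w1)))"
        by (simp add: energy_eq sum_distrib_left)
      also have "\<dots> \<le> (\<Sum>w1\<in>W (Suc m). (jump v w1)\<^sup>2 * (D * \<tau> ^ (n - Suc m)))"
        by (intro sum_mono mult_left_mono cutoff_family_energy[OF T saturated_boundary_part]) auto
      also have "\<dots> = (\<Sum>w1\<in>W (Suc m). (jump v w1)\<^sup>2) * (D * \<tau> ^ (n - Suc m))" by (simp add: sum_distrib_right)
      also have "\<dots> \<le> B * \<kappa> ^ Suc m * (D * \<tau> ^ (n - Suc m))"
        using D \<tau> by (intro mult_right_mono B(2)) auto
      finally show ?thesis .
    qed
    have "(\<Sum>w\<in>W n. pair_energy (V 0) (interpolant T v w)) \<le> (\<Sum>w\<in>W n. (\<Sum>m<n. ?t m w / s ^ (n - Suc m)) / (1 - s))"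
    proof (rule sum_mono)
      fix w assume "w \<in> W n"
      then have len: "length w = n" by (simp add: words_def)
      have "interpolant T v w = (\<lambda>p. \<Sum>m<n. jump v (take (Suc m) w) *
          (T (boundary_part (take (Suc m) w)) \<circ> Fw (drop (Suc m) w)) p)"
        by (simp add: fun_eq_iff interpolant_def len)
      then show "pair_energy (V 0) (interpolant T v w) \<le> (\<Sum>m<n. ?t m w / s ^ (n - Suc m)) / (1 - s)"
        using pair_energy_weighted_sum_le[OF s(1,2), where A = "V 0" and n = n
            and c = "\<lambda>m. jump v (take (Suc m) w)"
            and g = "\<lambda>m. T (boundary_part (take (Suc m) w)) \<circ> Fw (drop (Suc m) w)"] by simp
    qed
    also have "\<dots> = (\<Sum>m<n. (\<Sum>w\<in>W n. ?t m w) / s ^ (n - Suc m)) / (1 - s)"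
      by (subst sum_divide_distrib[symmetric], subst sum.swap) (simp add: sum_divide_distrib)
    also have "\<dots> \<le> (\<Sum>m<n. B * \<kappa> ^ Suc m * (D * \<tau> ^ (n - Suc m)) / s ^ (n - Suc m)) / (1 - s)"
      using s by (intro divide_right_mono sum_mono level) auto
    also have "(\<Sum>m<n. B * \<kappa> ^ Suc m * (D * \<tau> ^ (n - Suc m)) / s ^ (n - Suc m)) = (\<Sum>m<n. D * B * \<kappa> ^ n * s ^ (n - Suc m))"
    proof (intro sum.cong refl)
      fix m assume "m \<in> {..<n}"
      then have n: "\<kappa> ^ n = \<kappa> ^ Suc m * \<kappa> ^ (n - Suc m)" by (subst power_add[symmetric]) simp
      have "\<tau> = s * s * \<kappa>" using s(3) \<kappa> by (simp add: field_simps)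
      then have "\<tau> ^ (n - Suc m) = s ^ (n - Suc m) * s ^ (n - Suc m) * \<kappa> ^ (n - Suc m)"
        by (simp add: power_mult_distrib)
      then show "B * \<kappa> ^ Suc m * (D * \<tau> ^ (n - Suc m)) / s ^ (n - Suc m) = D * B * \<kappa> ^ n * s ^ (n - Suc m)"
        using s by (simp add: n mult_ac)
    qed
    also have "\<dots> = D * B * \<kappa> ^ n * (\<Sum>m<n. s ^ m)"
      using sum.nat_diff_reindex[of "\<lambda>m. s ^ m" n] by (simp add: sum_distrib_left[symmetric])
    also have "\<dots> \<le> D * B * \<kappa> ^ n * (1 / (1 - s))"
    proof (intro mult_left_mono)
      show "(\<Sum>k<n. s ^ k) \<le> 1 / (1 - s)" by (rule geometric_sum_le[OF s(1,2)])
    qed (use D B \<kappa> in simp)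
    finally show ?thesis using s by (simp add: divide_right_mono mult_ac)
  qed
  have rest: "(\<Sum>w\<in>W n. pair_energy (V 0) (rem w)) \<le> 2 * (real (card (V 0)))\<^sup>2 * A * \<kappa> ^ n" if n: "1 \<le> n" for n
  proof -
    have "pair_energy (V 0) (rem w) \<le> 2 * (real (card (V 0)))\<^sup>2 * boundary_energy w v" if w: "w \<in> W n" for w
    proof -
      have ne: "w \<noteq> []" using w n by (auto simp: words_def)
      have r: "(rem w p)\<^sup>2 \<le> boundary_energy w v" if p: "p \<in> V 0" for p
      proof (cases "Fw w p \<in> boundary_points")
        case True
        then have pb: "p \<in> boundary_part w" using p by (simp add: boundary_part_def)
        then have "base_point w \<in> boundary_part w" by (intro base_point) auto
        then show ?thesis using diff_le_boundary_energy[OF pb, of "base_point w" v] True ne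
          by (simp add: rem_def base_value_def)
      qed (simp add: rem_def boundary_energy_nonneg)
      have "pair_energy (V 0) (rem w) \<le> 1/2 * (\<Sum>x\<in>V 0. \<Sum>y\<in>V 0. 4 * boundary_energy w v)"
        unfolding pair_energy_def
      proof (intro mult_left_mono sum_mono)
        fix x y assume "x \<in> V 0" "y \<in> V 0"
        then have "(rem w x)\<^sup>2 \<le> boundary_energy w v" "(rem w y)\<^sup>2 \<le> boundary_energy w v" using r by auto
        then show "\<bar>rem w x - rem w y\<bar>\<^sup>2 \<le> 4 * boundary_energy w v"
          using zero_le_power2[of "rem w x + rem w y"] by (simp add: power2_eq_square algebra_simps)
      qed auto
      then show ?thesis by (simp add: power2_eq_square mult_ac)
    qed
    then have "(\<Sum>w\<in>W n. pair_energy (V 0) (rem w)) \<le> 2 * (real (card (V 0)))\<^sup>2 * (\<Sum>w\<in>W n. boundary_energy w v)"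
      unfolding sum_distrib_left by (intro sum_mono)
    also have "\<dots> \<le> 2 * (real (card (V 0)))\<^sup>2 * (A * \<kappa> ^ n)" using be[OF n] by (intro mult_left_mono) auto
    finally show ?thesis by (simp add: mult_ac)
  qed
  define A1 where "A1 = 2 * (D * B / (1 - s) / (1 - s)) + 2 * (2 * (real (card (V 0)))\<^sup>2 * A)"
  have A1: "0 \<le> A1" using D B A s by (simp add: A1_def)
  have "En n f \<le> A1 * \<kappa> ^ n" if n: "1 \<le> n" for n
  proof -
    have "En n f \<le> (\<Sum>w\<in>W n. 2 * pair_energy (V 0) (interpolant T v w) + 2 * pair_energy (V 0) (rem w))"
      unfolding energy_eq
    proof (rule sum_mono)
      fix w assume w: "w \<in> W n"
      have "pair_energy (V 0) (f \<circ> Fw w) = pair_energy (V 0) (\<lambda>p. interpolant T v w p + rem w p)"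
        by (rule pair_energy_cong) (simp add: f_eq[OF w])
      also have "\<dots> \<le> 2 * pair_energy (V 0) (interpolant T v w) + 2 * pair_energy (V 0) (rem w)"
        by (rule pair_energy_add_le)
      finally show "pair_energy (V 0) (f \<circ> Fw w) \<le> 2 * pair_energy (V 0) (interpolant T v w) + 2 * pair_energy (V 0) (rem w)" .
    qed
    also have "\<dots> \<le> A1 * \<kappa> ^ n"
    proof -
      have "A1 * \<kappa> ^ n = 2 * (D * B / (1 - s) / (1 - s) * \<kappa> ^ n) + 2 * (2 * (real (card (V 0)))\<^sup>2 * A * \<kappa> ^ n)"
        by (simp only: A1_def distrib_right mult.assoc)
      then show ?thesis using main[of n] rest[OF n] by (simp add: sum.distrib sum_distrib_left[symmetric])
    qed
    finally show ?thesis .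
  qed
  then obtain A2 where "0 \<le> A2" "\<And>n. En n f \<le> A2 * \<kappa> ^ n"
    using geometric_bound_from[where a = "\<lambda>n. En n f", OF \<kappa>(1) A1] by metis
  moreover have "f p = u p" if "p \<in> V 0" for p using that V0_boundary_points v by (auto simp: f_def)
  ultimately show ?thesis unfolding \<kappa>_eq by blast
qed

end

section \<open>The critical exponent\<close>

text \<open>
  The function \<open>u\<close> itself competes in the minimum that defines the trace.
\<close>

lemma (in homogeneous_pcf) trace_bound:
  assumes trace: "is_trace N F K n R" and pos: "\<And>x y. x \<in> V 0 \<Longrightarrow> y \<in> V 0 \<Longrightarrow> x \<noteq> y \<Longrightarrow> 0 < R x y"
    and pq: "p \<in> V 0" "q \<in> V 0" "p \<noteq> q"
  shows "(u p - u q)\<^sup>2 \<le> 2 * R p q * En n u"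
proof -
  let ?f = "\<lambda>x y. 1 / R x y * \<bar>u x - u y\<bar>\<^sup>2"
  have nonneg: "0 \<le> ?f x y" if "x \<in> V 0" "y \<in> V 0" for x y
    using pos[OF that] by (cases "x = y") (auto simp: less_imp_le)
  have "?f p q \<le> (\<Sum>y\<in>V 0. ?f p y)"
    using pq finite_V0 nonneg by (intro member_le_sum) auto
  also have "\<dots> \<le> (\<Sum>x\<in>V 0. \<Sum>y\<in>V 0. ?f x y)"
    using pq finite_V0 nonneg by (intro member_le_sum[of p _ "\<lambda>x. \<Sum>y\<in>V 0. ?f x y"]) (auto intro: sum_nonneg)
  also have "\<dots> = 2 * network_form (V 0) R u" by (simp add: network_form_def)
  also have "network_form (V 0) R u \<le> En n u"
  proof -
    have "is_minimum (network_form (V 0) R u) {energy N F K n v | v. \<forall>x\<in>V 0. v x = u x}"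
      using trace unfolding is_trace_def by blast
    moreover have "En n u \<in> {energy N F K n v | v. \<forall>x\<in>V 0. v x = u x}" by blast
    ultimately show ?thesis unfolding is_minimum_def by blast
  qed
  finally show ?thesis using pos[OF pq] by (simp add: field_simps)
qed

text \<open>
  A space all of whose members agree at two points of \<open>K\<close> cannot approximate a function that separates them.
\<close>

lemma (in homogeneous_pcf_measure) not_dense_above:
  assumes \<alpha>: "\<alpha> = ln (real N) / \<bar>ln \<rho>\<bar>" and \<sigma>: "\<alpha> < 2 * \<sigma>"
    and trace: "\<And>n. is_trace N F K n (Rtr n)"
    and pos: "\<And>n x y. x \<in> V 0 \<Longrightarrow> y \<in> V 0 \<Longrightarrow> x \<noteq> y \<Longrightarrow> 0 < Rtr n x y"
    and pq: "p \<in> V 0" "q \<in> V 0" "p \<noteq> q"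
    and rate: "has_growth_rate (\<lambda>n. Rtr n p q) R0" and less: "\<rho> powr (2 * \<sigma> - \<alpha>) < 1 / R0"
  shows "\<not> dense_in_C K (besov_cont K \<mu> \<alpha> \<sigma>)"
proof
  assume dense: "dense_in_C K (besov_cont K \<mu> \<alpha> \<sigma>)"
  define \<eta> where "\<eta> = \<rho> powr (2 * \<sigma> - \<alpha>)"
  have \<eta>: "0 < \<eta>" "\<eta> < 1 / R0" using rho less by (auto simp: \<eta>_def)
  have R0: "1 < R0" using rate by (simp add: has_growth_rate_def)
  have "R0 < 1 / \<eta>" using \<eta> R0 by (simp add: field_simps)
  then obtain t where t: "R0 < t" "t < 1 / \<eta>" using dense_order_class.dense by blast
  have eq: "u p = u q" if u: "u \<in> besov_cont K \<mu> \<alpha> \<sigma>" for u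
  proof -
    obtain B n0 where B: "0 \<le> B" "\<And>n. n0 \<le> n \<Longrightarrow> En n u \<le> B * \<eta> ^ n"
      by (rule energy_of_besov_cont[OF \<alpha> \<sigma> u, folded \<eta>_def]) (rule that)
    obtain M where M: "\<And>n. M \<le> n \<Longrightarrow> Rtr n p q \<le> t ^ n" by (rule growth_rate_upper[OF rate t(1)]) (rule that)
    have le: "(u p - u q)\<^sup>2 \<le> 2 * B * (t * \<eta>) ^ n" if n: "max n0 M \<le> n" for n
    proof -
      have "(u p - u q)\<^sup>2 \<le> 2 * Rtr n p q * En n u" by (rule trace_bound[OF trace pos pq])
      also have "\<dots> \<le> 2 * t ^ n * (B * \<eta> ^ n)"
        using M[of n] B(2)[of n] n pos[OF pq, of n] t(1) R0 energy_nonneg[of n u] by (intro mult_mono) auto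
      finally show ?thesis by (simp add: power_mult_distrib mult_ac)
    qed
    have "(\<lambda>n. 2 * B * (t * \<eta>) ^ n) \<longlonglongrightarrow> 2 * B * 0"
      using t \<eta> R0 by (intro tendsto_intros LIMSEQ_power_zero) (simp add: field_simps abs_mult)
    then have "(u p - u q)\<^sup>2 \<le> 2 * B * 0" by (rule LIMSEQ_le_const) (use le in blast)
    then show ?thesis by simp
  qed
  define f where "f x = dist x p / dist q p" for x
  have "continuous_on K f" unfolding f_def by (intro continuous_intros) (use pq in auto)
  then obtain u where u: "u \<in> besov_cont K \<mu> \<alpha> \<sigma>" "\<And>x. x \<in> K \<Longrightarrow> \<bar>f x - u x\<bar> < 1/2"
    using dense unfolding dense_in_C_def by (metis half_gt_zero_iff zero_less_one)
  have "f p = 0" "f q = 1" using pq by (auto simp: f_def)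
  moreover have "\<bar>f p - u p\<bar> < 1/2" "\<bar>f q - u q\<bar> < 1/2" using u(2) pq V0_K by auto
  ultimately show False using eq[OF u(1)] by linarith
qed

theorem proposition4p2:
  fixes N :: nat and \<rho> :: real and b :: "nat \<Rightarrow> real ^ 'd"
    and F :: "nat \<Rightarrow> real ^ 'd \<Rightarrow> real ^ 'd"
    and K :: "(real ^ 'd) set" and \<mu> :: "(real ^ 'd) measure" and \<alpha> :: real
    and Rtr :: "nat \<Rightarrow> real ^ 'd \<Rightarrow> real ^ 'd \<Rightarrow> real"
    and R :: "real ^ 'd \<Rightarrow> real ^ 'd \<Rightarrow> real" and Rstar :: real
    and E :: "((real ^ 'd) \<times> (real ^ 'd)) set"
    and Rq :: "nat \<Rightarrow> (real ^ 'd) set \<Rightarrow> (real ^ 'd) set \<Rightarrow> real"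
  assumes rho: "0 < \<rho>" "\<rho> < 1"
    and F: "\<And>i x. F i x = \<rho> *\<^sub>R (x - b i) + b i"
    and K: "self_similar_set N F K" "connected K" "pcf N F K"
    and V0: "2 \<le> card (vertices N F K 0)"
    and mu: "self_similar_measure N F K \<mu>"
    and alpha: "\<alpha> = ln (real N) / \<bar>ln \<rho>\<bar>"
    and trace: "\<And>n. is_trace N F K n (Rtr n)"
    and rate: "\<And>p q. p \<in> vertices N F K 0 \<Longrightarrow> q \<in> vertices N F K 0 \<Longrightarrow> p \<noteq> q \<Longrightarrow>
                 has_growth_rate (\<lambda>n. Rtr n p q) (R p q)"
    and Rstar: "Rstar = Min {R p q | p q. p \<in> vertices N F K 0 \<and> q \<in> vertices N F K 0 \<and> p \<noteq> q}"
    and E: "equiv (vertices N F K 0) E" "2 \<le> card (vertices N F K 0 // E)"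
    and compatible: "compatible N F K E"
    and B: "property_B N F K E"
    and i: "\<And>J u. J \<in> all_vertices N F K // limit_rel N F K E \<Longrightarrow> boundary_class N F K J \<Longrightarrow>
              nontrivial_class J \<Longrightarrow>
              \<exists>v. (\<forall>x\<in>J \<inter> vertices N F K 0. v x = (u x :: real)) \<and>
                  bdd_above (range (\<lambda>n. Rstar ^ n * class_energy N F K J n v))"
    and quotient_trace: "\<And>n. is_quotient_trace N F K E n (Rq n)"
    and ii: "\<And>Ji Jj. Ji \<in> vertices N F K 0 // E \<Longrightarrow> Jj \<in> vertices N F K 0 // E \<Longrightarrow> Ji \<noteq> Jj \<Longrightarrow>
               \<exists>S. has_growth_rate (\<lambda>n. Rq n Ji Jj) S \<and> S > Rstar"
  shows "dense_in_C K (besov_cont K \<mu> \<alpha> (critical_exponent K \<mu> \<alpha>))"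
proof -
  interpret homogeneous_pcf_measure N \<rho> b F K \<mu>
    by unfold_locales (fact rho F K V0 mu)+
  interpret rel: homogeneous_pcf_relation N \<rho> b F K E
    by unfold_locales (fact E compatible B)+
  let ?S = "{R p q | p q. p \<in> V 0 \<and> q \<in> V 0 \<and> p \<noteq> q}"
  have fin: "finite ?S"
    by (rule finite_subset[of _ "(\<lambda>(p, q). R p q) ` (V 0 \<times> V 0)"]) (use finite_V0 in auto)
  obtain p0 q0 where "p0 \<in> V 0" "q0 \<in> V 0" "p0 \<noteq> q0" by (rule V0_two)
  then have "?S \<noteq> {}" by blast
  then have "Rstar \<in> ?S" unfolding Rstar using fin by (rule Min_in[rotated])
  then obtain p q where pq: "p \<in> V 0" "q \<in> V 0" "p \<noteq> q" "Rstar = R p q" by blast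
  have ratepq: "has_growth_rate (\<lambda>n. Rtr n p q) Rstar" using rate[OF pq(1-3)] pq(4) by simp
  then have R1: "1 < Rstar" by (simp add: has_growth_rate_def)
  have pos: "0 < Rtr n x y" if "x \<in> V 0" "y \<in> V 0" "x \<noteq> y" for n x y
    using rate[OF that] by (simp add: has_growth_rate_def)
  have lr: "ln \<rho> < 0" using rho by simp
  define \<sigma>0 where "\<sigma>0 = (\<alpha> + ln Rstar / \<bar>ln \<rho>\<bar>) / 2"
  have \<alpha>0: "0 < \<alpha>" by (rule dimension_pos[OF alpha])
  have "0 < ln Rstar / \<bar>ln \<rho>\<bar>" using R1 lr by (intro divide_pos_pos) auto
  then have \<sigma>0: "0 < \<sigma>0" "\<alpha> < 2 * \<sigma>0" using \<alpha>0 by (auto simp: \<sigma>0_def)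
  have \<kappa>: "\<rho> powr (2 * \<sigma>0 - \<alpha>) = 1 / Rstar"
  proof -
    have "(2 * \<sigma>0 - \<alpha>) * ln \<rho> = - ln Rstar" using lr by (simp add: \<sigma>0_def field_simps)
    then show ?thesis using rho R1 by (simp add: powr_def exp_minus inverse_eq_divide)
  qed
  have dense0: "dense_in_C K (besov_cont K \<mu> \<alpha> \<sigma>0)"
    unfolding dense_in_C_def
  proof (intro conjI allI impI)
    show "besov_cont K \<mu> \<alpha> \<sigma>0 \<subseteq> {u. continuous_on K u}" by (auto simp: besov_cont_def)
    fix f :: "real ^ 'd \<Rightarrow> real" and \<epsilon> :: real
    assume f: "continuous_on K f" and \<epsilon>: "0 < \<epsilon>"
    have \<kappa>01: "0 < 1 / Rstar" "1 / Rstar < 1" using R1 by auto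
    obtain h A where h: "continuous_on K h" "0 \<le> A" "\<And>n. En n h \<le> A * (1 / Rstar) ^ n"
      "\<And>x. x \<in> K \<Longrightarrow> \<bar>f x - h x\<bar> < \<epsilon>"
      by (rule finite_energy_dense[OF rel.finite_energy_extension[OF R1 quotient_trace ii i] \<kappa>01 f \<epsilon>]) (assumption | rule that)+
    have "h \<in> besov_cont K \<mu> \<alpha> \<sigma>0"
      by (rule besov_cont_of_energy[OF alpha \<sigma>0(2) h(1) _ h(2)]) (simp only: \<kappa> h(3))
    then show "\<exists>u\<in>besov_cont K \<mu> \<alpha> \<sigma>0. \<forall>x\<in>K. \<bar>f x - u x\<bar> < \<epsilon>" using h(4) by blast
  qed
  have upper: "\<sigma> \<le> \<sigma>0" if "dense_in_C K (besov_cont K \<mu> \<alpha> \<sigma>)" for \<sigma>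
  proof (rule ccontr)
    assume "\<not> \<sigma> \<le> \<sigma>0"
    then have "\<rho> powr (2 * \<sigma> - \<alpha>) < 1 / Rstar" unfolding \<kappa>[symmetric]
      using rho by (intro powr_less_mono') auto
    moreover have "\<alpha> < 2 * \<sigma>" using \<open>\<not> \<sigma> \<le> \<sigma>0\<close> \<sigma>0(2) by linarith
    ultimately show False using not_dense_above[OF alpha _ trace pos pq(1-3) ratepq] that by blast
  qed
  have "critical_exponent K \<mu> \<alpha> = \<sigma>0"
    unfolding critical_exponent_def by (rule cSup_eq_maximum) (use \<sigma>0(1) dense0 upper in auto)
  then show ?thesis using dense0 by simp
qed

end
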